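(* Let $R$ be an Artin algebra, let $k\ge 1$, and let $\ell=\mathrm{LL}(R)$ be the Loewy length of $R$. If $m=k\text{-}\mathrm{ddell}(R)<\infty$, then $$k\text{-}\mathrm{gddell}(R)\le \ell(m+1)-1.$$ Consequently, $k\text{-}\mathrm{ddell}(R)<\infty$ if and only if $k\text{-}\mathrm{gddell}(R)<\infty$.
   Context: All modules are finitely generated right modules; $\mathrm{mod}\,R$ is the category of such $R$-modules. The Loewy length of $R$ is the least $\ell$ with $(\mathrm{rad}\,R)^\ell=0$. $\Omega^n(M)$ is the $n$-th syzygy module of $M$ ($\Omega^0(M)=M$); syzygies are considered up to projective direct summands. Accordingly, "$X$ is a direct summand of $Y$" for syzygies $X,Y$ means that $X$ is a direct summand of $Y\oplus Q$ for some finitely generated projective $Q$. For $k\ge1$ and $M\in\mathrm{mod}\,R$, $k\text{-}\mathrm{dell}(M)=\inf\{n\ge 0\mid \Omega^n(M)\text{ is a direct summand of }\Omega^{n+k}(N)\text{ for some }N\in\mathrm{mod}\,R\}$, and $k\text{-}\mathrm{ddell}(M)$ is the infimum of all $m\in\mathbb N$ for which there exist $n\le m$ and an exact sequence $0\to C_n\to\cdots\to C_0\to M\to 0$ in $\mathrm{mod}\,R$ with $(i+k)\text{-}\mathrm{dell}(C_i)\le m-i$ for $i=0,\dots,n$. The infimum of the empty set is $\infty$. Then $k\text{-}\mathrm{ddell}(R)=\sup\{k\text{-}\mathrm{ddell}(L)\mid L\text{ a simple }R\text{-module}\}$ and $k\text{-}\mathrm{gddell}(R)=\sup\{k\text{-}\mathrm{ddell}(M)\mid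 M\in\mathrm{mod}\,R\}$. *)

theory Defs
  imports "HOL-Library.Extended_Nat" "HOL-Algebra.Module" "HOL-Algebra.Ideal_Product"
begin

section \<open>Artin algebras\<close>

text \<open>A set generates a module if no proper submodule contains it.  The library predicate
  \<^const>\<open>submodule\<close> uses only the carrier of the scalar ring and the operations of the module,
  so it serves right modules over non-commutative rings just as well.\<close>

definition fin_gen :: "('r, 'x) ring_scheme \<Rightarrow> ('r, 'm, 'y) module_scheme \<Rightarrow> bool" where
  "fin_gen R M \<longleftrightarrow> (\<exists>A \<subseteq> carrier M. finite A \<and>
     (\<forall>H. submodule H R M \<and> A \<subseteq> H \<longrightarrow> H = carrier M))"

definition artinian_cring :: "('s, 'x) ring_scheme \<Rightarrow> bool" where
  "artinian_cring S \<longleftrightarrow> cring S \<and>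
     (\<forall>I :: nat \<Rightarrow> 's set. (\<forall>n. ideal (I n) S \<and> I (Suc n) \<subseteq> I n) \<longrightarrow> (\<exists>n. \<forall>m\<ge>n. I m = I n))"

text \<open>The record \<open>R\<close> carries both the ring structure and the scalar action of \<open>S\<close>; the
  library locale \<^locale>\<open>algebra\<close> is not applicable because it makes \<open>R\<close> commutative.\<close>

locale artin_algebra = ring R + module S R
  for S :: "('s, 'x) ring_scheme" and R :: "('s, 'r, 'y) module_scheme" (structure) +
  assumes base_artinian: "artinian_cring S"
    and smult_mult_left:
      "\<lbrakk>a \<in> carrier S; x \<in> carrier R; y \<in> carrier R\<rbrakk> \<Longrightarrow> (a \<odot> x) \<otimes> y = a \<odot> (x \<otimes> y)"
    and smult_mult_right:
      "\<lbrakk>a \<in> carrier S; x \<in> carrier R; y \<in> carrier R\<rbrakk> \<Longrightarrow> x \<otimes> (a \<odot> y) = a \<odot> (x \<otimes> y)"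
    and fin_gen_over_base: "fin_gen S R"


section \<open>Right modules\<close>

text \<open>Right modules use the library's module record: \<open>smult M a x\<close> stands for \<open>x a\<close>.  Hence the
  order of the factors in \<open>smult_assoc\<close>, which says \<open>x (a b) = (x a) b\<close>.  The fields \<open>mult\<close> and
  \<open>one\<close> of the record are never used.\<close>

locale right_module = R?: ring R + M?: abelian_group M
  for R :: "('r, 'x) ring_scheme" (structure) and M :: "('r, 'm, 'y) module_scheme" (structure) +
  assumes smult_closed [simp, intro]:
      "\<lbrakk>a \<in> carrier R; x \<in> carrier M\<rbrakk> \<Longrightarrow> a \<odot>\<^bsub>M\<^esub> x \<in> carrier M"
    and smult_ring_distr:
      "\<lbrakk>a \<in> carrier R; b \<in> carrier R; x \<in> carrier M\<rbrakk> \<Longrightarrow>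
       (a \<oplus> b) \<odot>\<^bsub>M\<^esub> x = a \<odot>\<^bsub>M\<^esub> x \<oplus>\<^bsub>M\<^esub> b \<odot>\<^bsub>M\<^esub> x"
    and smult_module_distr:
      "\<lbrakk>a \<in> carrier R; x \<in> carrier M; y \<in> carrier M\<rbrakk> \<Longrightarrow>
       a \<odot>\<^bsub>M\<^esub> (x \<oplus>\<^bsub>M\<^esub> y) = a \<odot>\<^bsub>M\<^esub> x \<oplus>\<^bsub>M\<^esub> a \<odot>\<^bsub>M\<^esub> y"
    and smult_assoc:
      "\<lbrakk>a \<in> carrier R; b \<in> carrier R; x \<in> carrier M\<rbrakk> \<Longrightarrow>
       (a \<otimes> b) \<odot>\<^bsub>M\<^esub> x = b \<odot>\<^bsub>M\<^esub> (a \<odot>\<^bsub>M\<^esub> x)"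
    and smult_one [simp]:
      "x \<in> carrier M \<Longrightarrow> \<one> \<odot>\<^bsub>M\<^esub> x = x"

definition rmod_hom ::
    "('r, 'x) ring_scheme \<Rightarrow> ('r, 'm) module \<Rightarrow> ('r, 'n) module \<Rightarrow> ('m \<Rightarrow> 'n) set" where
  "rmod_hom R M N = {f \<in> carrier M \<rightarrow> carrier N.
     (\<forall>x\<in>carrier M. \<forall>y\<in>carrier M. f (x \<oplus>\<^bsub>M\<^esub> y) = f x \<oplus>\<^bsub>N\<^esub> f y) \<and>
     (\<forall>a\<in>carrier R. \<forall>x\<in>carrier M. f (a \<odot>\<^bsub>M\<^esub> x) = a \<odot>\<^bsub>N\<^esub> f x)}"

definition rmod_iso ::
    "('r, 'x) ring_scheme \<Rightarrow> ('r, 'm) module \<Rightarrow> ('r, 'n) module \<Rightarrow> bool" where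
  "rmod_iso R M N \<longleftrightarrow> (\<exists>f \<in> rmod_hom R M N. bij_betw f (carrier M) (carrier N))"

definition direct_sum :: "('r, 'm) module \<Rightarrow> ('r, 'n) module \<Rightarrow> ('r, 'm \<times> 'n) module" where
  "direct_sum M N =
     \<lparr>carrier = carrier M \<times> carrier N, mult = undefined, one = undefined,
      zero = (\<zero>\<^bsub>M\<^esub>, \<zero>\<^bsub>N\<^esub>),
      add = (\<lambda>x y. (fst x \<oplus>\<^bsub>M\<^esub> fst y, snd x \<oplus>\<^bsub>N\<^esub> snd y)),
      smult = (\<lambda>a x. (a \<odot>\<^bsub>M\<^esub> fst x, a \<odot>\<^bsub>N\<^esub> snd x))\<rparr>"

definition direct_summand ::
    "('r, 'x) ring_scheme \<Rightarrow> ('r, 'm) module \<Rightarrow> ('r, 'n) module \<Rightarrow> bool" where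
  "direct_summand R X Z \<longleftrightarrow> (\<exists>A B. submodule A R Z \<and> submodule B R Z \<and>
     A <+>\<^bsub>Z\<^esub> B = carrier Z \<and> A \<inter> B = {\<zero>\<^bsub>Z\<^esub>} \<and> rmod_iso R X (Z\<lparr>carrier := A\<rparr>))"

definition regular_module :: "('r, 'x) ring_scheme \<Rightarrow> ('r, 'r) module" where
  "regular_module R =
     \<lparr>carrier = carrier R, mult = mult R, one = one R, zero = zero R, add = add R,
      smult = (\<lambda>a x. x \<otimes>\<^bsub>R\<^esub> a)\<rparr>"

definition simple_rmodule :: "('r, 'x) ring_scheme \<Rightarrow> ('r, 'm) module \<Rightarrow> bool" where
  "simple_rmodule R L \<longleftrightarrow> right_module R L \<and> carrier L \<noteq> {\<zero>\<^bsub>L\<^esub>} \<and>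
     (\<forall>H. submodule H R L \<longrightarrow> H = {\<zero>\<^bsub>L\<^esub>} \<or> H = carrier L)"


section \<open>The category of finitely generated right modules\<close>

text \<open>HOL cannot quantify over modules of all types inside a formula.  The category is therefore
  formed by the finitely generated right modules whose elements are sets of sequences in \<open>R\<close>.
  Every finitely generated module is isomorphic to one of these, its elements being
  identified with cosets of a submodule of some \<open>R\<^sup>n\<close>; see \<open>fg_module_has_copy\<close> below.\<close>

type_synonym 'r fgmod = "('r, (nat \<Rightarrow> 'r) set) module"

definition mod_cat :: "('r, 'x) ring_scheme \<Rightarrow> 'r fgmod set" where
  "mod_cat R = {M. right_module R M \<and> fin_gen R M}"

primrec lin_comb :: "('r, 'm, 'y) module_scheme \<Rightarrow> 'm list \<Rightarrow> (nat \<Rightarrow> 'r) \<Rightarrow> 'm" where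
  "lin_comb M [] f = \<zero>\<^bsub>M\<^esub>"
| "lin_comb M (a # as) f = (f 0 \<odot>\<^bsub>M\<^esub> a) \<oplus>\<^bsub>M\<^esub> lin_comb M as (\<lambda>i. f (Suc i))"

context right_module
begin

lemma smult_zero_ring [simp]: assumes "x \<in> carrier M" shows "\<zero> \<odot>\<^bsub>M\<^esub> x = \<zero>\<^bsub>M\<^esub>"
proof -
  have c: "\<zero> \<odot>\<^bsub>M\<^esub> x \<in> carrier M" using assms by simp
  have "\<zero> \<odot>\<^bsub>M\<^esub> x \<oplus>\<^bsub>M\<^esub> \<zero> \<odot>\<^bsub>M\<^esub> x = \<zero> \<odot>\<^bsub>M\<^esub> x"
    using smult_ring_distr[of \<zero> \<zero> x] assms by simp
  then show ?thesis using c by (metis M.add.r_cancel_one')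
qed

lemma smult_zero_module [simp]: assumes "a \<in> carrier R" shows "a \<odot>\<^bsub>M\<^esub> \<zero>\<^bsub>M\<^esub> = \<zero>\<^bsub>M\<^esub>"
proof -
  have c: "a \<odot>\<^bsub>M\<^esub> \<zero>\<^bsub>M\<^esub> \<in> carrier M" using assms by simp
  have "a \<odot>\<^bsub>M\<^esub> \<zero>\<^bsub>M\<^esub> \<oplus>\<^bsub>M\<^esub> a \<odot>\<^bsub>M\<^esub> \<zero>\<^bsub>M\<^esub> = a \<odot>\<^bsub>M\<^esub> \<zero>\<^bsub>M\<^esub>"
    using smult_module_distr[of a "\<zero>\<^bsub>M\<^esub>" "\<zero>\<^bsub>M\<^esub>"] assms by simp
  then show ?thesis using c by (metis M.add.r_cancel_one')
qed

lemma smult_minus_one: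
  assumes "x \<in> carrier M" shows "(\<ominus> \<one>) \<odot>\<^bsub>M\<^esub> x = \<ominus>\<^bsub>M\<^esub> x"
proof -
  have "(\<ominus> \<one>) \<odot>\<^bsub>M\<^esub> x \<oplus>\<^bsub>M\<^esub> x = \<zero>\<^bsub>M\<^esub>"
    using smult_ring_distr[of "\<ominus> \<one>" \<one> x] assms by (simp add: R.l_neg)
  then show ?thesis using assms by (simp add: M.minus_equality)
qed

lemma submoduleI:
  assumes "H \<subseteq> carrier M" "\<zero>\<^bsub>M\<^esub> \<in> H"
    and add: "\<And>x y. \<lbrakk>x \<in> H; y \<in> H\<rbrakk> \<Longrightarrow> x \<oplus>\<^bsub>M\<^esub> y \<in> H"
    and smult: "\<And>a x. \<lbrakk>a \<in> carrier R; x \<in> H\<rbrakk> \<Longrightarrow> a \<odot>\<^bsub>M\<^esub> x \<in> H"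
  shows "submodule H R M"
proof -
  have "\<ominus>\<^bsub>M\<^esub> x \<in> H" if "x \<in> H" for x
    using smult[of "\<ominus> \<one>" x] that assms(1) smult_minus_one[of x] by auto
  then show ?thesis
    unfolding submodule_def submodule_axioms_def subgroup_def
    using assms by (auto simp: a_inv_def)
qed

lemma lin_comb_closed:
  "\<lbrakk>set as \<subseteq> carrier M; (\<forall>i. f i \<in> carrier R)\<rbrakk> \<Longrightarrow> lin_comb M as f \<in> carrier M"
  by (induction as arbitrary: f) auto

lemma lin_comb_add:
  "\<lbrakk>set as \<subseteq> carrier M; (\<forall>i. f i \<in> carrier R); (\<forall>i. g i \<in> carrier R)\<rbrakk> \<Longrightarrow>
   lin_comb M as f \<oplus>\<^bsub>M\<^esub> lin_comb M as g = lin_comb M as (\<lambda>i. f i \<oplus> g i)"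
proof (induction as arbitrary: f g)
  case Nil then show ?case by simp
next
  case (Cons a as)
  have r: "\<forall>i. f (Suc i) \<in> carrier R" "\<forall>i. g (Suc i) \<in> carrier R"
    "f 0 \<in> carrier R" "g 0 \<in> carrier R" "a \<in> carrier M" "set as \<subseteq> carrier M"
    using Cons.prems by auto
  show ?case
    using Cons.IH[OF r(6,1,2)] r lin_comb_closed[OF r(6,1)] lin_comb_closed[OF r(6,2)]
    by (simp add: smult_ring_distr M.a_ac flip: Cons.IH[OF r(6,1,2)])
qed

lemma lin_comb_smult:
  "\<lbrakk>set as \<subseteq> carrier M; (\<forall>i. f i \<in> carrier R); b \<in> carrier R\<rbrakk> \<Longrightarrow>
   b \<odot>\<^bsub>M\<^esub> lin_comb M as f = lin_comb M as (\<lambda>i. f i \<otimes> b)"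
proof (induction as arbitrary: f)
  case Nil then show ?case by simp
next
  case (Cons a as)
  have r: "\<forall>i. f (Suc i) \<in> carrier R" "f 0 \<in> carrier R" "a \<in> carrier M"
    "set as \<subseteq> carrier M"
    using Cons.prems by auto
  show ?case
    using Cons.IH[OF r(4,1) Cons.prems(3)] r lin_comb_closed[OF r(4,1)] Cons.prems(3)
    by (simp add: smult_module_distr smult_assoc)
qed

lemma lin_comb_zero: "set as \<subseteq> carrier M \<Longrightarrow> lin_comb M as (\<lambda>i. \<zero>) = \<zero>\<^bsub>M\<^esub>"
  by (induction as) auto

lemma lin_comb_mem:
  "\<lbrakk>set as \<subseteq> carrier M; a \<in> set as\<rbrakk> \<Longrightarrow> \<exists>f. (\<forall>i. f i \<in> carrier R) \<and> lin_comb M as f = a"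
proof (induction as)
  case Nil then show ?case by simp
next
  case (Cons b as)
  show ?case
  proof (cases "a = b")
    case True
    have "lin_comb M (b # as) (case_nat \<one> (\<lambda>i. \<zero>)) = a"
      using True Cons.prems lin_comb_zero[of as] by simp
    moreover have "\<forall>i. case_nat \<one> (\<lambda>i. \<zero>) i \<in> carrier R"
      by (auto split: nat.splits)
    ultimately show ?thesis by blast
  next
    case False
    then obtain f where f: "(\<forall>i. f i \<in> carrier R)" "lin_comb M as f = a"
      using Cons by auto
    have "lin_comb M (b # as) (case_nat \<zero> f) = a"
      using f Cons.prems by auto
    moreover have "\<forall>i. case_nat \<zero> f i \<in> carrier R"
      using f(1) by (auto split: nat.splits)
    ultimately show ?thesis by blast
  qed
qed

end

lemma fg_module_lin_comb:
  assumes "right_module R M" "fin_gen R M"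
  obtains as where "set as \<subseteq> carrier M"
    "carrier M = {lin_comb M as f | f. \<forall>i. f i \<in> carrier R}"
proof -
  interpret right_module R M by fact
  obtain A where A: "A \<subseteq> carrier M" "finite A"
    "\<And>H. submodule H R M \<Longrightarrow> A \<subseteq> H \<Longrightarrow> H = carrier M"
    using assms(2) unfolding fin_gen_def by blast
  obtain as where as: "set as = A" using finite_list[OF A(2)] by blast
  define H where "H = {lin_comb M as f | f. \<forall>i. f i \<in> carrier R}"
  have s: "set as \<subseteq> carrier M" using as A(1) by simp
  have "submodule H R M"
  proof (rule submoduleI)
    show "H \<subseteq> carrier M" unfolding H_def using lin_comb_closed[OF s] by blast
    show "\<zero>\<^bsub>M\<^esub> \<in> H"
      unfolding H_def using lin_comb_zero[OF s] by (intro CollectI exI[of _ "\<lambda>i. \<zero>\<^bsub>R\<^esub>"]) auto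
  next
    fix x y assume "x \<in> H" "y \<in> H"
    then obtain f g where fg: "x = lin_comb M as f" "(\<forall>i. f i \<in> carrier R)"
      "y = lin_comb M as g" "(\<forall>i. g i \<in> carrier R)" unfolding H_def by blast
    then show "x \<oplus>\<^bsub>M\<^esub> y \<in> H"
      unfolding H_def using lin_comb_add[OF s fg(2,4)]
      by (intro CollectI exI[of _ "\<lambda>i. f i \<oplus>\<^bsub>R\<^esub> g i"]) auto
  next
    fix b x assume b: "b \<in> carrier R" and "x \<in> H"
    then obtain f where f: "x = lin_comb M as f" "(\<forall>i. f i \<in> carrier R)"
      unfolding H_def by blast
    then show "b \<odot>\<^bsub>M\<^esub> x \<in> H"
      unfolding H_def using lin_comb_smult[OF s f(2) b] b
      by (intro CollectI exI[of _ "\<lambda>i. f i \<otimes>\<^bsub>R\<^esub> b"]) auto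
  qed
  moreover have "A \<subseteq> H"
    unfolding H_def using lin_comb_mem[OF s] as by blast
  ultimately show ?thesis using A(3) that[OF s] unfolding H_def by blast
qed

lemma rmod_transport:
  fixes M :: "('r, 'm) module" and j :: "'m \<Rightarrow> 'n"
  assumes "right_module R M" "fin_gen R M" "inj_on j (carrier M)"
  shows "\<exists>N :: ('r, 'n) module. right_module R N \<and> fin_gen R N \<and> rmod_iso R M N"
proof -
  interpret right_module R M by fact
  define h where "h = the_inv_into (carrier M) j"
  have hj [simp]: "x \<in> carrier M \<Longrightarrow> h (j x) = x" for x
    unfolding h_def using assms(3) by (rule the_inv_into_f_f)
  define N :: "('r, 'n) module" where "N = \<lparr>carrier = j ` carrier M, mult = undefined, one = undefined,
    zero = j \<zero>\<^bsub>M\<^esub>, add = (\<lambda>x y. j (h x \<oplus>\<^bsub>M\<^esub> h y)), smult = (\<lambda>a x. j (a \<odot>\<^bsub>M\<^esub> h x))\<rparr>"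
  have N [simp]: "carrier N = j ` carrier M" "zero N = j \<zero>\<^bsub>M\<^esub>"
    "add N = (\<lambda>x y. j (h x \<oplus>\<^bsub>M\<^esub> h y))" "smult N = (\<lambda>a x. j (a \<odot>\<^bsub>M\<^esub> h x))"
    unfolding N_def by simp_all
  have "abelian_group N"
  proof (rule abelian_groupI)
    fix x assume "x \<in> carrier N"
    then obtain y where "y \<in> carrier M" "x = j y" by auto
    then show "\<exists>y\<in>carrier N. y \<oplus>\<^bsub>N\<^esub> x = \<zero>\<^bsub>N\<^esub>"
      by (auto intro!: bexI[of _ "\<ominus>\<^bsub>M\<^esub> y"] simp: M.l_neg)
  qed (auto simp: M.a_ac)
  then have rN: "right_module R N"
    unfolding right_module_def right_module_axioms_def
    by (auto simp: R.ring_axioms smult_ring_distr smult_module_distr smult_assoc)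
  interpret N: right_module R N by fact
  have iso: "rmod_iso R M N"
    unfolding rmod_iso_def rmod_hom_def
    using assms(3) by (intro bexI[of _ j]) (auto simp: bij_betw_def)
  obtain A where A: "A \<subseteq> carrier M" "finite A"
    "\<And>H. submodule H R M \<Longrightarrow> A \<subseteq> H \<Longrightarrow> H = carrier M"
    using assms(2) unfolding fin_gen_def by blast
  have "H = carrier N" if H: "submodule H R N" "j ` A \<subseteq> H" for H
  proof -
    interpret H: submodule H R N by fact
    have sub: "H \<subseteq> j ` carrier M" using H.subset by simp
    define K where "K = {x \<in> carrier M. j x \<in> H}"
    have "submodule K R M"
    proof (rule submoduleI)
      show "\<zero>\<^bsub>M\<^esub> \<in> K" using H.one_closed by (simp add: K_def)
    next
      fix x y assume "x \<in> K" "y \<in> K"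
      then show "x \<oplus>\<^bsub>M\<^esub> y \<in> K"
        using H.m_closed[of "j x" "j y"] by (simp add: K_def)
    next
      fix a x assume "a \<in> carrier R" "x \<in> K"
      then show "a \<odot>\<^bsub>M\<^esub> x \<in> K"
        using H.smult_closed[of a "j x"] by (simp add: K_def)
    qed (auto simp: K_def)
    moreover have "A \<subseteq> K" using A(1) H(2) by (auto simp: K_def)
    ultimately have "K = carrier M" using A(3) by blast
    then show ?thesis using sub by (auto simp: K_def)
  qed
  then have "fin_gen R N"
    unfolding fin_gen_def using A(1,2) by (intro exI[of _ "j ` A"]) auto
  with rN iso show ?thesis by blast
qed

lemma fg_module_has_copy:
  assumes "right_module R M" "fin_gen R M"
  shows "\<exists>N \<in> mod_cat R. rmod_iso R M N"
proof -
  obtain as where "set as \<subseteq> carrier M"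
    and as: "carrier M = {lin_comb M as f | f. \<forall>i. f i \<in> carrier R}"
    by (rule fg_module_lin_comb[OF assms])
  define j where "j x = {f. (\<forall>i. f i \<in> carrier R) \<and> lin_comb M as f = x}" for x
  have "inj_on j (carrier M)"
  proof (rule inj_onI)
    fix x y assume x: "x \<in> carrier M" and eq: "j x = j y"
    obtain f where f: "f \<in> j x" using x unfolding as j_def by blast
    then have "f \<in> j y" using eq by simp
    with f show "x = y" by (simp add: j_def)
  qed
  from rmod_transport[OF assms this] show ?thesis by (auto simp: mod_cat_def)
qed


section \<open>Projective modules and syzygies\<close>

definition fg_projective :: "('r, 'x) ring_scheme \<Rightarrow> 'r fgmod \<Rightarrow> bool" where
  "fg_projective R P \<longleftrightarrow> P \<in> mod_cat R \<and>
     (\<forall>A \<in> mod_cat R. \<forall>B \<in> mod_cat R. \<forall>g \<in> rmod_hom R A B. \<forall>f \<in> rmod_hom R P B.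
        g ` carrier A = carrier B \<longrightarrow>
        (\<exists>h \<in> rmod_hom R P A. \<forall>x \<in> carrier P. g (h x) = f x))"

text \<open>\<open>syzygy R n M X\<close>: the module \<open>X\<close> is an \<open>n\<close>-th syzygy of \<open>M\<close>, formed with arbitrary (not
  necessarily minimal) finitely generated projective modules mapping onto the successive syzygies;
  this determines \<open>X\<close> up to projective direct summands.\<close>

primrec syzygy :: "('r, 'x) ring_scheme \<Rightarrow> nat \<Rightarrow> 'r fgmod \<Rightarrow> 'r fgmod \<Rightarrow> bool" where
  "syzygy R 0 M X \<longleftrightarrow> X = M"
| "syzygy R (Suc n) M X \<longleftrightarrow> (\<exists>Y P p. syzygy R n M Y \<and> fg_projective R P \<and>
     p \<in> rmod_hom R P Y \<and> p ` carrier P = carrier Y \<and> X = P\<lparr>carrier := a_kernel P Y p\<rparr>)"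

definition stable_summand :: "('r, 'x) ring_scheme \<Rightarrow> 'r fgmod \<Rightarrow> 'r fgmod \<Rightarrow> bool" where
  "stable_summand R X Y \<longleftrightarrow> (\<exists>Q. fg_projective R Q \<and> direct_summand R X (direct_sum Y Q))"


section \<open>Delooping levels\<close>

definition dell :: "('r, 'x) ring_scheme \<Rightarrow> nat \<Rightarrow> 'r fgmod \<Rightarrow> enat" where
  "dell R k M = Inf {enat n | n. \<exists>N \<in> mod_cat R. \<exists>X Y.
     syzygy R n M X \<and> syzygy R (n + k) N Y \<and> stable_summand R X Y}"

text \<open>Exactness of \<open>0 \<rightarrow> C n \<rightarrow> \<dots> \<rightarrow> C 0 \<rightarrow> M \<rightarrow> 0\<close>.  In the shifted sequence \<open>E\<close> with
  \<open>E 0 = M\<close> and \<open>E (i + 1) = C i\<close>, the map \<open>d i\<close> goes from \<open>E (i + 1)\<close> to \<open>E i\<close>.\<close>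

definition exact_seq_onto ::
    "('r, 'x) ring_scheme \<Rightarrow> nat \<Rightarrow> (nat \<Rightarrow> 'r fgmod) \<Rightarrow> 'r fgmod \<Rightarrow> bool" where
  "exact_seq_onto R n C M \<longleftrightarrow> (\<forall>i\<le>n. C i \<in> mod_cat R) \<and>
     (let E = case_nat M C in
      \<exists>d. (\<forall>i\<le>n. d i \<in> rmod_hom R (E (Suc i)) (E i)) \<and>
          d 0 ` carrier (E 1) = carrier (E 0) \<and>
          (\<forall>i<n. d (Suc i) ` carrier (E (Suc (Suc i))) = a_kernel (E (Suc i)) (E i) (d i)) \<and>
          inj_on (d n) (carrier (E (Suc n))))"

definition ddell :: "('r, 'x) ring_scheme \<Rightarrow> nat \<Rightarrow> 'r fgmod \<Rightarrow> enat" where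
  "ddell R k M = Inf {enat m | m. \<exists>n\<le>m. \<exists>C. exact_seq_onto R n C M \<and>
     (\<forall>i\<le>n. dell R (i + k) (C i) \<le> enat (m - i))}"

definition ddell_ring :: "('r, 'x) ring_scheme \<Rightarrow> nat \<Rightarrow> enat" where
  "ddell_ring R k = Sup {ddell R k L | L. L \<in> mod_cat R \<and> simple_rmodule R L}"

definition gddell :: "('r, 'x) ring_scheme \<Rightarrow> nat \<Rightarrow> enat" where
  "gddell R k = Sup {ddell R k M | M. M \<in> mod_cat R}"


section \<open>Loewy length\<close>

definition maximal_right_ideal :: "'r set \<Rightarrow> ('r, 'x) ring_scheme \<Rightarrow> bool" where
  "maximal_right_ideal I R \<longleftrightarrow> submodule I R (regular_module R) \<and> I \<noteq> carrier R \<and>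
     (\<forall>J. submodule J R (regular_module R) \<and> I \<subseteq> J \<longrightarrow> J = I \<or> J = carrier R)"

definition jacobson_rad :: "('r, 'x) ring_scheme \<Rightarrow> 'r set" where
  "jacobson_rad R = {x \<in> carrier R. \<forall>I. maximal_right_ideal I R \<longrightarrow> x \<in> I}"

primrec rad_power :: "('r, 'x) ring_scheme \<Rightarrow> nat \<Rightarrow> 'r set" where
  "rad_power R 0 = carrier R"
| "rad_power R (Suc n) = ideal_prod R (rad_power R n) (jacobson_rad R)"

text \<open>The radical of an Artin algebra is nilpotent, so the minimum below exists; it is \<open>0\<close>
  precisely for the zero ring.\<close>

definition loewy_length :: "('r, 'x) ring_scheme \<Rightarrow> nat" where
  "loewy_length R = (LEAST l. rad_power R l = {\<zero>\<^bsub>R\<^esub>})"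

end

theory Submission
  imports Defs
begin

text \<open>Let \<open>m\<close> be the \<open>k\<close>-derived delooping level of the simple modules.  Every module has a
  filtration with at most \<open>loewy_length R\<close> semisimple layers, and a semisimple layer is a finite
  direct sum of simple modules, so it has level at most \<open>m\<close> as well.  What remains is to control the
  level of an extension.

  The right bookkeeping is the class \<open>resolved\<close> below.  Only zero modules have
  \<open>resolved R 0 k\<close>, and \<open>M\<close> has \<open>resolved R (Suc t) k\<close> if it is the quotient of a module \<open>X\<close> with
  \<open>k\<close>-delooping level at most \<open>t\<close> by a submodule that has \<open>resolved R t (Suc k)\<close>.  Unfolding this
  recursion yields exactly the exact sequences in the definition of the derived delooping level: it
  is at most \<open>m\<close> if and only if \<open>M\<close> has \<open>resolved R (Suc m) k\<close> (\<open>ddell_le_iff_resolved\<close>).  With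
  the index shifted by one the class is subadditive along extensions (\<open>resolved_extension\<close>), so
  \<open>l\<close> layers give \<open>resolved R (l * Suc m) k\<close>, which is level at most \<open>l * (m + 1) - 1\<close>.

  Subadditivity is not a horseshoe argument, because maps out of modules
  that are merely deloopable cannot be lifted along surjections.  Instead a short exact sequence \<open>0 \<rightarrow> A \<rightarrow> B \<rightarrow> C \<rightarrow> 0\<close> is rotated.  Given a
  surjection from \<open>X\<close> to \<open>A\<close> and a projective \<open>P\<close> mapping onto \<open>C\<close>, lift \<open>P \<rightarrow> C\<close> to \<open>B\<close>; then
  \<open>X \<oplus> P\<close> maps onto \<open>B\<close>, and the kernel is an extension of the syzygy of \<open>C\<close> by the kernel of
  \<open>X \<rightarrow> A\<close>.  The projective summand does not change the delooping level of \<open>X\<close>, and the kernel is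
  an extension of the same kind with a shorter resolution at the left end and with \<open>k\<close> replaced by
  \<open>Suc k\<close>.  The induction closes because the syzygy of \<open>C\<close>, for a suitable \<open>P\<close>, keeps the length of
  the resolution of \<open>C\<close> while \<open>k\<close> grows by one (\<open>resolved_cover\<close>); this rests on the
  identity of the \<open>n\<close>-th syzygy of the first syzygy with the \<open>(n + 1)\<close>-st syzygy.

  The ring theory needed is that of right artinian rings.  An Artin algebra satisfies the
  descending chain condition on right ideals, its radical \<open>J\<close> is nilpotent and is a finite
  intersection of maximal right ideals, and the latter makes every module killed by \<open>J\<close> a sum of
  simple modules.  Filtering by socles then shows that submodules of finitely generated modules are
  finitely generated, so that syzygies stay in the category, and it also provides the layers.\<close>

section \<open>Homomorphisms and submodules\<close>

lemma rmod_homI: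
  assumes "\<And>x. x \<in> carrier A \<Longrightarrow> f x \<in> carrier B"
    "\<And>x y. x \<in> carrier A \<Longrightarrow> y \<in> carrier A \<Longrightarrow> f (x \<oplus>\<^bsub>A\<^esub> y) = f x \<oplus>\<^bsub>B\<^esub> f y"
    "\<And>a x. a \<in> carrier R \<Longrightarrow> x \<in> carrier A \<Longrightarrow> f (a \<odot>\<^bsub>A\<^esub> x) = a \<odot>\<^bsub>B\<^esub> f x"
  shows "f \<in> rmod_hom R A B"
  using assms unfolding rmod_hom_def by auto

lemma
  assumes "f \<in> rmod_hom R A B"
  shows hom_closed: "x \<in> carrier A \<Longrightarrow> f x \<in> carrier B"
    and hom_add: "x \<in> carrier A \<Longrightarrow> y \<in> carrier A \<Longrightarrow> f (x \<oplus>\<^bsub>A\<^esub> y) = f x \<oplus>\<^bsub>B\<^esub> f y"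
    and hom_smult: "a \<in> carrier R \<Longrightarrow> x \<in> carrier A \<Longrightarrow> f (a \<odot>\<^bsub>A\<^esub> x) = a \<odot>\<^bsub>B\<^esub> f x"
  using assms unfolding rmod_hom_def by auto

lemma hom_zero:
  assumes "right_module R A" "right_module R B" "f \<in> rmod_hom R A B"
  shows "f \<zero>\<^bsub>A\<^esub> = \<zero>\<^bsub>B\<^esub>"
proof -
  interpret A: right_module R A by fact
  interpret B: right_module R B by fact
  have "f (\<zero>\<^bsub>R\<^esub> \<odot>\<^bsub>A\<^esub> \<zero>\<^bsub>A\<^esub>) = \<zero>\<^bsub>R\<^esub> \<odot>\<^bsub>B\<^esub> f \<zero>\<^bsub>A\<^esub>"
    by (rule hom_smult[OF assms(3)]) auto
  then show ?thesis using hom_closed[OF assms(3)] by simp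
qed

lemma hom_neg:
  assumes "right_module R A" "right_module R B" "f \<in> rmod_hom R A B" "x \<in> carrier A"
  shows "f (\<ominus>\<^bsub>A\<^esub> x) = \<ominus>\<^bsub>B\<^esub> f x"
proof -
  interpret A: right_module R A by fact
  interpret B: right_module R B by fact
  show ?thesis
    using hom_smult[OF assms(3), of "\<ominus>\<^bsub>R\<^esub> \<one>\<^bsub>R\<^esub>" x] assms(4) hom_closed[OF assms(3)]
    by (simp add: A.smult_minus_one B.smult_minus_one)
qed

lemma hom_comp:
  assumes "f \<in> rmod_hom R A B" "g \<in> rmod_hom R B C"
  shows "(\<lambda>x. g (f x)) \<in> rmod_hom R A C"
  using assms by (intro rmod_homI) (simp_all add: hom_closed hom_add hom_smult)

lemma hom_id: "(\<lambda>x. x) \<in> rmod_hom R A A"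
  unfolding rmod_hom_def by auto

lemma hom_plus:
  assumes "right_module R B" "f \<in> rmod_hom R A B" "g \<in> rmod_hom R A B"
  shows "(\<lambda>x. f x \<oplus>\<^bsub>B\<^esub> g x) \<in> rmod_hom R A B"
proof -
  interpret B: right_module R B by fact
  note h = assms(2,3)[THEN hom_closed] assms(2,3)[THEN hom_add] assms(2,3)[THEN hom_smult]
  show ?thesis
    by (rule rmod_homI) (simp_all add: h B.smult_module_distr B.M.a_ac)
qed

lemma hom_uminus:
  assumes "right_module R B" "f \<in> rmod_hom R A B"
  shows "(\<lambda>x. \<ominus>\<^bsub>B\<^esub> f x) \<in> rmod_hom R A B"
proof -
  interpret B: right_module R B by fact
  note h = assms(2)[THEN hom_closed] assms(2)[THEN hom_add] assms(2)[THEN hom_smult]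
  have "\<ominus>\<^bsub>B\<^esub> (a \<odot>\<^bsub>B\<^esub> y) = a \<odot>\<^bsub>B\<^esub> (\<ominus>\<^bsub>B\<^esub> y)" if "a \<in> carrier R" "y \<in> carrier B" for a y
  proof (rule B.M.minus_equality)
    have "a \<odot>\<^bsub>B\<^esub> (\<ominus>\<^bsub>B\<^esub> y) \<oplus>\<^bsub>B\<^esub> a \<odot>\<^bsub>B\<^esub> y = a \<odot>\<^bsub>B\<^esub> (\<ominus>\<^bsub>B\<^esub> y \<oplus>\<^bsub>B\<^esub> y)"
      using that by (simp only: B.smult_module_distr B.M.a_inv_closed)
    then show "a \<odot>\<^bsub>B\<^esub> (\<ominus>\<^bsub>B\<^esub> y) \<oplus>\<^bsub>B\<^esub> a \<odot>\<^bsub>B\<^esub> y = \<zero>\<^bsub>B\<^esub>"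
      using that by (simp add: B.M.l_neg)
  qed (use that in auto)
  then show ?thesis
    by (intro rmod_homI) (simp_all add: h B.M.minus_add)
qed

lemma hom_restrict:
  assumes "f \<in> rmod_hom R A B" "H \<subseteq> carrier A" "f ` H \<subseteq> K"
  shows "f \<in> rmod_hom R (A\<lparr>carrier := H\<rparr>) (B\<lparr>carrier := K\<rparr>)"
  using assms unfolding rmod_hom_def by (auto simp: image_subset_iff subset_iff)

lemma hom_restrict_dom:
  assumes "f \<in> rmod_hom R A B" "H \<subseteq> carrier A"
  shows "f \<in> rmod_hom R (A\<lparr>carrier := H\<rparr>) B"
  using assms unfolding rmod_hom_def by (auto simp: subset_iff)

lemma hom_restrict_cod:
  assumes "f \<in> rmod_hom R A B" "f ` carrier A \<subseteq> K"
  shows "f \<in> rmod_hom R A (B\<lparr>carrier := K\<rparr>)"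
  using assms unfolding rmod_hom_def by (auto simp: image_subset_iff)

lemma hom_widen_cod:
  assumes "f \<in> rmod_hom R A (B\<lparr>carrier := K\<rparr>)" "K \<subseteq> carrier B"
  shows "f \<in> rmod_hom R A B"
  using assms unfolding rmod_hom_def by auto

lemma
  assumes "submodule H R M"
  shows submodule_subset: "H \<subseteq> carrier M"
    and submodule_zero: "\<zero>\<^bsub>M\<^esub> \<in> H"
    and submodule_add: "x \<in> H \<Longrightarrow> y \<in> H \<Longrightarrow> x \<oplus>\<^bsub>M\<^esub> y \<in> H"
    and submodule_smult: "a \<in> carrier R \<Longrightarrow> x \<in> H \<Longrightarrow> a \<odot>\<^bsub>M\<^esub> x \<in> H"
    and submodule_neg: "x \<in> H \<Longrightarrow> \<ominus>\<^bsub>M\<^esub> x \<in> H"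
proof -
  interpret submodule H R M by fact
  show "H \<subseteq> carrier M" by (rule subset[simplified])
  show "\<zero>\<^bsub>M\<^esub> \<in> H" using one_closed by simp
  show "x \<in> H \<Longrightarrow> y \<in> H \<Longrightarrow> x \<oplus>\<^bsub>M\<^esub> y \<in> H" using m_closed by simp
  show "a \<in> carrier R \<Longrightarrow> x \<in> H \<Longrightarrow> a \<odot>\<^bsub>M\<^esub> x \<in> H" by simp
  show "x \<in> H \<Longrightarrow> \<ominus>\<^bsub>M\<^esub> x \<in> H" using m_inv_closed by (simp add: a_inv_def)
qed

lemma submodule_module:
  assumes "right_module R M" "submodule H R M"
  shows "right_module R (M\<lparr>carrier := H\<rparr>)"
proof -
  interpret M: right_module R M by fact
  note H = submodule_subset[OF assms(2)] submodule_zero[OF assms(2)] submodule_add[OF assms(2)]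
    submodule_smult[OF assms(2)] submodule_neg[OF assms(2)]
  have c: "x \<in> H \<Longrightarrow> x \<in> carrier M" for x using H(1) by auto
  have "abelian_group (M\<lparr>carrier := H\<rparr>)"
  proof (rule abelian_groupI)
    fix x assume "x \<in> carrier (M\<lparr>carrier := H\<rparr>)"
    then show "\<exists>y\<in>carrier (M\<lparr>carrier := H\<rparr>). y \<oplus>\<^bsub>M\<lparr>carrier := H\<rparr>\<^esub> x = \<zero>\<^bsub>M\<lparr>carrier := H\<rparr>\<^esub>"
      using H(5) c by (auto intro!: bexI[of _ "\<ominus>\<^bsub>M\<^esub> x"] simp: M.M.l_neg)
  qed (use H c in \<open>simp_all add: M.M.a_ac\<close>)
  then show ?thesis
    unfolding right_module_def right_module_axioms_def
    using H c by (simp add: M.R.ring_axioms M.smult_ring_distr M.smult_module_distr M.smult_assoc)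
qed

lemma submodule_carrier: "right_module R M \<Longrightarrow> submodule (carrier M) R M"
proof -
  assume "right_module R M"
  then interpret right_module R M .
  show ?thesis by (rule submoduleI) auto
qed

lemma submodule_singleton_zero: "right_module R M \<Longrightarrow> submodule {\<zero>\<^bsub>M\<^esub>} R M"
proof -
  assume "right_module R M"
  then interpret right_module R M .
  show ?thesis by (rule submoduleI) auto
qed

lemma submodule_Inter:
  assumes "right_module R M" "\<H> \<noteq> {}" "\<And>H. H \<in> \<H> \<Longrightarrow> submodule H R M"
  shows "submodule (\<Inter>\<H>) R M"
proof (rule right_module.submoduleI[OF assms(1)])
  show "\<Inter>\<H> \<subseteq> carrier M" using assms(2,3) submodule_subset by fastforce
qed (auto simp: submodule_zero[OF assms(3)] submodule_add[OF assms(3)] submodule_smult[OF assms(3)])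

lemma submodule_Int:
  assumes "right_module R M" "submodule H R M" "submodule K R M"
  shows "submodule (H \<inter> K) R M"
  using submodule_Inter[OF assms(1), of "{H, K}"] assms(2,3) by auto

lemma submodule_trans_iff:
  assumes "right_module R M" "submodule H R M"
  shows "submodule K R (M\<lparr>carrier := H\<rparr>) \<longleftrightarrow> submodule K R M \<and> K \<subseteq> H"
proof
  assume K: "submodule K R (M\<lparr>carrier := H\<rparr>)"
  have "K \<subseteq> H" using submodule_subset[OF K] by simp
  moreover have "submodule K R M"
    using submodule_zero[OF K] submodule_add[OF K] submodule_smult[OF K] \<open>K \<subseteq> H\<close>
      submodule_subset[OF assms(2)]
    by (intro right_module.submoduleI[OF assms(1)]) auto
  ultimately show "submodule K R M \<and> K \<subseteq> H" by blast
next
  assume K: "submodule K R M \<and> K \<subseteq> H"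
  then have K': "submodule K R M" by blast
  show "submodule K R (M\<lparr>carrier := H\<rparr>)"
    using submodule_zero[OF K'] submodule_add[OF K'] submodule_smult[OF K'] K
    by (intro right_module.submoduleI[OF submodule_module[OF assms]]) auto
qed

lemma mem_kernel: "x \<in> a_kernel A B f \<longleftrightarrow> x \<in> carrier A \<and> f x = \<zero>\<^bsub>B\<^esub>"
  by (auto simp: a_kernel_def kernel_def)

lemma kernel_submodule:
  assumes "right_module R A" "right_module R B" "f \<in> rmod_hom R A B"
  shows "submodule (a_kernel A B f) R A"
proof -
  interpret A: right_module R A by fact
  interpret B: right_module R B by fact
  show ?thesis
    by (rule A.submoduleI)
      (auto simp: mem_kernel hom_zero[OF assms] hom_add[OF assms(3)] hom_smult[OF assms(3)])
qed

lemma image_submodule: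
  assumes "right_module R A" "right_module R B" "f \<in> rmod_hom R A B" "submodule H R A"
  shows "submodule (f ` H) R B"
proof (rule right_module.submoduleI[OF assms(2)])
  note H = submodule_subset[OF assms(4)] submodule_zero[OF assms(4)] submodule_add[OF assms(4)]
    submodule_smult[OF assms(4)]
  show "f ` H \<subseteq> carrier B" using H(1) hom_closed[OF assms(3)] by auto
  show "\<zero>\<^bsub>B\<^esub> \<in> f ` H" using hom_zero[OF assms(1-3)] H(2) by (metis imageI)
  show "x \<oplus>\<^bsub>B\<^esub> y \<in> f ` H" if xy: "x \<in> f ` H" "y \<in> f ` H" for x y
  proof -
    obtain u v where uv: "u \<in> H" "v \<in> H" "x = f u" "y = f v" using xy by blast
    then have "x \<oplus>\<^bsub>B\<^esub> y = f (u \<oplus>\<^bsub>A\<^esub> v)" using H(1) by (simp add: hom_add[OF assms(3)] subset_iff)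
    then show ?thesis using H(3)[OF uv(1,2)] by simp
  qed
  show "a \<odot>\<^bsub>B\<^esub> x \<in> f ` H" if ax: "a \<in> carrier R" "x \<in> f ` H" for a x
  proof -
    obtain u where u: "u \<in> H" "x = f u" using ax by blast
    then have "a \<odot>\<^bsub>B\<^esub> x = f (a \<odot>\<^bsub>A\<^esub> u)" using H(1) ax by (simp add: hom_smult[OF assms(3)] subset_iff)
    then show ?thesis using H(4)[OF ax(1) u(1)] by simp
  qed
qed

lemma vimage_submodule:
  assumes "right_module R A" "right_module R B" "f \<in> rmod_hom R A B" "submodule K R B"
  shows "submodule {x \<in> carrier A. f x \<in> K} R A"
proof -
  interpret A: right_module R A by fact
  note K = submodule_zero[OF assms(4)] submodule_add[OF assms(4)] submodule_smult[OF assms(4)]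
  show ?thesis
    by (rule A.submoduleI)
      (auto simp: K hom_zero[OF assms(1-3)] hom_add[OF assms(3)] hom_smult[OF assms(3)])
qed

text \<open>The cosets of \<open>H\<close> are represented by chosen elements, so the quotient lives on the type of
  \<open>M\<close>.\<close>

lemma quotient_exists:
  fixes M :: "('r, 'm) module"
  assumes "right_module R M" "submodule H R M"
  obtains C :: "('r, 'm) module" and g where "right_module R C" "g \<in> rmod_hom R M C"
    "g ` carrier M = carrier C" "a_kernel M C g = H"
proof -
  interpret M: right_module R M by fact
  note H = submodule_subset[OF assms(2)] submodule_zero[OF assms(2)] submodule_add[OF assms(2)]
    submodule_smult[OF assms(2)] submodule_neg[OF assms(2)]
  have c: "x \<in> H \<Longrightarrow> x \<in> carrier M" for x using H(1) by auto
  define rel where "rel x y \<longleftrightarrow> x \<in> carrier M \<and> (\<exists>h\<in>H. y = x \<oplus>\<^bsub>M\<^esub> h)" for x y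
  have relI: "x \<in> carrier M \<Longrightarrow> h \<in> H \<Longrightarrow> rel x (x \<oplus>\<^bsub>M\<^esub> h)" for x h by (auto simp: rel_def)
  have refl: "x \<in> carrier M \<Longrightarrow> rel x x" for x using relI[of x "\<zero>\<^bsub>M\<^esub>"] H(2) by simp
  have relc: "rel x y \<Longrightarrow> y \<in> carrier M" "rel x y \<Longrightarrow> x \<in> carrier M" for x y
    using c by (auto simp: rel_def)
  have sym: "rel y x" if r: "rel x y" for x y
  proof -
    obtain h where h: "x \<in> carrier M" "h \<in> H" "y = x \<oplus>\<^bsub>M\<^esub> h" using r unfolding rel_def by blast
    then have "x = y \<oplus>\<^bsub>M\<^esub> \<ominus>\<^bsub>M\<^esub> h" using c by (simp add: M.M.a_assoc M.M.r_neg)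
    then show ?thesis using relI[of y "\<ominus>\<^bsub>M\<^esub> h"] H(5) h c by auto
  qed
  have trans: "rel x z" if r: "rel x y" "rel y z" for x y z
  proof -
    obtain h where h: "x \<in> carrier M" "h \<in> H" "y = x \<oplus>\<^bsub>M\<^esub> h" using r(1) unfolding rel_def by blast
    obtain k where k: "k \<in> H" "z = y \<oplus>\<^bsub>M\<^esub> k" using r(2) unfolding rel_def by blast
    have "z = x \<oplus>\<^bsub>M\<^esub> (h \<oplus>\<^bsub>M\<^esub> k)" using h k c by (simp add: M.M.a_assoc)
    then show ?thesis using relI[OF h(1) H(3)[OF h(2) k(1)]] by simp
  qed
  define r where "r x = (SOME y. rel x y)" for x
  have r: "rel x (r x)" if "x \<in> carrier M" for x
    unfolding r_def using refl[OF that] by (rule someI)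
  have r_cong: "r x = r y" if "rel x y" for x y
  proof -
    have "rel x = rel y" using that sym trans by blast
    then show ?thesis by (simp add: r_def)
  qed
  have r_eq: "r x = r y \<longleftrightarrow> rel x y" if xy: "x \<in> carrier M" "y \<in> carrier M" for x y
    using r[OF xy(1)] r[OF xy(2)] r_cong sym trans by metis
  have rel_add: "rel (x \<oplus>\<^bsub>M\<^esub> x') (y \<oplus>\<^bsub>M\<^esub> y')" if r: "rel x y" "rel x' y'" for x y x' y'
  proof -
    obtain h where h: "x \<in> carrier M" "h \<in> H" "y = x \<oplus>\<^bsub>M\<^esub> h" using r(1) unfolding rel_def by blast
    obtain k where k: "x' \<in> carrier M" "k \<in> H" "y' = x' \<oplus>\<^bsub>M\<^esub> k" using r(2) unfolding rel_def by blast
    have "y \<oplus>\<^bsub>M\<^esub> y' = (x \<oplus>\<^bsub>M\<^esub> x') \<oplus>\<^bsub>M\<^esub> (h \<oplus>\<^bsub>M\<^esub> k)" using h k c by (simp add: M.M.a_ac)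
    then show ?thesis using relI[of "x \<oplus>\<^bsub>M\<^esub> x'" "h \<oplus>\<^bsub>M\<^esub> k"] h k H(3) by simp
  qed
  have rel_smult: "rel (a \<odot>\<^bsub>M\<^esub> x) (a \<odot>\<^bsub>M\<^esub> y)" if r: "rel x y" "a \<in> carrier R" for x y a
  proof -
    obtain h where h: "x \<in> carrier M" "h \<in> H" "y = x \<oplus>\<^bsub>M\<^esub> h" using r(1) unfolding rel_def by blast
    then show ?thesis using relI[of "a \<odot>\<^bsub>M\<^esub> x" "a \<odot>\<^bsub>M\<^esub> h"] H(4) c r(2)
      by (simp add: M.smult_module_distr)
  qed
  define C where "C = M\<lparr>carrier := r ` carrier M, zero := r \<zero>\<^bsub>M\<^esub>, add := (\<lambda>x y. r (x \<oplus>\<^bsub>M\<^esub> y)),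
    smult := (\<lambda>a x. r (a \<odot>\<^bsub>M\<^esub> x))\<rparr>"
  have C [simp]: "carrier C = r ` carrier M" "\<zero>\<^bsub>C\<^esub> = r \<zero>\<^bsub>M\<^esub>" "x \<oplus>\<^bsub>C\<^esub> y = r (x \<oplus>\<^bsub>M\<^esub> y)"
    "a \<odot>\<^bsub>C\<^esub> x = r (a \<odot>\<^bsub>M\<^esub> x)" for x y a
    unfolding C_def by simp_all
  have rc [simp]: "x \<in> carrier M \<Longrightarrow> r x \<in> carrier M" for x using r relc by blast
  have rr [simp]: "r (r x) = r x" if "x \<in> carrier M" for x
    using r_cong[OF r[OF that]] by simp
  have radd1 [simp]: "r (r x \<oplus>\<^bsub>M\<^esub> y) = r (x \<oplus>\<^bsub>M\<^esub> y)" "r (y \<oplus>\<^bsub>M\<^esub> r x) = r (y \<oplus>\<^bsub>M\<^esub> x)"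
    if "x \<in> carrier M" "y \<in> carrier M" for x y
    using r_cong[OF rel_add[OF r[OF that(1)] refl[OF that(2)]]]
      r_cong[OF rel_add[OF refl[OF that(2)] r[OF that(1)]]] by simp_all
  have rsm [simp]: "r (a \<odot>\<^bsub>M\<^esub> r x) = r (a \<odot>\<^bsub>M\<^esub> x)" if "x \<in> carrier M" "a \<in> carrier R" for x a
    using r_cong[OF rel_smult[OF r[OF that(1)] that(2)]] by simp
  have rsm2: "r (a \<odot>\<^bsub>M\<^esub> r x \<oplus>\<^bsub>M\<^esub> b \<odot>\<^bsub>M\<^esub> r x) = r (a \<odot>\<^bsub>M\<^esub> x \<oplus>\<^bsub>M\<^esub> b \<odot>\<^bsub>M\<^esub> x)"
    "r (b \<odot>\<^bsub>M\<^esub> (a \<odot>\<^bsub>M\<^esub> r x)) = r (b \<odot>\<^bsub>M\<^esub> (a \<odot>\<^bsub>M\<^esub> x))"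
    if "x \<in> carrier M" "a \<in> carrier R" "b \<in> carrier R" for x a b
    using r_cong[OF rel_add[OF rel_smult[OF r[OF that(1)] that(2)] rel_smult[OF r[OF that(1)] that(3)]]]
      r_cong[OF rel_smult[OF rel_smult[OF r[OF that(1)] that(2)] that(3)]] by simp_all
  have "abelian_group C"
  proof (rule abelian_groupI)
    fix x assume "x \<in> carrier C"
    then obtain y where y: "y \<in> carrier M" "x = r y" by auto
    then show "\<exists>z\<in>carrier C. z \<oplus>\<^bsub>C\<^esub> x = \<zero>\<^bsub>C\<^esub>"
      by (auto intro!: bexI[of _ "\<ominus>\<^bsub>M\<^esub> y"] simp: M.M.l_neg)
    fix y assume "y \<in> carrier C"
    then show "x \<oplus>\<^bsub>C\<^esub> y = y \<oplus>\<^bsub>C\<^esub> x"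
      using \<open>x \<in> carrier C\<close> by (auto simp: M.M.a_comm)
  qed (auto simp: M.M.a_assoc)
  then have rC: "right_module R C"
    unfolding right_module_def right_module_axioms_def
    by (auto simp: M.R.ring_axioms M.smult_ring_distr M.smult_module_distr M.smult_assoc rsm2)
  moreover have "r \<in> rmod_hom R M C" by (rule rmod_homI) auto
  moreover have "a_kernel M C r = H"
  proof -
    have "r x = r \<zero>\<^bsub>M\<^esub> \<longleftrightarrow> x \<in> H" if x: "x \<in> carrier M" for x
    proof -
      have "rel \<zero>\<^bsub>M\<^esub> x \<longleftrightarrow> x \<in> H" using x c by (auto simp: rel_def)
      then show ?thesis using r_eq[of "\<zero>\<^bsub>M\<^esub>" x] x by (metis M.M.zero_closed)
    qed
    then show ?thesis using c by (auto simp: mem_kernel)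
  qed
  ultimately show ?thesis using that[of C r] by simp
qed

text \<open>As \<open>A\<close> and \<open>B\<close> meet only in zero, the \<open>A\<close>-component of an element does not depend on the
  chosen decomposition, which makes the choice additive and linear.\<close>

lemma internal_projection:
  assumes "right_module R Z" "submodule A R Z" "submodule B R Z"
    "A <+>\<^bsub>Z\<^esub> B = carrier Z" "A \<inter> B = {\<zero>\<^bsub>Z\<^esub>}"
  obtains \<pi> where "\<pi> \<in> rmod_hom R Z (Z\<lparr>carrier := A\<rparr>)" "\<And>a. a \<in> A \<Longrightarrow> \<pi> a = a"
    "\<And>b. b \<in> B \<Longrightarrow> \<pi> b = \<zero>\<^bsub>Z\<^esub>" "\<And>z. z \<in> carrier Z \<Longrightarrow> \<exists>b\<in>B. z = \<pi> z \<oplus>\<^bsub>Z\<^esub> b"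
proof -
  interpret Z: right_module R Z by fact
  note A = submodule_subset[OF assms(2)] submodule_zero[OF assms(2)] submodule_add[OF assms(2)]
    submodule_smult[OF assms(2)] submodule_neg[OF assms(2)]
  note B = submodule_subset[OF assms(3)] submodule_zero[OF assms(3)] submodule_add[OF assms(3)]
    submodule_smult[OF assms(3)] submodule_neg[OF assms(3)]
  define \<pi> where "\<pi> z = (SOME a. a \<in> A \<and> (\<exists>b\<in>B. z = a \<oplus>\<^bsub>Z\<^esub> b))" for z
  have \<pi>: "\<pi> (a \<oplus>\<^bsub>Z\<^esub> b) = a" if ab: "a \<in> A" "b \<in> B" for a b
  proof -
    have "\<pi> (a \<oplus>\<^bsub>Z\<^esub> b) \<in> A \<and> (\<exists>b'\<in>B. a \<oplus>\<^bsub>Z\<^esub> b = \<pi> (a \<oplus>\<^bsub>Z\<^esub> b) \<oplus>\<^bsub>Z\<^esub> b')"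
      unfolding \<pi>_def by (rule someI[of _ a]) (use ab in auto)
    then obtain b' where b': "\<pi> (a \<oplus>\<^bsub>Z\<^esub> b) \<in> A" "b' \<in> B" "a \<oplus>\<^bsub>Z\<^esub> b = \<pi> (a \<oplus>\<^bsub>Z\<^esub> b) \<oplus>\<^bsub>Z\<^esub> b'" by auto
    define a' where "a' = \<pi> (a \<oplus>\<^bsub>Z\<^esub> b)"
    have c: "a \<in> carrier Z" "b \<in> carrier Z" "a' \<in> carrier Z" "b' \<in> carrier Z"
      using ab b' A(1) B(1) by (auto simp: a'_def)
    have "\<ominus>\<^bsub>Z\<^esub> a' \<oplus>\<^bsub>Z\<^esub> a = b' \<oplus>\<^bsub>Z\<^esub> \<ominus>\<^bsub>Z\<^esub> b"
    proof -
      have "\<ominus>\<^bsub>Z\<^esub> a' \<oplus>\<^bsub>Z\<^esub> a = \<ominus>\<^bsub>Z\<^esub> a' \<oplus>\<^bsub>Z\<^esub> ((a \<oplus>\<^bsub>Z\<^esub> b) \<oplus>\<^bsub>Z\<^esub> \<ominus>\<^bsub>Z\<^esub> b)"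
        using c by (simp add: Z.M.a_assoc Z.M.r_neg)
      also have "\<dots> = b' \<oplus>\<^bsub>Z\<^esub> \<ominus>\<^bsub>Z\<^esub> b"
        unfolding b'(3)[folded a'_def] using c by (simp add: Z.M.a_assoc Z.M.r_neg1)
      finally show ?thesis .
    qed
    moreover have "\<ominus>\<^bsub>Z\<^esub> a' \<oplus>\<^bsub>Z\<^esub> a \<in> A" "b' \<oplus>\<^bsub>Z\<^esub> \<ominus>\<^bsub>Z\<^esub> b \<in> B"
      using A(3,5) B(3,5) b' ab by (auto simp: a'_def)
    ultimately have "\<ominus>\<^bsub>Z\<^esub> a' \<oplus>\<^bsub>Z\<^esub> a = \<zero>\<^bsub>Z\<^esub>" using assms(5) by auto
    then have "a' \<oplus>\<^bsub>Z\<^esub> (\<ominus>\<^bsub>Z\<^esub> a' \<oplus>\<^bsub>Z\<^esub> a) = a'" using c by simp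
    then have "a = a'" using c by (simp add: Z.M.r_neg2)
    then show ?thesis by (simp add: a'_def)
  qed
  have dec: "\<exists>a\<in>A. \<exists>b\<in>B. z = a \<oplus>\<^bsub>Z\<^esub> b" if "z \<in> carrier Z" for z
    using that unfolding assms(4)[symmetric] set_add_def' by blast
  show ?thesis
  proof (rule that)
    show "\<pi> \<in> rmod_hom R Z (Z\<lparr>carrier := A\<rparr>)"
    proof (rule rmod_homI)
      show "\<pi> z \<in> carrier (Z\<lparr>carrier := A\<rparr>)" if "z \<in> carrier Z" for z
        using dec[OF that] \<pi> by auto
      show "\<pi> (x \<oplus>\<^bsub>Z\<^esub> y) = \<pi> x \<oplus>\<^bsub>Z\<lparr>carrier := A\<rparr>\<^esub> \<pi> y" if xy: "x \<in> carrier Z" "y \<in> carrier Z" for x y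
      proof -
        obtain a b where ab: "a \<in> A" "b \<in> B" "x = a \<oplus>\<^bsub>Z\<^esub> b" using dec[OF xy(1)] by blast
        obtain a' b' where ab': "a' \<in> A" "b' \<in> B" "y = a' \<oplus>\<^bsub>Z\<^esub> b'" using dec[OF xy(2)] by blast
        have "x \<oplus>\<^bsub>Z\<^esub> y = (a \<oplus>\<^bsub>Z\<^esub> a') \<oplus>\<^bsub>Z\<^esub> (b \<oplus>\<^bsub>Z\<^esub> b')"
          using ab ab' A(1) B(1) by (simp add: subset_iff Z.M.a_ac)
        then have "\<pi> (x \<oplus>\<^bsub>Z\<^esub> y) = a \<oplus>\<^bsub>Z\<^esub> a'" using \<pi> A(3) B(3) ab ab' by simp
        then show ?thesis using \<pi> ab ab' by simp
      qed
      show "\<pi> (r \<odot>\<^bsub>Z\<^esub> x) = r \<odot>\<^bsub>Z\<lparr>carrier := A\<rparr>\<^esub> \<pi> x" if r: "r \<in> carrier R" "x \<in> carrier Z" for r x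
      proof -
        obtain a b where ab: "a \<in> A" "b \<in> B" "x = a \<oplus>\<^bsub>Z\<^esub> b" using dec[OF r(2)] by blast
        have "r \<odot>\<^bsub>Z\<^esub> x = r \<odot>\<^bsub>Z\<^esub> a \<oplus>\<^bsub>Z\<^esub> r \<odot>\<^bsub>Z\<^esub> b"
          using ab A(1) B(1) r by (simp add: subset_iff Z.smult_module_distr)
        then have "\<pi> (r \<odot>\<^bsub>Z\<^esub> x) = r \<odot>\<^bsub>Z\<^esub> a" using \<pi> A(4) B(4) ab r by simp
        then show ?thesis using \<pi> ab by simp
      qed
    qed
    show "\<pi> a = a" if "a \<in> A" for a
      using \<pi>[OF that B(2)] that A(1) by (simp add: subset_iff)
    show "\<pi> b = \<zero>\<^bsub>Z\<^esub>" if "b \<in> B" for b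
      using \<pi>[OF A(2) that] that B(1) by (simp add: subset_iff)
    show "\<exists>b\<in>B. z = \<pi> z \<oplus>\<^bsub>Z\<^esub> b" if "z \<in> carrier Z" for z
      using dec[OF that] \<pi> by metis
  qed
qed

section \<open>Finite generation\<close>

lemma fin_gen_image:
  assumes "right_module R M" "right_module R C" "f \<in> rmod_hom R M C" "f ` carrier M = carrier C"
    "fin_gen R M"
  shows "fin_gen R C"
proof -
  obtain A where A: "A \<subseteq> carrier M" "finite A"
    "\<And>H. submodule H R M \<Longrightarrow> A \<subseteq> H \<Longrightarrow> H = carrier M"
    using assms(5) unfolding fin_gen_def by blast
  have "K = carrier C" if K: "submodule K R C" "f ` A \<subseteq> K" for K
  proof -
    have "{x \<in> carrier M. f x \<in> K} = carrier M"
      using vimage_submodule[OF assms(1-3) K(1)] A K(2) by (intro A(3)) auto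
    then have "f ` carrier M \<subseteq> K" by blast
    then show ?thesis using assms(4) submodule_subset[OF K(1)] by auto
  qed
  then show ?thesis
    unfolding fin_gen_def using A(1,2) assms(4) by (intro exI[of _ "f ` A"]) auto
qed

text \<open>Generators of the kernel together with preimages of generators of the image generate.\<close>

lemma fin_gen_extension:
  assumes "right_module R M" "right_module R C" "f \<in> rmod_hom R M C" "f ` carrier M = carrier C"
    "fin_gen R (M\<lparr>carrier := a_kernel M C f\<rparr>)" "fin_gen R C"
  shows "fin_gen R M"
proof -
  interpret M: right_module R M by fact
  interpret C: right_module R C by fact
  let ?K = "a_kernel M C f"
  note K = kernel_submodule[OF assms(1-3)]
  obtain A where A: "A \<subseteq> carrier C" "finite A"
    "\<And>H. submodule H R C \<Longrightarrow> A \<subseteq> H \<Longrightarrow> H = carrier C"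
    using assms(6) unfolding fin_gen_def by blast
  obtain B where B: "B \<subseteq> ?K" "finite B"
    "\<And>H. submodule H R (M\<lparr>carrier := ?K\<rparr>) \<Longrightarrow> B \<subseteq> H \<Longrightarrow> H = ?K"
    using assms(5) unfolding fin_gen_def by auto
  obtain A' where A': "A' \<subseteq> carrier M" "finite A'" "f ` A' = A"
    using finite_subset_image[of A f "carrier M"] A(1,2) assms(4) by metis
  have "H = carrier M" if H: "submodule H R M" "A' \<union> B \<subseteq> H" for H
  proof -
    have "submodule (H \<inter> ?K) R (M\<lparr>carrier := ?K\<rparr>)"
      using submodule_Int[OF assms(1) H(1) K] submodule_trans_iff[OF assms(1) K] by simp
    then have KH: "?K \<subseteq> H" using B(1) B(3)[of "H \<inter> ?K"] H(2) by blast
    have fH: "f ` H = carrier C"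
      using A(3)[OF image_submodule[OF assms(1-3) H(1)]] A'(3) H(2) by blast
    note Hs = submodule_subset[OF H(1)]
    have "x \<in> H" if x: "x \<in> carrier M" for x
    proof -
      obtain h where h: "h \<in> H" "f x = f h" using fH hom_closed[OF assms(3) x] by (metis imageE)
      have hc: "h \<in> carrier M" using h Hs by auto
      have "x \<oplus>\<^bsub>M\<^esub> \<ominus>\<^bsub>M\<^esub> h \<in> ?K"
        using x h hc hom_closed[OF assms(3)] by (simp add: mem_kernel hom_add[OF assms(3)] hom_neg[OF assms(1-3)] C.M.r_neg)
      then have "(x \<oplus>\<^bsub>M\<^esub> \<ominus>\<^bsub>M\<^esub> h) \<oplus>\<^bsub>M\<^esub> h \<in> H" using KH submodule_add[OF H(1)] h(1) by blast
      then show ?thesis using x hc by (simp add: M.M.a_assoc M.M.l_neg)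
    qed
    then show ?thesis using Hs by blast
  qed
  then show ?thesis
    unfolding fin_gen_def using A'(1,2) B(1,2) submodule_subset[OF K]
    by (intro exI[of _ "A' \<union> B"]) auto
qed

section \<open>Biproducts\<close>

text \<open>The summands and the sum may live on three different types, so a direct sum is described by its
  injections and projections.  This is stable under isomorphism, and the statements below need not
  mention how the sum was built.\<close>

definition biprod :: "('r, 'x) ring_scheme \<Rightarrow> ('r, 'a) module \<Rightarrow> ('r, 'b) module \<Rightarrow> ('r, 'c) module \<Rightarrow>
    ('a \<Rightarrow> 'c) \<Rightarrow> ('b \<Rightarrow> 'c) \<Rightarrow> ('c \<Rightarrow> 'a) \<Rightarrow> ('c \<Rightarrow> 'b) \<Rightarrow> bool" where
  "biprod R A B W i1 i2 p1 p2 \<longleftrightarrow>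
     i1 \<in> rmod_hom R A W \<and> i2 \<in> rmod_hom R B W \<and> p1 \<in> rmod_hom R W A \<and> p2 \<in> rmod_hom R W B \<and>
     (\<forall>a\<in>carrier A. p1 (i1 a) = a \<and> p2 (i1 a) = \<zero>\<^bsub>B\<^esub>) \<and>
     (\<forall>b\<in>carrier B. p1 (i2 b) = \<zero>\<^bsub>A\<^esub> \<and> p2 (i2 b) = b) \<and>
     (\<forall>w\<in>carrier W. i1 (p1 w) \<oplus>\<^bsub>W\<^esub> i2 (p2 w) = w)"

lemma
  assumes "biprod R A B W i1 i2 p1 p2"
  shows biprod_hom: "i1 \<in> rmod_hom R A W" "i2 \<in> rmod_hom R B W" "p1 \<in> rmod_hom R W A"
      "p2 \<in> rmod_hom R W B"
    and biprod_eq: "a \<in> carrier A \<Longrightarrow> p1 (i1 a) = a" "a \<in> carrier A \<Longrightarrow> p2 (i1 a) = \<zero>\<^bsub>B\<^esub>"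
      "b \<in> carrier B \<Longrightarrow> p1 (i2 b) = \<zero>\<^bsub>A\<^esub>" "b \<in> carrier B \<Longrightarrow> p2 (i2 b) = b"
      "w \<in> carrier W \<Longrightarrow> i1 (p1 w) \<oplus>\<^bsub>W\<^esub> i2 (p2 w) = w"
    and biprod_closed: "a \<in> carrier A \<Longrightarrow> i1 a \<in> carrier W" "b \<in> carrier B \<Longrightarrow> i2 b \<in> carrier W"
      "w \<in> carrier W \<Longrightarrow> p1 w \<in> carrier A" "w \<in> carrier W \<Longrightarrow> p2 w \<in> carrier B"
  using assms unfolding biprod_def by (auto intro: hom_closed)

lemma biprod_ext:
  assumes "biprod R A B W i1 i2 p1 p2" "v \<in> carrier W" "w \<in> carrier W" "p1 v = p1 w" "p2 v = p2 w"
  shows "v = w"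
  using biprod_eq(5)[OF assms(1,2)] biprod_eq(5)[OF assms(1,3)] assms(4,5) by metis

lemma biprod_p_add:
  assumes "right_module R A" "right_module R B" "biprod R A B W i1 i2 p1 p2"
    "a \<in> carrier A" "b \<in> carrier B"
  shows "p1 (i1 a \<oplus>\<^bsub>W\<^esub> i2 b) = a" "p2 (i1 a \<oplus>\<^bsub>W\<^esub> i2 b) = b"
proof -
  interpret A: right_module R A by fact
  interpret B: right_module R B by fact
  show "p1 (i1 a \<oplus>\<^bsub>W\<^esub> i2 b) = a" "p2 (i1 a \<oplus>\<^bsub>W\<^esub> i2 b) = b"
    using assms(4,5) biprod_closed[OF assms(3)]
    by (simp_all add: hom_add[OF biprod_hom(3)[OF assms(3)]] hom_add[OF biprod_hom(4)[OF assms(3)]]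
        biprod_eq[OF assms(3)])
qed

lemma hom_inv:
  assumes "f \<in> rmod_hom R A B" "right_module R A" "bij_betw f (carrier A) (carrier B)"
  shows "inv_into (carrier A) f \<in> rmod_hom R B A"
proof -
  interpret A: right_module R A by fact
  let ?g = "inv_into (carrier A) f"
  have g: "y \<in> carrier B \<Longrightarrow> ?g y \<in> carrier A" "y \<in> carrier B \<Longrightarrow> f (?g y) = y"
    "x \<in> carrier A \<Longrightarrow> ?g (f x) = x" for x y
    using assms(3) by (auto simp: bij_betw_def inv_into_into f_inv_into_f)
  show ?thesis
  proof (rule rmod_homI)
    show "?g (x \<oplus>\<^bsub>B\<^esub> y) = ?g x \<oplus>\<^bsub>A\<^esub> ?g y" if "x \<in> carrier B" "y \<in> carrier B" for x y
      using g(3)[of "?g x \<oplus>\<^bsub>A\<^esub> ?g y"] that by (simp add: g hom_add[OF assms(1)])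
    show "?g (a \<odot>\<^bsub>B\<^esub> y) = a \<odot>\<^bsub>A\<^esub> ?g y" if "a \<in> carrier R" "y \<in> carrier B" for a y
      using g(3)[of "a \<odot>\<^bsub>A\<^esub> ?g y"] that by (simp add: g hom_smult[OF assms(1)])
  qed (use g in auto)
qed

lemma direct_sum_module:
  assumes "right_module R A" "right_module R B"
  shows "right_module R (direct_sum A B)"
proof -
  interpret A: right_module R A by fact
  interpret B: right_module R B by fact
  have "abelian_group (direct_sum A B)"
  proof (rule abelian_groupI)
    fix x assume "x \<in> carrier (direct_sum A B)"
    then show "\<exists>y\<in>carrier (direct_sum A B). y \<oplus>\<^bsub>direct_sum A B\<^esub> x = \<zero>\<^bsub>direct_sum A B\<^esub>"
      by (intro bexI[of _ "(\<ominus>\<^bsub>A\<^esub> fst x, \<ominus>\<^bsub>B\<^esub> snd x)"])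
        (auto simp: direct_sum_def A.M.l_neg B.M.l_neg)
  qed (auto simp: direct_sum_def A.M.a_ac B.M.a_ac)
  then show ?thesis
    unfolding right_module_def right_module_axioms_def
    by (auto simp: direct_sum_def A.R.ring_axioms A.smult_ring_distr A.smult_module_distr A.smult_assoc
        B.smult_ring_distr B.smult_module_distr B.smult_assoc)
qed

lemma biprod_direct_sum:
  assumes "right_module R A" "right_module R B"
  shows "biprod R A B (direct_sum A B) (\<lambda>a. (a, \<zero>\<^bsub>B\<^esub>)) (\<lambda>b. (\<zero>\<^bsub>A\<^esub>, b)) fst snd"
proof -
  interpret A: right_module R A by fact
  interpret B: right_module R B by fact
  show ?thesis
    unfolding biprod_def
    by (intro conjI rmod_homI) (auto simp: direct_sum_def)
qed

lemma biprod_fin_gen: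
  assumes "right_module R A" "right_module R B" "right_module R W" "biprod R A B W i1 i2 p1 p2"
    "fin_gen R A" "fin_gen R B"
  shows "fin_gen R W"
proof -
  interpret W: right_module R W by fact
  note hom = biprod_hom[OF assms(4)]
  have onto: "p2 ` carrier W = carrier B"
    using biprod_closed[OF assms(4)] biprod_eq[OF assms(4)] by (force intro: image_eqI)
  let ?K = "a_kernel W B p2"
  have "i1 ` carrier A = ?K"
  proof
    show "i1 ` carrier A \<subseteq> ?K"
      using biprod_closed[OF assms(4)] biprod_eq[OF assms(4)] by (auto simp: mem_kernel)
    show "?K \<subseteq> i1 ` carrier A"
    proof
      fix w assume "w \<in> ?K"
      then have w: "w \<in> carrier W" "p2 w = \<zero>\<^bsub>B\<^esub>" by (auto simp: mem_kernel)
      have "w = i1 (p1 w)"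
        using biprod_eq(5)[OF assms(4) w(1)] w hom_zero[OF assms(2,3) hom(2)]
          biprod_closed[OF assms(4)] by simp
      then show "w \<in> i1 ` carrier A" using biprod_closed[OF assms(4)] w by auto
    qed
  qed
  then have "fin_gen R (W\<lparr>carrier := ?K\<rparr>)"
    using fin_gen_image[OF assms(1) submodule_module[OF assms(3) kernel_submodule[OF assms(3,2) hom(4)]]
        hom_restrict_cod[OF hom(1)] _ assms(5)] by auto
  then show ?thesis using fin_gen_extension[OF assms(3,2) hom(4) onto _ assms(6)] by blast
qed

text \<open>The product construction leaves the type of the category; its structure maps are transported to
  a copy inside the category.\<close>

lemma biprod_exists:
  assumes "A \<in> mod_cat R" "B \<in> mod_cat R"
  obtains W i1 i2 p1 p2 where "W \<in> mod_cat R" "biprod R A B W i1 i2 p1 p2"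
proof -
  have AB: "right_module R A" "right_module R B" "fin_gen R A" "fin_gen R B"
    using assms by (auto simp: mod_cat_def)
  note D = direct_sum_module[OF AB(1,2)]
  note b = biprod_direct_sum[OF AB(1,2)]
  have "fin_gen R (direct_sum A B)" by (rule biprod_fin_gen[OF AB(1,2) D b AB(3,4)])
  then obtain W f where W: "W \<in> mod_cat R" "f \<in> rmod_hom R (direct_sum A B) W"
    "bij_betw f (carrier (direct_sum A B)) (carrier W)"
    using fg_module_has_copy[OF D] unfolding rmod_iso_def by blast
  let ?g = "inv_into (carrier (direct_sum A B)) f"
  have g: "y \<in> carrier W \<Longrightarrow> ?g y \<in> carrier (direct_sum A B)" "y \<in> carrier W \<Longrightarrow> f (?g y) = y"
    "x \<in> carrier (direct_sum A B) \<Longrightarrow> ?g (f x) = x" for x y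
    using W(3) by (auto simp: bij_betw_def inv_into_into f_inv_into_f)
  note hg = hom_inv[OF W(2) D W(3)]
  have "biprod R A B W (\<lambda>a. f (a, \<zero>\<^bsub>B\<^esub>)) (\<lambda>b. f (\<zero>\<^bsub>A\<^esub>, b)) (\<lambda>w. fst (?g w)) (\<lambda>w. snd (?g w))"
    unfolding biprod_def
  proof (intro conjI ballI)
    show "f (fst (?g w), \<zero>\<^bsub>B\<^esub>) \<oplus>\<^bsub>W\<^esub> f (\<zero>\<^bsub>A\<^esub>, snd (?g w)) = w" if w: "w \<in> carrier W" for w
      using biprod_eq(5)[OF b g(1)[OF w]] biprod_closed[OF b] g(1,2)[OF w]
      by (simp flip: hom_add[OF W(2)])
  qed (use g(3) biprod_closed[OF b] in \<open>simp_all add: hom_comp[OF biprod_hom(1)[OF b] W(2)]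
      hom_comp[OF biprod_hom(2)[OF b] W(2)] hom_comp[OF hg biprod_hom(3)[OF b]]
      hom_comp[OF hg biprod_hom(4)[OF b]]\<close>)
  with W(1) show ?thesis by (rule that)
qed

lemma biprod_internal:
  assumes "right_module R Z" "submodule A R Z" "submodule B R Z"
    "A <+>\<^bsub>Z\<^esub> B = carrier Z" "A \<inter> B = {\<zero>\<^bsub>Z\<^esub>}"
  obtains p1 p2 where
    "biprod R (Z\<lparr>carrier := A\<rparr>) (Z\<lparr>carrier := B\<rparr>) Z (\<lambda>x. x) (\<lambda>x. x) p1 p2"
proof -
  interpret Z: right_module R Z by fact
  obtain p1 where p1: "p1 \<in> rmod_hom R Z (Z\<lparr>carrier := A\<rparr>)" "\<And>a. a \<in> A \<Longrightarrow> p1 a = a"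
    "\<And>b. b \<in> B \<Longrightarrow> p1 b = \<zero>\<^bsub>Z\<^esub>" "\<And>z. z \<in> carrier Z \<Longrightarrow> \<exists>b\<in>B. z = p1 z \<oplus>\<^bsub>Z\<^esub> b"
    by (rule internal_projection[OF assms]) blast
  note A = submodule_subset[OF assms(2)] and B = submodule_subset[OF assms(3)]
  have p1c: "z \<in> carrier Z \<Longrightarrow> p1 z \<in> A" for z using hom_closed[OF p1(1)] by simp
  define p2 where "p2 z = z \<oplus>\<^bsub>Z\<^esub> \<ominus>\<^bsub>Z\<^esub> p1 z" for z
  have p2: "p2 z \<in> B" "p1 z \<oplus>\<^bsub>Z\<^esub> p2 z = z" if z: "z \<in> carrier Z" for z
  proof -
    obtain b where b: "b \<in> B" "z = p1 z \<oplus>\<^bsub>Z\<^esub> b" using p1(4)[OF z] by blast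
    have c: "p1 z \<in> carrier Z" "b \<in> carrier Z" using b(1) p1c[OF z] A B by auto
    have "p2 z = (p1 z \<oplus>\<^bsub>Z\<^esub> b) \<oplus>\<^bsub>Z\<^esub> \<ominus>\<^bsub>Z\<^esub> p1 z" using b(2) by (simp add: p2_def)
    also have "\<dots> = (b \<oplus>\<^bsub>Z\<^esub> p1 z) \<oplus>\<^bsub>Z\<^esub> \<ominus>\<^bsub>Z\<^esub> p1 z" using c by (simp add: Z.M.a_comm)
    also have "\<dots> = b" using c by (simp add: Z.M.a_assoc Z.M.r_neg)
    finally show "p2 z \<in> B" "p1 z \<oplus>\<^bsub>Z\<^esub> p2 z = z" using b by simp_all
  qed
  have p1Z: "p1 \<in> rmod_hom R Z Z" by (rule hom_widen_cod[OF p1(1) A])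
  have p2h: "p2 \<in> rmod_hom R Z Z"
    unfolding p2_def by (intro hom_plus[OF assms(1)] hom_uminus[OF assms(1)] hom_id p1Z)
  show ?thesis
  proof (rule that)
    show "biprod R (Z\<lparr>carrier := A\<rparr>) (Z\<lparr>carrier := B\<rparr>) Z (\<lambda>x. x) (\<lambda>x. x) p1 p2"
      unfolding biprod_def
    proof (intro conjI ballI)
      show "(\<lambda>x. x) \<in> rmod_hom R (Z\<lparr>carrier := A\<rparr>) Z" "(\<lambda>x. x) \<in> rmod_hom R (Z\<lparr>carrier := B\<rparr>) Z"
        using A B by (auto intro: hom_restrict_dom hom_id)
      show "p2 \<in> rmod_hom R Z (Z\<lparr>carrier := B\<rparr>)" using p2 by (intro hom_restrict_cod[OF p2h]) auto
      show "p2 a = \<zero>\<^bsub>Z\<lparr>carrier := B\<rparr>\<^esub>" if "a \<in> carrier (Z\<lparr>carrier := A\<rparr>)" for a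
        using that A p1(2) by (auto simp: p2_def Z.M.r_neg)
      show "p2 b = b" if "b \<in> carrier (Z\<lparr>carrier := B\<rparr>)" for b
        using that B p1(3) by (auto simp: p2_def)
    qed (use p1 p2 in auto)
  qed
qed

section \<open>Projective modules\<close>

lemma mod_catD: "M \<in> mod_cat R \<Longrightarrow> right_module R M" "M \<in> mod_cat R \<Longrightarrow> fin_gen R M"
  by (auto simp: mod_cat_def)

lemma projectiveD: "P \<in> mod_cat R" "right_module R P" if "fg_projective R P"
proof -
  show "P \<in> mod_cat R" using that unfolding fg_projective_def by (rule conjunct1)
  then show "right_module R P" by (rule mod_catD)
qed

lemma projective_lift:
  assumes "fg_projective R P" "A \<in> mod_cat R" "B \<in> mod_cat R" "g \<in> rmod_hom R A B"
    "g ` carrier A = carrier B" "f \<in> rmod_hom R P B"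
  obtains h where "h \<in> rmod_hom R P A" "\<forall>x\<in>carrier P. g (h x) = f x"
proof -
  have "\<exists>h\<in>rmod_hom R P A. \<forall>x\<in>carrier P. g (h x) = f x"
    using assms unfolding fg_projective_def by simp
  then show ?thesis by (elim bexE) (rule that)
qed

lemma zero_submodule_mod_cat:
  assumes "M \<in> mod_cat R"
  shows "M\<lparr>carrier := {\<zero>\<^bsub>M\<^esub>}\<rparr> \<in> mod_cat R"
proof -
  note r = submodule_module[OF mod_catD(1)[OF assms] submodule_singleton_zero[OF mod_catD(1)[OF assms]]]
  have "fin_gen R (M\<lparr>carrier := {\<zero>\<^bsub>M\<^esub>}\<rparr>)"
    unfolding fin_gen_def using submodule_subset submodule_zero
    by (intro exI[of _ "{}"]) fastforce
  with r show ?thesis by (simp add: mod_cat_def)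
qed

lemma const_zero_hom: "right_module R B \<Longrightarrow> (\<lambda>x. \<zero>\<^bsub>B\<^esub>) \<in> rmod_hom R A B"
proof -
  assume "right_module R B"
  then interpret B: right_module R B .
  show ?thesis by (rule rmod_homI) auto
qed

lemma zero_projective:
  assumes "M \<in> mod_cat R" "carrier M = {\<zero>\<^bsub>M\<^esub>}"
  shows "fg_projective R M"
  unfolding fg_projective_def
proof (intro conjI ballI impI)
  fix A B f g assume *: "A \<in> mod_cat R" "B \<in> mod_cat R" "g \<in> rmod_hom R A B" "f \<in> rmod_hom R M B"
  show "\<exists>h\<in>rmod_hom R M A. \<forall>x\<in>carrier M. g (h x) = f x"
    using const_zero_hom[OF mod_catD(1)[OF *(1)]] hom_zero[OF mod_catD(1)[OF *(1)] mod_catD(1)[OF *(2)] *(3)]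
      hom_zero[OF mod_catD(1)[OF assms(1)] mod_catD(1)[OF *(2)] *(4)] assms(2)
    by (intro bexI[of _ "\<lambda>x. \<zero>\<^bsub>A\<^esub>"]) auto
qed fact

lemma biprod_projective:
  assumes "fg_projective R P" "fg_projective R Q" "W \<in> mod_cat R" "biprod R P Q W i1 i2 p1 p2"
  shows "fg_projective R W"
  unfolding fg_projective_def
proof (intro conjI ballI impI)
  fix A B f g assume *: "A \<in> mod_cat R" "B \<in> mod_cat R" "g \<in> rmod_hom R A B" "f \<in> rmod_hom R W B"
    "g ` carrier A = carrier B"
  note h = biprod_hom[OF assms(4)] and c = biprod_closed[OF assms(4)]
  obtain h1 where h1: "h1 \<in> rmod_hom R P A" "\<forall>x\<in>carrier P. g (h1 x) = f (i1 x)"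
    by (rule projective_lift[OF assms(1) *(1,2,3,5) hom_comp[OF h(1) *(4)]])
  obtain h2 where h2: "h2 \<in> rmod_hom R Q A" "\<forall>x\<in>carrier Q. g (h2 x) = f (i2 x)"
    by (rule projective_lift[OF assms(2) *(1,2,3,5) hom_comp[OF h(2) *(4)]])
  have "g (h1 (p1 w) \<oplus>\<^bsub>A\<^esub> h2 (p2 w)) = f w" if "w \<in> carrier W" for w
    using that c biprod_eq(5)[OF assms(4) that]
    by (simp add: hom_add[OF *(3)] hom_closed[OF h1(1)] hom_closed[OF h2(1)] h1(2) h2(2)
        flip: hom_add[OF *(4)])
  then show "\<exists>h\<in>rmod_hom R W A. \<forall>x\<in>carrier W. g (h x) = f x"
    by (intro bexI[of _ "\<lambda>w. h1 (p1 w) \<oplus>\<^bsub>A\<^esub> h2 (p2 w)"] hom_plus[OF mod_catD(1)[OF *(1)]]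
        hom_comp[OF h(3) h1(1)] hom_comp[OF h(4) h2(1)]) auto
qed fact

lemma regular_right_module: "ring R \<Longrightarrow> right_module R (regular_module R)"
proof -
  assume "ring R"
  then interpret ring R .
  have "abelian_group (regular_module R)"
  proof (rule abelian_groupI)
    fix x assume "x \<in> carrier (regular_module R)"
    then show "\<exists>y\<in>carrier (regular_module R). y \<oplus>\<^bsub>regular_module R\<^esub> x = \<zero>\<^bsub>regular_module R\<^esub>"
      by (intro bexI[of _ "\<ominus>\<^bsub>R\<^esub> x"]) (auto simp: regular_module_def l_neg)
  qed (auto simp: regular_module_def a_ac)
  then show ?thesis
    unfolding right_module_def right_module_axioms_def
    by (auto simp: regular_module_def ring_axioms r_distr l_distr m_assoc)
qed

lemma regular_fin_gen: "ring R \<Longrightarrow> fin_gen R (regular_module R)"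
proof -
  assume "ring R"
  then interpret ring R .
  have "H = carrier R" if H: "submodule H R (regular_module R)" "\<one>\<^bsub>R\<^esub> \<in> H" for H
    using submodule_smult[OF H(1) _ H(2)] submodule_subset[OF H(1)] by (auto simp: regular_module_def)
  then show ?thesis unfolding fin_gen_def by (intro exI[of _ "{\<one>\<^bsub>R\<^esub>}"]) (auto simp: regular_module_def)
qed

text \<open>\<open>Q\<close> is a copy of the regular module and \<open>e\<close> the image of one: a homomorphism out of \<open>Q\<close> is
  the same as the element to which it sends \<open>e\<close>.\<close>

lemma free_cyclic_module:
  assumes "ring R"
  obtains Q :: "'r fgmod" and e where "fg_projective R Q" "e \<in> carrier Q"
    "\<forall>M\<in>mod_cat R. \<forall>m\<in>carrier M. \<exists>f\<in>rmod_hom R Q M. f e = m"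
proof -
  interpret ring R by fact
  let ?F = "regular_module R"
  note F = regular_right_module[OF assms] regular_fin_gen[OF assms]
  have Fs [simp]: "carrier ?F = carrier R" "a \<odot>\<^bsub>?F\<^esub> x = x \<otimes>\<^bsub>R\<^esub> a" "x \<oplus>\<^bsub>?F\<^esub> y = x \<oplus>\<^bsub>R\<^esub> y" for a x y
    by (simp_all add: regular_module_def)
  obtain Q j where Q: "Q \<in> mod_cat R" "j \<in> rmod_hom R ?F Q" "bij_betw j (carrier R) (carrier Q)"
    using fg_module_has_copy[OF F] unfolding rmod_iso_def by auto
  let ?g = "inv_into (carrier R) j"
  have hg: "?g \<in> rmod_hom R Q ?F" using hom_inv[OF Q(2) F(1)] Q(3) by simp
  have gj: "?g (j x) = x" if "x \<in> carrier R" for x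
    using Q(3) that by (simp add: bij_betw_def inv_into_f_f)
  have gen: "\<exists>x\<in>carrier R. q = x \<odot>\<^bsub>Q\<^esub> j \<one>\<^bsub>R\<^esub>" if q: "q \<in> carrier Q" for q
  proof -
    obtain x where x: "x \<in> carrier R" "q = j x" using q Q(3) by (auto simp: bij_betw_def)
    then show ?thesis using hom_smult[OF Q(2), of x "\<one>\<^bsub>R\<^esub>"] by auto
  qed
  have ex: "\<exists>f\<in>rmod_hom R Q M. f (j \<one>\<^bsub>R\<^esub>) = m" if M: "M \<in> mod_cat R" "m \<in> carrier M" for M m
  proof -
    interpret M: right_module R M using M(1) by (rule mod_catD)
    have "(\<lambda>q. ?g q \<odot>\<^bsub>M\<^esub> m) \<in> rmod_hom R Q M"
      using hom_closed[OF hg] hom_add[OF hg] hom_smult[OF hg] M(2)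
      by (intro rmod_homI) (simp_all add: M.smult_ring_distr M.smult_assoc)
    moreover have "?g (j \<one>\<^bsub>R\<^esub>) \<odot>\<^bsub>M\<^esub> m = m" using M(2) by (simp add: gj)
    ultimately show ?thesis by (intro bexI[of _ "\<lambda>q. ?g q \<odot>\<^bsub>M\<^esub> m"])
  qed
  have e: "j \<one>\<^bsub>R\<^esub> \<in> carrier Q" using hom_closed[OF Q(2)] by simp
  have "fg_projective R Q"
    unfolding fg_projective_def
  proof (intro conjI ballI impI)
    fix A B f g assume *: "A \<in> mod_cat R" "B \<in> mod_cat R" "g \<in> rmod_hom R A B" "f \<in> rmod_hom R Q B"
      "g ` carrier A = carrier B"
    obtain a where a: "a \<in> carrier A" "g a = f (j \<one>\<^bsub>R\<^esub>)" using hom_closed[OF *(4) e] *(5) by (metis imageE)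
    obtain h where h: "h \<in> rmod_hom R Q A" "h (j \<one>\<^bsub>R\<^esub>) = a" using ex[OF *(1) a(1)] by blast
    have "g (h q) = f q" if "q \<in> carrier Q" for q
      using gen[OF that] e a h(2) hom_closed[OF h(1)]
      by (auto simp: hom_smult[OF h(1)] hom_smult[OF *(3)] hom_smult[OF *(4)])
    then show "\<exists>h\<in>rmod_hom R Q A. \<forall>x\<in>carrier Q. g (h x) = f x" using h(1) by blast
  qed fact
  moreover have "\<forall>M\<in>mod_cat R. \<forall>m\<in>carrier M. \<exists>f\<in>rmod_hom R Q M. f (j \<one>\<^bsub>R\<^esub>) = m"
    by (intro ballI ex)
  ultimately show ?thesis using e that[of Q "j \<one>\<^bsub>R\<^esub>"] by simp
qed

text \<open>One free cyclic summand is used for each generator.\<close>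

lemma projective_cover_exists:
  assumes "M \<in> mod_cat R"
  obtains P p where "fg_projective R P" "p \<in> rmod_hom R P M" "p ` carrier P = carrier M"
proof -
  interpret M: right_module R M using assms by (rule mod_catD)
  obtain F :: "'a fgmod" and e where F: "fg_projective R F" "e \<in> carrier F"
    "\<forall>M\<in>mod_cat R. \<forall>m\<in>carrier M. \<exists>f\<in>rmod_hom R F M. f e = m"
    by (rule free_cyclic_module[OF M.R.ring_axioms])
  have ex: "\<exists>P p. fg_projective R P \<and> p \<in> rmod_hom R P M \<and> A \<subseteq> p ` carrier P"
    if "finite A" "A \<subseteq> carrier M" for A
    using that
  proof (induction A rule: finite_induct)
    case empty
    show ?case
      using zero_projective[OF zero_submodule_mod_cat[OF assms]] const_zero_hom[OF M.right_module_axioms] by auto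
  next
    case (insert m A)
    then have "\<exists>P p. fg_projective R P \<and> p \<in> rmod_hom R P M \<and> A \<subseteq> p ` carrier P" by simp
    then obtain P p where P: "fg_projective R P" "p \<in> rmod_hom R P M" "A \<subseteq> p ` carrier P"
      by (elim exE conjE)
    have m: "m \<in> carrier M" using insert by simp
    obtain f where f: "f \<in> rmod_hom R F M" "f e = m" using F(3) assms m by blast
    obtain W i1 i2 p1 p2 where W: "W \<in> mod_cat R" "biprod R P F W i1 i2 p1 p2"
      by (rule biprod_exists[OF projectiveD(1)[OF P(1)] projectiveD(1)[OF F(1)]])
    let ?h = "\<lambda>w. p (p1 w) \<oplus>\<^bsub>M\<^esub> f (p2 w)"
    have h: "?h \<in> rmod_hom R W M"
      by (intro hom_plus[OF M.right_module_axioms] hom_comp[OF biprod_hom(3)[OF W(2)] P(2)]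
          hom_comp[OF biprod_hom(4)[OF W(2)] f(1)])
    have "p x \<in> ?h ` carrier W" if "x \<in> carrier P" for x
      using that biprod_closed[OF W(2)] biprod_eq[OF W(2)] hom_closed[OF P(2)]
        hom_zero[OF projectiveD(2)[OF F(1)] M.right_module_axioms f(1)]
      by (intro image_eqI[of _ _ "i1 x"]) auto
    moreover have "m \<in> ?h ` carrier W"
      using F(2) f(2) biprod_closed[OF W(2)] biprod_eq[OF W(2)] hom_closed[OF f(1)]
        hom_zero[OF projectiveD(2)[OF P(1)] M.right_module_axioms P(2)]
      by (intro image_eqI[of _ _ "i2 e"]) auto
    ultimately have "insert m A \<subseteq> ?h ` carrier W" using P(3) by blast
    then show ?case using biprod_projective[OF P(1) F(1) W] h by (intro exI conjI)
  qed
  obtain A where A: "A \<subseteq> carrier M" "finite A"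
    "\<And>H. submodule H R M \<Longrightarrow> A \<subseteq> H \<Longrightarrow> H = carrier M"
    using mod_catD(2)[OF assms] unfolding fin_gen_def by blast
  obtain P p where P: "fg_projective R P" "p \<in> rmod_hom R P M" "A \<subseteq> p ` carrier P"
    using ex[OF A(2,1)] by (elim exE conjE)
  have "p ` carrier P = carrier M"
    using A(3)[OF image_submodule[OF projectiveD(2)[OF P(1)] M.right_module_axioms P(2)
          submodule_carrier[OF projectiveD(2)[OF P(1)]]] P(3)] .
  with P(1,2) show ?thesis by (rule that)
qed

section \<open>Stable retracts\<close>

text \<open>The maps say that \<open>x \<mapsto> (a x, b x)\<close> and \<open>(y, q) \<mapsto> c y + d q\<close> make \<open>X\<close> a retract of \<open>Y \<oplus> Q\<close>.
  In this form being a stable summand becomes an equation between maps, which can be lifted along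
  projective surjections.\<close>

definition stable_retract :: "('r, 'x) ring_scheme \<Rightarrow> 'r fgmod \<Rightarrow> 'r fgmod \<Rightarrow> bool" where
  "stable_retract R X Y \<longleftrightarrow> (\<exists>Q a b c d. fg_projective R Q \<and>
     a \<in> rmod_hom R X Y \<and> c \<in> rmod_hom R Y X \<and> b \<in> rmod_hom R X Q \<and> d \<in> rmod_hom R Q X \<and>
     (\<forall>x\<in>carrier X. c (a x) \<oplus>\<^bsub>X\<^esub> d (b x) = x))"

text \<open>The retraction is the projection onto the summand followed by the inverse of the isomorphism.\<close>

lemma stable_summand_imp_retract:
  assumes "X \<in> mod_cat R" "Y \<in> mod_cat R" "stable_summand R X Y"
  shows "stable_retract R X Y"
proof -
  interpret X: right_module R X using assms(1) by (rule mod_catD)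
  interpret Y: right_module R Y using assms(2) by (rule mod_catD)
  obtain Q A B \<phi> where Q: "fg_projective R Q" and
    AB: "submodule A R (direct_sum Y Q)" "submodule B R (direct_sum Y Q)"
      "A <+>\<^bsub>direct_sum Y Q\<^esub> B = carrier (direct_sum Y Q)" "A \<inter> B = {\<zero>\<^bsub>direct_sum Y Q\<^esub>}" and
    \<phi>: "\<phi> \<in> rmod_hom R X ((direct_sum Y Q)\<lparr>carrier := A\<rparr>)" "bij_betw \<phi> (carrier X) A"
    using assms(3) unfolding stable_summand_def direct_summand_def rmod_iso_def by auto
  interpret Q: right_module R Q using Q by (rule projectiveD)
  let ?Z = "direct_sum Y Q"
  note Z = direct_sum_module[OF Y.right_module_axioms Q.right_module_axioms]
  note bp = biprod_direct_sum[OF Y.right_module_axioms Q.right_module_axioms]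
  note A = submodule_subset[OF AB(1)]
  obtain \<pi> where \<pi>: "\<pi> \<in> rmod_hom R ?Z (?Z\<lparr>carrier := A\<rparr>)" "\<And>a. a \<in> A \<Longrightarrow> \<pi> a = a"
    by (rule internal_projection[OF Z AB]) blast
  let ?\<psi> = "inv_into (carrier X) \<phi>"
  have \<psi>: "?\<psi> \<in> rmod_hom R (?Z\<lparr>carrier := A\<rparr>) X" using hom_inv[OF \<phi>(1) X.right_module_axioms] \<phi>(2) by simp
  have \<psi>\<phi>: "?\<psi> (\<phi> x) = x" if "x \<in> carrier X" for x
    using \<phi>(2) that by (simp add: bij_betw_def inv_into_f_f)
  note \<phi>Z = hom_widen_cod[OF \<phi>(1) A]
  have "?\<psi> (\<pi> (fst (\<phi> x), \<zero>\<^bsub>Q\<^esub>)) \<oplus>\<^bsub>X\<^esub> ?\<psi> (\<pi> (\<zero>\<^bsub>Y\<^esub>, snd (\<phi> x))) = x" if x: "x \<in> carrier X" for x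
  proof -
    have c: "(fst (\<phi> x), \<zero>\<^bsub>Q\<^esub>) \<in> carrier ?Z" "(\<zero>\<^bsub>Y\<^esub>, snd (\<phi> x)) \<in> carrier ?Z"
      using hom_closed[OF \<phi>Z x] biprod_closed[OF bp] by auto
    have "?\<psi> (\<pi> (fst (\<phi> x), \<zero>\<^bsub>Q\<^esub>)) \<oplus>\<^bsub>X\<^esub> ?\<psi> (\<pi> (\<zero>\<^bsub>Y\<^esub>, snd (\<phi> x)))
        = ?\<psi> (\<pi> ((fst (\<phi> x), \<zero>\<^bsub>Q\<^esub>) \<oplus>\<^bsub>?Z\<^esub> (\<zero>\<^bsub>Y\<^esub>, snd (\<phi> x))))"
      unfolding hom_add[OF \<pi>(1) c] by (rule hom_add[OF \<psi> hom_closed[OF \<pi>(1) c(1)] hom_closed[OF \<pi>(1) c(2)], symmetric])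
    also have "\<dots> = ?\<psi> (\<pi> (\<phi> x))" using biprod_eq(5)[OF bp hom_closed[OF \<phi>Z x]] by simp
    also have "\<dots> = x" using \<pi>(2) hom_closed[OF \<phi>(1) x] \<psi>\<phi>[OF x] by simp
    finally show ?thesis .
  qed
  then show ?thesis
    unfolding stable_retract_def
    using Q hom_comp[OF \<phi>Z biprod_hom(3)[OF bp]] hom_comp[OF \<phi>Z biprod_hom(4)[OF bp]]
      hom_comp[OF hom_comp[OF biprod_hom(1)[OF bp] \<pi>(1)] \<psi>] hom_comp[OF hom_comp[OF biprod_hom(2)[OF bp] \<pi>(1)] \<psi>]
    by (intro exI[of _ Q] exI[of _ "\<lambda>x. fst (\<phi> x)"] exI[of _ "\<lambda>x. snd (\<phi> x)"]
        exI[of _ "\<lambda>y. ?\<psi> (\<pi> (y, \<zero>\<^bsub>Q\<^esub>))"] exI[of _ "\<lambda>q. ?\<psi> (\<pi> (\<zero>\<^bsub>Y\<^esub>, q))"] conjI ballI)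
qed

text \<open>The image of the section and the kernel of the retraction are complementary.\<close>

lemma stable_retract_imp_summand:
  assumes "X \<in> mod_cat R" "Y \<in> mod_cat R" "stable_retract R X Y"
  shows "stable_summand R X Y"
proof -
  interpret X: right_module R X using assms(1) by (rule mod_catD)
  interpret Y: right_module R Y using assms(2) by (rule mod_catD)
  obtain Q a b c d where Q: "fg_projective R Q" and
    abcd: "a \<in> rmod_hom R X Y" "c \<in> rmod_hom R Y X" "b \<in> rmod_hom R X Q" "d \<in> rmod_hom R Q X"
      "\<forall>x\<in>carrier X. c (a x) \<oplus>\<^bsub>X\<^esub> d (b x) = x"
    using assms(3) unfolding stable_retract_def by (elim exE conjE)
  interpret Q: right_module R Q using Q by (rule projectiveD)
  let ?Z = "direct_sum Y Q"
  note Zm = direct_sum_module[OF Y.right_module_axioms Q.right_module_axioms]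
  note bp = biprod_direct_sum[OF Y.right_module_axioms Q.right_module_axioms]
  interpret Z: right_module R ?Z by (rule Zm)
  define i where "i x = (a x, b x)" for x
  define r where "r z = c (fst z) \<oplus>\<^bsub>X\<^esub> d (snd z)" for z
  have i: "i \<in> rmod_hom R X ?Z"
    unfolding i_def using abcd(1,3)[THEN hom_closed] abcd(1,3)[THEN hom_add] abcd(1,3)[THEN hom_smult]
    by (intro rmod_homI) (auto simp: direct_sum_def)
  have r: "r \<in> rmod_hom R ?Z X"
    unfolding r_def by (intro hom_plus[OF X.right_module_axioms] hom_comp[OF biprod_hom(3)[OF bp] abcd(2)]
        hom_comp[OF biprod_hom(4)[OF bp] abcd(4)])
  have ri: "r (i x) = x" if "x \<in> carrier X" for x using abcd(5) that by (simp add: i_def r_def)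
  let ?A = "i ` carrier X" and ?B = "a_kernel ?Z X r"
  have A: "submodule ?A R ?Z"
    by (rule image_submodule[OF X.right_module_axioms Zm i submodule_carrier[OF X.right_module_axioms]])
  have B: "submodule ?B R ?Z" by (rule kernel_submodule[OF Zm X.right_module_axioms r])
  have "z \<in> ?A <+>\<^bsub>?Z\<^esub> ?B" if z: "z \<in> carrier ?Z" for z
  proof -
    define w where "w = z \<oplus>\<^bsub>?Z\<^esub> \<ominus>\<^bsub>?Z\<^esub> i (r z)"
    have cl: "r z \<in> carrier X" "i (r z) \<in> carrier ?Z" using hom_closed[OF r z] hom_closed[OF i] by auto
    have "w \<in> ?B"
      using z cl by (simp add: w_def mem_kernel hom_add[OF r] hom_neg[OF Zm X.right_module_axioms r] ri X.M.r_neg)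
    moreover have "z = i (r z) \<oplus>\<^bsub>?Z\<^esub> w"
      using z cl by (simp add: w_def Z.M.a_lcomm[of "i (r z)" z] Z.M.r_neg)
    ultimately show ?thesis using cl(1) unfolding set_add_def' by blast
  qed
  moreover have "?A <+>\<^bsub>?Z\<^esub> ?B \<subseteq> carrier ?Z"
    using submodule_subset[OF A] submodule_subset[OF B]
    by (intro Z.M.set_add_closed)
  ultimately have "?A <+>\<^bsub>?Z\<^esub> ?B = carrier ?Z" by blast
  moreover have "?A \<inter> ?B = {\<zero>\<^bsub>?Z\<^esub>}"
  proof -
    have "z = \<zero>\<^bsub>?Z\<^esub>" if z: "z \<in> ?A \<inter> ?B" for z
    proof -
      obtain x where x: "x \<in> carrier X" "z = i x" using z by blast
      have "r z = \<zero>\<^bsub>X\<^esub>" using z by (simp add: mem_kernel)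
      then have "x = \<zero>\<^bsub>X\<^esub>" using ri[OF x(1)] x(2) by simp
      then show ?thesis using hom_zero[OF X.right_module_axioms Zm i] x(2) by simp
    qed
    then show ?thesis using submodule_zero[OF A] submodule_zero[OF B] by blast
  qed
  moreover have "rmod_iso R X (?Z\<lparr>carrier := ?A\<rparr>)"
    unfolding rmod_iso_def
    using hom_restrict_cod[OF i, of ?A] inj_on_inverseI[of "carrier X" r i] ri
    by (intro bexI[of _ i]) (simp_all add: bij_betw_def)
  ultimately show ?thesis
    unfolding stable_summand_def direct_summand_def using Q A B
    by (intro exI[of _ Q] conjI exI[of _ ?A] exI[of _ ?B])
qed

section \<open>Syzygies\<close>

abbreviation Ker :: "('r, 'a) module \<Rightarrow> ('r, 'b) module \<Rightarrow> ('a \<Rightarrow> 'b) \<Rightarrow> ('r, 'a) module" where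
  "Ker A B f \<equiv> A\<lparr>carrier := a_kernel A B f\<rparr>"

definition surj_hom ::
    "('r, 'x) ring_scheme \<Rightarrow> ('r, 'a) module \<Rightarrow> ('r, 'b) module \<Rightarrow> ('a \<Rightarrow> 'b) \<Rightarrow> bool" where
  "surj_hom R A B f \<longleftrightarrow> f \<in> rmod_hom R A B \<and> f ` carrier A = carrier B"

text \<open>Any surjection from a projective module counts; it need not be minimal.\<close>

definition cover :: "('r, 'x) ring_scheme \<Rightarrow> 'r fgmod \<Rightarrow> 'r fgmod \<Rightarrow> _ \<Rightarrow> bool" where
  "cover R P M p \<longleftrightarrow> fg_projective R P \<and> surj_hom R P M p"

lemma surj_homD: "f \<in> rmod_hom R A B" "f ` carrier A = carrier B" if "surj_hom R A B f"
  using that by (simp_all add: surj_hom_def)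

lemma surj_homE:
  assumes "surj_hom R A B f" "b \<in> carrier B" obtains a where "a \<in> carrier A" "f a = b"
  using assms unfolding surj_hom_def by (metis imageE)

lemma surj_homI:
  assumes "f \<in> rmod_hom R A B" "\<And>b. b \<in> carrier B \<Longrightarrow> \<exists>a\<in>carrier A. f a = b"
  shows "surj_hom R A B f"
  unfolding surj_hom_def using assms(1,2) hom_closed[OF assms(1)] by (fastforce simp: image_iff)

lemma coverD: "fg_projective R P" "surj_hom R P M p" "P \<in> mod_cat R" if "cover R P M p"
proof -
  show *: "fg_projective R P" using that unfolding cover_def by (rule conjunct1)
  show "surj_hom R P M p" using that unfolding cover_def by (rule conjunct2)
  show "P \<in> mod_cat R" using * by (rule projectiveD)
qed

lemma coverI: "fg_projective R P \<Longrightarrow> surj_hom R P M p \<Longrightarrow> cover R P M p"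
  unfolding cover_def by (rule conjI)

lemma cover_exists:
  assumes "M \<in> mod_cat R" obtains P p where "cover R P M p"
proof -
  obtain P p where "fg_projective R P" "p \<in> rmod_hom R P M" "p ` carrier P = carrier M"
    by (rule projective_cover_exists[OF assms])
  then show ?thesis by (intro that[of P p] coverI) (simp_all add: surj_hom_def)
qed

lemma syzygy_Suc:
  "syzygy R (Suc n) M X \<longleftrightarrow> (\<exists>Y P p. syzygy R n M Y \<and> cover R P Y p \<and> X = Ker P Y p)"
  unfolding syzygy.simps cover_def surj_hom_def conj_assoc ..

text \<open>The recursion for syzygies splits off the last step; comparing the syzygies of a module with those
  of its first syzygy requires splitting off the first one.\<close>

lemma syzygy_Suc_front:
  "syzygy R (Suc n) M X \<longleftrightarrow> (\<exists>P p. cover R P M p \<and> syzygy R n (Ker P M p) X)"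
proof (induction n arbitrary: X)
  case 0
  show ?case unfolding syzygy_Suc by auto
next
  case (Suc n)
  show ?case unfolding syzygy_Suc[of R "Suc n"] Suc unfolding syzygy_Suc by blast
qed

locale noetherian_modules = ring R for R :: "('r, 'x) ring_scheme" (structure) +
  assumes submodule_fin_gen:
    "M \<in> mod_cat R \<Longrightarrow> submodule H R M \<Longrightarrow> fin_gen R (M\<lparr>carrier := H\<rparr>)"
begin

lemma sub_mod_cat: "M \<in> mod_cat R \<Longrightarrow> submodule H R M \<Longrightarrow> M\<lparr>carrier := H\<rparr> \<in> mod_cat R"
  using submodule_fin_gen[of M H] submodule_module[of R M H] by (simp add: mod_cat_def)

lemma ker_mod_cat:
  assumes "A \<in> mod_cat R" "B \<in> mod_cat R" "f \<in> rmod_hom R A B"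
  shows "Ker A B f \<in> mod_cat R"
  by (intro sub_mod_cat kernel_submodule assms mod_catD[OF assms(1)] mod_catD[OF assms(2)])

lemma syzygy_mod_cat:
  assumes "M \<in> mod_cat R" "syzygy R n M X" shows "X \<in> mod_cat R"
  using assms(2)
proof (induction n arbitrary: X)
  case 0 then show ?case using assms(1) by simp
next
  case (Suc n)
  then obtain Y P p where *: "syzygy R n M Y" "cover R P Y p" "X = Ker P Y p"
    unfolding syzygy_Suc by (elim exE conjE)
  then show ?case
    using ker_mod_cat[OF coverD(3)[OF *(2)] Suc.IH[OF *(1)] surj_homD(1)[OF coverD(2)[OF *(2)]]] by simp
qed

lemma syzygy_extend:
  assumes "M \<in> mod_cat R" "syzygy R n M X"
  obtains P p where "cover R P X p" "syzygy R (Suc n) M (Ker P X p)"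
proof -
  obtain P p where "cover R P X p" by (rule cover_exists[OF syzygy_mod_cat[OF assms]])
  then show ?thesis using that[of P p] assms(2) unfolding syzygy_Suc by metis
qed

lemma syzygy_exists: "M \<in> mod_cat R \<Longrightarrow> \<exists>X. syzygy R n M X"
proof (induction n)
  case (Suc n)
  then obtain X where "syzygy R n M X" by metis
  then show ?case using syzygy_extend[OF Suc.prems] by metis
next
  case 0
  show ?case by (intro exI[of _ M]) simp
qed

text \<open>Lift \<open>a\<close>, \<open>c\<close> and \<open>d\<close> to the projective modules.  The lift of \<open>c a + d b\<close> differs from the
  identity of \<open>P\<close> by a map \<open>\<psi>\<close> with values in the kernel of \<open>p\<close>.  On that kernel the lift of \<open>d b\<close>
  vanishes, so its identity is \<open>c' a' + \<psi>\<close>, and \<open>\<psi>\<close> restricted to the kernel factors through \<open>P\<close>.\<close>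

lemma stable_retract_syzygy:
  assumes "X \<in> mod_cat R" "Y \<in> mod_cat R" "stable_retract R X Y" "cover R P X p" "cover R P' Y p'"
  shows "stable_retract R (Ker P X p) (Ker P' Y p')"
proof -
  interpret X: right_module R X using assms(1) by (rule mod_catD)
  interpret P: right_module R P using coverD(1)[OF assms(4)] by (rule projectiveD)
  obtain Q a b c d where Q: "fg_projective R Q" and
    abcd: "a \<in> rmod_hom R X Y" "c \<in> rmod_hom R Y X" "b \<in> rmod_hom R X Q" "d \<in> rmod_hom R Q X"
      "\<forall>x\<in>carrier X. c (a x) \<oplus>\<^bsub>X\<^esub> d (b x) = x"
    using assms(3) unfolding stable_retract_def by (elim exE conjE)
  note P = coverD(1,3)[OF assms(4)] surj_homD[OF coverD(2)[OF assms(4)]]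
  note P' = coverD(1,3)[OF assms(5)] surj_homD[OF coverD(2)[OF assms(5)]]
  note r = mod_catD(1)[OF assms(1)] mod_catD(1)[OF assms(2)]
  note rP = mod_catD(1)[OF P(2)] mod_catD(1)[OF P'(2)]
  obtain a' where a': "a' \<in> rmod_hom R P P'" "\<forall>x\<in>carrier P. p' (a' x) = a (p x)"
    by (rule projective_lift[OF P(1) P'(2) assms(2) P'(3,4) hom_comp[OF P(3) abcd(1)]])
  obtain c' where c': "c' \<in> rmod_hom R P' P" "\<forall>x\<in>carrier P'. p (c' x) = c (p' x)"
    by (rule projective_lift[OF P'(1) P(2) assms(1) P(3,4) hom_comp[OF P'(3) abcd(2)]])
  obtain d' where d': "d' \<in> rmod_hom R Q P" "\<forall>x\<in>carrier Q. p (d' x) = d x"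
    by (rule projective_lift[OF Q P(2) assms(1) P(3,4) abcd(4)])
  define \<psi> where "\<psi> x = x \<oplus>\<^bsub>P\<^esub> \<ominus>\<^bsub>P\<^esub> (c' (a' x) \<oplus>\<^bsub>P\<^esub> d' (b (p x)))" for x
  have hm: "(\<lambda>x. c' (a' x) \<oplus>\<^bsub>P\<^esub> d' (b (p x))) \<in> rmod_hom R P P"
    by (intro hom_plus[OF rP(1)] hom_comp[OF a'(1) c'(1)] hom_comp[OF hom_comp[OF P(3) abcd(3)] d'(1)])
  have \<psi>: "\<psi> \<in> rmod_hom R P P"
    unfolding \<psi>_def by (intro hom_plus[OF rP(1)] hom_uminus[OF rP(1)] hom_id hm)
  note cl = hom_closed[OF P(3)] hom_closed[OF P'(3)] hom_closed[OF a'(1)] hom_closed[OF c'(1)]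
    hom_closed[OF d'(1)] hom_closed[OF abcd(3)] hom_closed[OF abcd(1)]
  have \<psi>0: "p (\<psi> x) = \<zero>\<^bsub>X\<^esub>" if "x \<in> carrier P" for x
    using that abcd(5) by (simp add: \<psi>_def hom_add[OF P(3)] hom_neg[OF rP(1) r(1) P(3)] cl c'(2) a'(2) d'(2) X.M.r_neg)
  let ?KX = "a_kernel P X p" and ?KY = "a_kernel P' Y p'"
  note KX = submodule_subset[OF kernel_submodule[OF rP(1) r(1) P(3)]]
  note KY = submodule_subset[OF kernel_submodule[OF rP(2) r(2) P'(3)]]
  have eq: "c' (a' x) \<oplus>\<^bsub>P\<^esub> \<psi> x = x" if x: "x \<in> ?KX" for x
  proof -
    have xP: "x \<in> carrier P" "p x = \<zero>\<^bsub>X\<^esub>" using x by (simp_all add: mem_kernel)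
    have "d' (b (p x)) = \<zero>\<^bsub>P\<^esub>"
      using xP hom_zero[OF r(1) projectiveD(2)[OF Q] abcd(3)] hom_zero[OF projectiveD(2)[OF Q] rP(1) d'(1)] by simp
    then show ?thesis using xP cl by (simp add: \<psi>_def P.M.a_lcomm[of _ x] P.M.r_neg)
  qed
  have "a' \<in> rmod_hom R (Ker P X p) (Ker P' Y p')"
    using cl a'(2) hom_zero[OF r abcd(1)] by (intro hom_restrict[OF a'(1) KX]) (auto simp: mem_kernel)
  moreover have "c' \<in> rmod_hom R (Ker P' Y p') (Ker P X p)"
    using cl c'(2) hom_zero[OF r(2,1) abcd(2)] by (intro hom_restrict[OF c'(1) KY]) (auto simp: mem_kernel)
  moreover have "(\<lambda>x. x) \<in> rmod_hom R (Ker P X p) P" by (rule hom_restrict_dom[OF hom_id KX])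
  moreover have "\<psi> \<in> rmod_hom R P (Ker P X p)"
    using hom_closed[OF \<psi>] \<psi>0 by (intro hom_restrict_cod[OF \<psi>]) (auto simp: mem_kernel)
  ultimately show ?thesis
    unfolding stable_retract_def
    by (intro exI[of _ P] exI[of _ a'] exI[of _ "\<lambda>x. x"] exI[of _ c'] exI[of _ \<psi>] conjI)
      (simp_all add: eq P(1))
qed

end

section \<open>Biproducts of homomorphisms\<close>

lemma biprod_map:
  assumes "right_module R B" "right_module R B'" "right_module R W"
    and V: "biprod R A A' V i1 i2 q1 q2" and W: "biprod R B B' W j1 j2 p1 p2"
    and f: "f \<in> rmod_hom R A B" "f' \<in> rmod_hom R A' B'"
  obtains F where "F \<in> rmod_hom R V W" "\<forall>v\<in>carrier V. p1 (F v) = f (q1 v)"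
    "\<forall>v\<in>carrier V. p2 (F v) = f' (q2 v)"
proof -
  let ?F = "\<lambda>v. j1 (f (q1 v)) \<oplus>\<^bsub>W\<^esub> j2 (f' (q2 v))"
  have "?F \<in> rmod_hom R V W"
    by (intro hom_plus[OF assms(3)] hom_comp[OF hom_comp[OF biprod_hom(3)[OF V] f(1)] biprod_hom(1)[OF W]]
        hom_comp[OF hom_comp[OF biprod_hom(4)[OF V] f(2)] biprod_hom(2)[OF W]])
  then show ?thesis
    using biprod_p_add[OF assms(1,2) W] biprod_closed[OF V] hom_closed[OF f(1)] hom_closed[OF f(2)]
    by (intro that[of ?F]) simp_all
qed

lemma biprod_map_surj:
  assumes "right_module R A" "right_module R A'" "right_module R V"
    and V: "biprod R A A' V i1 i2 q1 q2" and W: "biprod R B B' W j1 j2 p1 p2"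
    and f: "surj_hom R A B f" "surj_hom R A' B' f'"
    and F: "F \<in> rmod_hom R V W" "\<forall>v\<in>carrier V. p1 (F v) = f (q1 v)"
    "\<forall>v\<in>carrier V. p2 (F v) = f' (q2 v)"
  shows "surj_hom R V W F"
proof (rule surj_homI[OF F(1)])
  interpret V: right_module R V by fact
  fix w assume w: "w \<in> carrier W"
  obtain a where a: "a \<in> carrier A" "f a = p1 w" by (rule surj_homE[OF f(1) biprod_closed(3)[OF W w]])
  obtain a' where a': "a' \<in> carrier A'" "f' a' = p2 w" by (rule surj_homE[OF f(2) biprod_closed(4)[OF W w]])
  let ?v = "i1 a \<oplus>\<^bsub>V\<^esub> i2 a'"
  have v: "?v \<in> carrier V" using biprod_closed[OF V] a a' by simp
  have "F ?v = w"
    by (rule biprod_ext[OF W hom_closed[OF F(1) v] w])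
      (simp_all add: F(2,3)[THEN bspec, OF v] biprod_p_add[OF assms(1,2) V a(1) a'(1)] a a')
  then show "\<exists>v\<in>carrier V. F v = w" using v by (rule bexI)
qed

lemma biprod_map_kernel:
  assumes "right_module R A" "right_module R A'" "right_module R B" "right_module R B'"
      "right_module R V" "right_module R W"
    and V: "biprod R A A' V i1 i2 q1 q2" and W: "biprod R B B' W j1 j2 p1 p2"
    and f: "f \<in> rmod_hom R A B" "f' \<in> rmod_hom R A' B'"
    and F: "F \<in> rmod_hom R V W" "\<forall>v\<in>carrier V. p1 (F v) = f (q1 v)"
    "\<forall>v\<in>carrier V. p2 (F v) = f' (q2 v)"
  shows "biprod R (Ker A B f) (Ker A' B' f') (Ker V W F) i1 i2 q1 q2"
proof -
  note p0 = hom_zero[OF assms(6,3) biprod_hom(3)[OF W]] hom_zero[OF assms(6,4) biprod_hom(4)[OF W]]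
  interpret W: right_module R W by fact
  have Fv: "F v = \<zero>\<^bsub>W\<^esub> \<longleftrightarrow> f (q1 v) = \<zero>\<^bsub>B\<^esub> \<and> f' (q2 v) = \<zero>\<^bsub>B'\<^esub>" if v: "v \<in> carrier V" for v
  proof
    assume "F v = \<zero>\<^bsub>W\<^esub>"
    then show "f (q1 v) = \<zero>\<^bsub>B\<^esub> \<and> f' (q2 v) = \<zero>\<^bsub>B'\<^esub>" using F(2,3)[THEN bspec, OF v] p0 by simp
  next
    assume "f (q1 v) = \<zero>\<^bsub>B\<^esub> \<and> f' (q2 v) = \<zero>\<^bsub>B'\<^esub>"
    then show "F v = \<zero>\<^bsub>W\<^esub>"
      using F(2,3)[THEN bspec, OF v] p0 by (intro biprod_ext[OF W hom_closed[OF F(1) v]]) simp_all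
  qed
  note c = biprod_closed[OF V] and e = biprod_eq[OF V] and h = biprod_hom[OF V]
  note z = hom_zero[OF assms(1,3) f(1)] hom_zero[OF assms(2,4) f(2)]
  have "i1 \<in> rmod_hom R (Ker A B f) (Ker V W F)"
    by (intro hom_restrict[OF h(1)]) (auto simp: mem_kernel Fv c e z)
  moreover have "i2 \<in> rmod_hom R (Ker A' B' f') (Ker V W F)"
    by (intro hom_restrict[OF h(2)]) (auto simp: mem_kernel Fv c e z)
  moreover have "q1 \<in> rmod_hom R (Ker V W F) (Ker A B f)"
    by (intro hom_restrict[OF h(3)]) (auto simp: mem_kernel Fv c)
  moreover have "q2 \<in> rmod_hom R (Ker V W F) (Ker A' B' f')"
    by (intro hom_restrict[OF h(4)]) (auto simp: mem_kernel Fv c)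
  ultimately show ?thesis
    unfolding biprod_def by (intro conjI) (simp_all add: mem_kernel e)
qed

lemma biprod_stable_retract:
  assumes m: "X \<in> mod_cat R" "X' \<in> mod_cat R" "V \<in> mod_cat R" "Y \<in> mod_cat R" "Y' \<in> mod_cat R" "U \<in> mod_cat R"
    and V: "biprod R X X' V i1 i2 q1 q2" and U: "biprod R Y Y' U j1 j2 p1 p2"
    and r: "stable_retract R X Y" "stable_retract R X' Y'"
  shows "stable_retract R V U"
proof -
  obtain Q a b c d where Q: "fg_projective R Q" and
    f: "a \<in> rmod_hom R X Y" "c \<in> rmod_hom R Y X" "b \<in> rmod_hom R X Q" "d \<in> rmod_hom R Q X"
      "\<forall>x\<in>carrier X. c (a x) \<oplus>\<^bsub>X\<^esub> d (b x) = x"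
    using r(1) unfolding stable_retract_def by (elim exE conjE)
  obtain Q' a' b' c' d' where Q': "fg_projective R Q'" and
    f': "a' \<in> rmod_hom R X' Y'" "c' \<in> rmod_hom R Y' X'" "b' \<in> rmod_hom R X' Q'" "d' \<in> rmod_hom R Q' X'"
      "\<forall>x\<in>carrier X'. c' (a' x) \<oplus>\<^bsub>X'\<^esub> d' (b' x) = x"
    using r(2) unfolding stable_retract_def by (elim exE conjE)
  obtain T k1 k2 t1 t2 where T: "T \<in> mod_cat R" "biprod R Q Q' T k1 k2 t1 t2"
    by (rule biprod_exists[OF projectiveD(1)[OF Q] projectiveD(1)[OF Q']])
  note rm = m[THEN mod_catD(1)] projectiveD(2)[OF Q] projectiveD(2)[OF Q'] mod_catD(1)[OF T(1)]
  interpret V: right_module R V by (rule rm)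
  obtain A where A: "A \<in> rmod_hom R V U" "\<forall>v\<in>carrier V. p1 (A v) = a (q1 v)"
    "\<forall>v\<in>carrier V. p2 (A v) = a' (q2 v)"
    by (rule biprod_map[OF rm(4,5,6) V U f(1) f'(1)])
  obtain B where B: "B \<in> rmod_hom R V T" "\<forall>v\<in>carrier V. t1 (B v) = b (q1 v)"
    "\<forall>v\<in>carrier V. t2 (B v) = b' (q2 v)"
    by (rule biprod_map[OF rm(7,8,9) V T(2) f(3) f'(3)])
  obtain C where C: "C \<in> rmod_hom R U V" "\<forall>v\<in>carrier U. q1 (C v) = c (p1 v)"
    "\<forall>v\<in>carrier U. q2 (C v) = c' (p2 v)"
    by (rule biprod_map[OF rm(1,2,3) U V f(2) f'(2)])
  obtain D where D: "D \<in> rmod_hom R T V" "\<forall>v\<in>carrier T. q1 (D v) = d (t1 v)"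
    "\<forall>v\<in>carrier T. q2 (D v) = d' (t2 v)"
    by (rule biprod_map[OF rm(1,2,3) T(2) V f(4) f'(4)])
  have eq: "C (A v) \<oplus>\<^bsub>V\<^esub> D (B v) = v" if v: "v \<in> carrier V" for v
  proof -
    note cl = hom_closed[OF A(1) v] hom_closed[OF B(1) v]
    note cl2 = hom_closed[OF C(1) cl(1)] hom_closed[OF D(1) cl(2)]
    show ?thesis
    proof (rule biprod_ext[OF V])
      show "q1 (C (A v) \<oplus>\<^bsub>V\<^esub> D (B v)) = q1 v"
        using f(5) biprod_closed(3)[OF V v]
        by (simp add: hom_add[OF biprod_hom(3)[OF V] cl2] C(2) D(2) cl A(2) B(2) v)
      show "q2 (C (A v) \<oplus>\<^bsub>V\<^esub> D (B v)) = q2 v"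
        using f'(5) biprod_closed(4)[OF V v]
        by (simp add: hom_add[OF biprod_hom(4)[OF V] cl2] C(3) D(3) cl A(3) B(3) v)
    qed (use cl2 v in simp_all)
  qed
  show ?thesis
    unfolding stable_retract_def
    by (intro exI[of _ T] exI[of _ A] exI[of _ B] exI[of _ C] exI[of _ D] conjI ballI
        A(1) B(1) C(1) D(1) biprod_projective[OF Q Q' T] eq)
qed

context noetherian_modules
begin

lemma biprod_syzygy:
  assumes "M \<in> mod_cat R" "M' \<in> mod_cat R" "W \<in> mod_cat R" "biprod R M M' W j1 j2 r1 r2"
    "syzygy R n M X" "syzygy R n M' X'"
  shows "\<exists>V i1 i2 q1 q2. syzygy R n W V \<and> biprod R X X' V i1 i2 q1 q2"
  using assms(5,6)
proof (induction n arbitrary: X X')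
  case 0
  then show ?case using assms(4) by auto
next
  case (Suc n)
  obtain Y P p where Y: "syzygy R n M Y" "cover R P Y p" "X = Ker P Y p"
    using Suc.prems(1) unfolding syzygy_Suc by (elim exE conjE)
  obtain Y' P' p' where Y': "syzygy R n M' Y'" "cover R P' Y' p'" "X' = Ker P' Y' p'"
    using Suc.prems(2) unfolding syzygy_Suc by (elim exE conjE)
  obtain U i1 i2 q1 q2 where U: "syzygy R n W U" "biprod R Y Y' U i1 i2 q1 q2"
    using Suc.IH[OF Y(1) Y'(1)] by (elim exE conjE)
  note P = coverD[OF Y(2)] and P' = coverD[OF Y'(2)]
  obtain T k1 k2 t1 t2 where T: "T \<in> mod_cat R" "biprod R P P' T k1 k2 t1 t2"
    by (rule biprod_exists[OF P(3) P'(3)])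
  note rm = syzygy_mod_cat[OF assms(1) Y(1), THEN mod_catD(1)] syzygy_mod_cat[OF assms(2) Y'(1), THEN mod_catD(1)]
    syzygy_mod_cat[OF assms(3) U(1), THEN mod_catD(1)] P(3)[THEN mod_catD(1)] P'(3)[THEN mod_catD(1)] T(1)[THEN mod_catD(1)]
  obtain F where F: "F \<in> rmod_hom R T U" "\<forall>v\<in>carrier T. q1 (F v) = p (t1 v)"
    "\<forall>v\<in>carrier T. q2 (F v) = p' (t2 v)"
    by (rule biprod_map[OF rm(1,2,3) T(2) U(2) surj_homD(1)[OF P(2)] surj_homD(1)[OF P'(2)]])
  have "cover R T U F"
    by (intro coverI biprod_projective[OF P(1) P'(1) T] biprod_map_surj[OF rm(4,5,6) T(2) U(2) P(2) P'(2) F])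
  then have "syzygy R (Suc n) W (Ker T U F)"
    using U(1) unfolding syzygy_Suc by (intro exI[of _ U] exI[of _ T] exI[of _ F]) simp
  moreover have "biprod R X X' (Ker T U F) k1 k2 t1 t2"
    unfolding Y(3) Y'(3)
    by (rule biprod_map_kernel[OF rm(4,5,1,2,6,3) T(2) U(2) surj_homD(1)[OF P(2)] surj_homD(1)[OF P'(2)] F])
  ultimately show ?case by (intro exI conjI)
qed

end

section \<open>Delooping\<close>

text \<open>The condition whose least \<open>n\<close> is the \<open>k\<close>-delooping level.\<close>

definition delooped :: "('r, 'x) ring_scheme \<Rightarrow> nat \<Rightarrow> nat \<Rightarrow> 'r fgmod \<Rightarrow> bool" where
  "delooped R k n M \<longleftrightarrow> (\<exists>N \<in> mod_cat R. \<exists>X Y.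
     syzygy R n M X \<and> syzygy R (n + k) N Y \<and> stable_summand R X Y)"

context noetherian_modules
begin

lemma deloopedE:
  assumes "M \<in> mod_cat R" "delooped R k n M"
  obtains N X Y where "N \<in> mod_cat R" "syzygy R n M X" "syzygy R (n + k) N Y" "stable_retract R X Y"
proof -
  obtain N X Y where *: "N \<in> mod_cat R" "syzygy R n M X" "syzygy R (n + k) N Y" "stable_summand R X Y"
    using assms(2) unfolding delooped_def by (elim bexE exE conjE)
  have "stable_retract R X Y"
    by (intro stable_summand_imp_retract[OF _ _ *(4)] syzygy_mod_cat[OF assms(1) *(2)] syzygy_mod_cat[OF *(1,3)])
  with *(1-3) show ?thesis by (rule that)
qed

lemma deloopedI:
  assumes "M \<in> mod_cat R" "N \<in> mod_cat R" "syzygy R n M X" "syzygy R (n + k) N Y" "stable_retract R X Y"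
  shows "delooped R k n M"
  unfolding delooped_def
  by (intro bexI[of _ N] exI[of _ X] exI[of _ Y] conjI assms stable_retract_imp_summand
      syzygy_mod_cat[OF assms(1,3)] syzygy_mod_cat[OF assms(2,4)])

lemma delooped_extend:
  assumes "M \<in> mod_cat R" "delooped R k n M"
  obtains N X Y where "N \<in> mod_cat R" "syzygy R (Suc n) M X" "syzygy R (Suc (n + k)) N Y" "stable_retract R X Y"
proof -
  obtain N X Y where *: "N \<in> mod_cat R" "syzygy R n M X" "syzygy R (n + k) N Y" "stable_retract R X Y"
    by (rule deloopedE[OF assms])
  obtain P p where P: "cover R P X p" "syzygy R (Suc n) M (Ker P X p)" by (rule syzygy_extend[OF assms(1) *(2)])
  obtain P' p' where P': "cover R P' Y p'" "syzygy R (Suc (n + k)) N (Ker P' Y p')" by (rule syzygy_extend[OF *(1,3)])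
  show ?thesis
    by (rule that[OF *(1) P(2) P'(2) stable_retract_syzygy[OF syzygy_mod_cat[OF assms(1) *(2)]
            syzygy_mod_cat[OF *(1,3)] *(4) P(1) P'(1)]])
qed

lemma delooped_mono:
  assumes "M \<in> mod_cat R" "delooped R k n M" "n \<le> n'"
  shows "delooped R k n' M"
  using assms(3)
proof (induction n' rule: dec_induct)
  case base show ?case by fact
next
  case (step n)
  obtain N X Y where *: "N \<in> mod_cat R" "syzygy R (Suc n) M X" "syzygy R (Suc (n + k)) N Y" "stable_retract R X Y"
    by (rule delooped_extend[OF assms(1) step.IH])
  then show ?case by (intro deloopedI[OF assms(1) *(1,2) _ *(4)]) simp
qed

text \<open>The \<open>n\<close>-th syzygy of the first syzygy is the next syzygy of \<open>M\<close>.  Hence passing to the first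
  syzygy raises the number of available deloopings by one and leaves \<open>n\<close> unchanged.\<close>

lemma delooped_cover:
  assumes "M \<in> mod_cat R" "delooped R k n M"
  obtains P p where "cover R P M p" "delooped R (Suc k) n (Ker P M p)"
proof -
  obtain N X Y where *: "N \<in> mod_cat R" "syzygy R (Suc n) M X" "syzygy R (Suc (n + k)) N Y" "stable_retract R X Y"
    by (rule delooped_extend[OF assms])
  obtain P p where P: "cover R P M p" "syzygy R n (Ker P M p) X"
    using *(2) unfolding syzygy_Suc_front by (elim exE conjE)
  have "Ker P M p \<in> mod_cat R"
    by (rule ker_mod_cat[OF coverD(3)[OF P(1)] assms(1) surj_homD(1)[OF coverD(2)[OF P(1)]]])
  then show ?thesis using *(3) by (intro that[OF P(1)] deloopedI[OF _ *(1) P(2) _ *(4)]) simp_all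
qed

lemma delooped_biprod:
  assumes m: "M \<in> mod_cat R" "M' \<in> mod_cat R" "W \<in> mod_cat R" "biprod R M M' W j1 j2 r1 r2"
    and "delooped R k n M" "delooped R k n M'"
  shows "delooped R k n W"
proof -
  obtain N X Y where *: "N \<in> mod_cat R" "syzygy R n M X" "syzygy R (n + k) N Y" "stable_retract R X Y"
    by (rule deloopedE[OF assms(1,5)])
  obtain N' X' Y' where **: "N' \<in> mod_cat R" "syzygy R n M' X'" "syzygy R (n + k) N' Y'" "stable_retract R X' Y'"
    by (rule deloopedE[OF assms(2,6)])
  obtain T k1 k2 t1 t2 where T: "T \<in> mod_cat R" "biprod R N N' T k1 k2 t1 t2"
    by (rule biprod_exists[OF *(1) **(1)])
  obtain V i1 i2 q1 q2 where V: "syzygy R n W V" "biprod R X X' V i1 i2 q1 q2"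
    using biprod_syzygy[OF m *(2) **(2)] by (elim exE conjE)
  obtain U u1 u2 v1 v2 where U: "syzygy R (n + k) T U" "biprod R Y Y' U u1 u2 v1 v2"
    using biprod_syzygy[OF *(1) **(1) T *(3) **(3)] by (elim exE conjE)
  have "stable_retract R V U"
    by (rule biprod_stable_retract[OF syzygy_mod_cat[OF m(1) *(2)] syzygy_mod_cat[OF m(2) **(2)]
          syzygy_mod_cat[OF m(3) V(1)] syzygy_mod_cat[OF *(1) *(3)] syzygy_mod_cat[OF **(1) **(3)]
          syzygy_mod_cat[OF T(1) U(1)] V(2) U(2) *(4) **(4)])
  then show ?thesis by (rule deloopedI[OF m(3) T(1) V(1) U(1)])
qed

text \<open>A projective module is a stable retract of every module, hence of a \<open>k\<close>-th syzygy of zero.\<close>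

lemma delooped_projective:
  assumes "fg_projective R P" shows "delooped R k n P"
proof -
  note P = projectiveD[OF assms]
  interpret P: right_module R P by (rule P)
  define Z where "Z = P\<lparr>carrier := {\<zero>\<^bsub>P\<^esub>}\<rparr>"
  have Z: "Z \<in> mod_cat R" unfolding Z_def by (rule zero_submodule_mod_cat[OF P(1)])
  obtain Y where Y: "syzygy R k Z Y" using syzygy_exists[OF Z, of k] by (elim exE)
  note Ym = syzygy_mod_cat[OF Z Y]
  have "stable_retract R P Y"
    unfolding stable_retract_def
    by (intro exI[of _ P] exI[of _ "\<lambda>x. \<zero>\<^bsub>Y\<^esub>"] exI[of _ "\<lambda>x. x"] exI[of _ "\<lambda>x. \<zero>\<^bsub>P\<^esub>"] conjI assms
        hom_id const_zero_hom mod_catD(1)[OF Ym] P) simp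
  then have "delooped R k 0 P" using Y by (intro deloopedI[OF P(1) Z, of 0 P k Y]) simp_all
  then show ?thesis by (rule delooped_mono[OF P(1)]) simp
qed

end

section \<open>Modules resolved by deloopable modules\<close>

text \<open>Modules with a resolution of length less than \<open>t\<close> whose \<open>i\<close>-th term has \<open>(i + k)\<close>-delooping level
  at most \<open>t - 1 - i\<close>.  The index is one more than the derived delooping level; with this shift the
  zero modules form the class at \<open>t = 0\<close>, and the class is subadditive along extensions.\<close>

primrec resolved :: "('r, 'x) ring_scheme \<Rightarrow> nat \<Rightarrow> nat \<Rightarrow> 'r fgmod \<Rightarrow> bool" where
  "resolved R 0 k M \<longleftrightarrow> M \<in> mod_cat R \<and> carrier M = {\<zero>\<^bsub>M\<^esub>}"
| "resolved R (Suc t) k M \<longleftrightarrow> M \<in> mod_cat R \<and> (\<exists>X f. X \<in> mod_cat R \<and> delooped R k t X \<and>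
     surj_hom R X M f \<and> resolved R t (Suc k) (Ker X M f))"

lemma resolved_mod_cat: "resolved R t k M \<Longrightarrow> M \<in> mod_cat R"
  by (cases t) simp_all

lemma resolved_SucE:
  assumes "resolved R (Suc t) k M"
  obtains X f where "X \<in> mod_cat R" "delooped R k t X" "surj_hom R X M f" "resolved R t (Suc k) (Ker X M f)"
  using assms unfolding resolved.simps by (elim exE conjE)

lemma resolved_SucI:
  assumes "M \<in> mod_cat R" "X \<in> mod_cat R" "delooped R k t X" "surj_hom R X M f" "resolved R t (Suc k) (Ker X M f)"
  shows "resolved R (Suc t) k M"
  unfolding resolved.simps by (intro conjI exI[of _ X] exI[of _ f] assms)

lemma resolved_iso:
  assumes "resolved R t k M" "surj_hom R M N g" "\<forall>x\<in>carrier M. g x = \<zero>\<^bsub>N\<^esub> \<longrightarrow> x = \<zero>\<^bsub>M\<^esub>" "N \<in> mod_cat R"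
  shows "resolved R t k N"
proof (cases t)
  case 0
  have rm: "right_module R M" "right_module R N" "carrier M = {\<zero>\<^bsub>M\<^esub>}"
    using assms(1,4) 0 by (simp_all add: mod_cat_def)
  then have "carrier N = {\<zero>\<^bsub>N\<^esub>}"
    using surj_homD(2)[OF assms(2)] hom_zero[OF rm(1,2) surj_homD(1)[OF assms(2)]] by simp
  then show ?thesis using 0 assms(4) by simp
next
  case (Suc s)
  obtain X f where X: "X \<in> mod_cat R" "delooped R k s X" "surj_hom R X M f" "resolved R s (Suc k) (Ker X M f)"
    using assms(1) unfolding Suc by (rule resolved_SucE)
  have "a_kernel X N (\<lambda>x. g (f x)) = a_kernel X M f"
    using assms(3) hom_closed[OF surj_homD(1)[OF X(3)]]
      hom_zero[OF mod_catD(1)[OF resolved_mod_cat[OF assms(1)]] mod_catD(1)[OF assms(4)] surj_homD(1)[OF assms(2)]]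
    by (auto simp: mem_kernel)
  then have "resolved R s (Suc k) (Ker X N (\<lambda>x. g (f x)))" using X(4) by (simp only:)
  moreover have "surj_hom R X N (\<lambda>x. g (f x))"
    using surj_homD[OF X(3)] surj_homD[OF assms(2)] hom_comp unfolding surj_hom_def
    by (metis image_image)
  ultimately show ?thesis unfolding Suc by (intro resolved_SucI[OF assms(4) X(1,2)])
qed

context noetherian_modules
begin

lemma resolved_zero:
  assumes "M \<in> mod_cat R" "carrier M = {\<zero>\<^bsub>M\<^esub>}" shows "resolved R t k M"
  using assms
proof (induction t arbitrary: k M)
  case 0 then show ?case by simp
next
  case (Suc t)
  have "Ker M M (\<lambda>x. x) = M" using Suc.prems(2) by (simp add: a_kernel_def kernel_def)
  then show ?case
    using Suc.IH[OF Suc.prems, of "Suc k"] zero_projective[OF Suc.prems]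
    by (intro resolved_SucI[of M _ M _ _ "\<lambda>x. x"] delooped_projective Suc.prems) (simp_all add: surj_hom_def hom_id)
qed

lemma resolved_biprod:
  assumes "resolved R t k M" "resolved R t k M'" "W \<in> mod_cat R" "biprod R M M' W i1 i2 p1 p2"
  shows "resolved R t k W"
  using assms
proof (induction t arbitrary: k M M' W i1 i2 p1 p2)
  case 0
  then have rm: "right_module R M" "right_module R M'" "right_module R W" "carrier M = {\<zero>\<^bsub>M\<^esub>}" "carrier M' = {\<zero>\<^bsub>M'\<^esub>}"
    by (simp_all add: mod_cat_def)
  interpret W: right_module R W by (rule rm)
  note b = 0(4)
  have "w = \<zero>\<^bsub>W\<^esub>" if w: "w \<in> carrier W" for w
  proof -
    have "p1 w = \<zero>\<^bsub>M\<^esub>" "p2 w = \<zero>\<^bsub>M'\<^esub>" using biprod_closed(3,4)[OF b w] rm(4,5) by simp_all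
    then show ?thesis
      using hom_zero[OF rm(3,1) biprod_hom(3)[OF b]] hom_zero[OF rm(3,2) biprod_hom(4)[OF b]]
      by (intro biprod_ext[OF b w]) simp_all
  qed
  then have "carrier W = {\<zero>\<^bsub>W\<^esub>}" by auto
  then show ?case using 0(3) by simp
next
  case (Suc t)
  note W = Suc.prems(3,4) and M = resolved_mod_cat[OF Suc.prems(1)] resolved_mod_cat[OF Suc.prems(2)]
  obtain X f where X: "X \<in> mod_cat R" "delooped R k t X" "surj_hom R X M f" "resolved R t (Suc k) (Ker X M f)"
    by (rule resolved_SucE[OF Suc.prems(1)])
  obtain X' f' where X': "X' \<in> mod_cat R" "delooped R k t X'" "surj_hom R X' M' f'" "resolved R t (Suc k) (Ker X' M' f')"
    by (rule resolved_SucE[OF Suc.prems(2)])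
  obtain V j1 j2 q1 q2 where V: "V \<in> mod_cat R" "biprod R X X' V j1 j2 q1 q2"
    by (rule biprod_exists[OF X(1) X'(1)])
  note rm = M[THEN mod_catD(1)] W(1)[THEN mod_catD(1)] X(1)[THEN mod_catD(1)] X'(1)[THEN mod_catD(1)] V(1)[THEN mod_catD(1)]
  note f = surj_homD(1)[OF X(3)] surj_homD(1)[OF X'(3)]
  obtain F where F: "F \<in> rmod_hom R V W" "\<forall>v\<in>carrier V. p1 (F v) = f (q1 v)" "\<forall>v\<in>carrier V. p2 (F v) = f' (q2 v)"
    by (rule biprod_map[OF rm(1,2,3) V(2) W(2) f])
  show ?case
  proof (rule resolved_SucI[OF W(1) V(1)])
    show "delooped R k t V" by (rule delooped_biprod[OF X(1) X'(1) V X(2) X'(2)])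
    show "surj_hom R V W F" by (rule biprod_map_surj[OF rm(4,5,6) V(2) W(2) X(3) X'(3) F])
    show "resolved R t (Suc k) (Ker V W F)"
      by (rule Suc.IH[OF X(4) X'(4) ker_mod_cat[OF V(1) W(1) F(1)]
            biprod_map_kernel[OF rm(4,5,1,2,6,3) V(2) W(2) f F]])
  qed
qed

text \<open>From \<open>0 \<rightarrow> ker g \<rightarrow> B \<rightarrow> C \<rightarrow> 0\<close>, a surjection \<open>f\<close> onto \<open>ker g\<close> and a map \<open>q\<close> into \<open>B\<close> with \<open>g q\<close>
  onto, the map \<open>h\<close> on \<open>A \<oplus> P\<close> is onto \<open>B\<close>; the projection to \<open>P\<close> exhibits its kernel as an
  extension of the kernel of \<open>g q\<close> by a copy of the kernel of \<open>f\<close>.\<close>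

lemma rotation:
  assumes m: "B \<in> mod_cat R" "C \<in> mod_cat R" "A \<in> mod_cat R" "P \<in> mod_cat R" "W \<in> mod_cat R"
    and g: "g \<in> rmod_hom R B C" and f: "surj_hom R A (Ker B C g) f"
    and q: "q \<in> rmod_hom R P B" "surj_hom R P C (\<lambda>x. g (q x))"
    and W: "biprod R A P W i1 i2 p1 p2"
  defines "h \<equiv> \<lambda>w. f (p1 w) \<oplus>\<^bsub>B\<^esub> q (p2 w)"
  shows "surj_hom R W B h"
    and "surj_hom R (Ker W B h) (Ker P C (\<lambda>x. g (q x))) p2"
    and "surj_hom R (Ker A (Ker B C g) f) (Ker (Ker W B h) (Ker P C (\<lambda>x. g (q x))) p2) i1"
    and "\<forall>x\<in>carrier (Ker A (Ker B C g) f). i1 x = \<zero>\<^bsub>W\<^esub> \<longrightarrow> x = \<zero>\<^bsub>A\<^esub>"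
proof -
  note rm = m[THEN mod_catD(1)]
  interpret B: right_module R B by (rule rm)
  interpret C: right_module R C by (rule rm)
  interpret W: right_module R W by (rule rm)
  note K = submodule_subset[OF kernel_submodule[OF rm(1,2) g]]
  note fB = hom_widen_cod[OF surj_homD(1)[OF f] K]
  note b = biprod_hom[OF W] and c = biprod_closed[OF W] and e = biprod_eq[OF W]
    and pa = biprod_p_add[OF rm(3,4) W]
  note cl = hom_closed[OF fB] hom_closed[OF q(1)] hom_closed[OF g]
  have gf: "g (f a) = \<zero>\<^bsub>C\<^esub>" if "a \<in> carrier A" for a
    using hom_closed[OF surj_homD(1)[OF f] that] by (simp add: mem_kernel)
  have h: "h \<in> rmod_hom R W B"
    unfolding h_def by (intro hom_plus[OF rm(1)] hom_comp[OF b(3) fB] hom_comp[OF b(4) q(1)])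
  have hi: "h (i1 a \<oplus>\<^bsub>W\<^esub> i2 x) = f a \<oplus>\<^bsub>B\<^esub> q x" if "a \<in> carrier A" "x \<in> carrier P" for a x
    using pa[OF that] by (simp add: h_def)
  have z: "f \<zero>\<^bsub>A\<^esub> = \<zero>\<^bsub>B\<^esub>" "q \<zero>\<^bsub>P\<^esub> = \<zero>\<^bsub>B\<^esub>" "i2 \<zero>\<^bsub>P\<^esub> = \<zero>\<^bsub>W\<^esub>" "p1 \<zero>\<^bsub>W\<^esub> = \<zero>\<^bsub>A\<^esub>" "p2 \<zero>\<^bsub>W\<^esub> = \<zero>\<^bsub>P\<^esub>" "g \<zero>\<^bsub>B\<^esub> = \<zero>\<^bsub>C\<^esub>"
    by (rule hom_zero[OF rm(3,1) fB] hom_zero[OF rm(4,1) q(1)] hom_zero[OF rm(4,5) b(2)]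
        hom_zero[OF rm(5,3) b(3)] hom_zero[OF rm(5,4) b(4)] hom_zero[OF rm(1,2) g])+
  have lift: "\<exists>a\<in>carrier A. f a = y" if y: "y \<in> carrier B" "g y = \<zero>\<^bsub>C\<^esub>" for y
  proof -
    have "y \<in> carrier (Ker B C g)" using y by (simp add: mem_kernel)
    then obtain a where "a \<in> carrier A" "f a = y" by (rule surj_homE[OF f])
    then show ?thesis by blast
  qed
  show sh: "surj_hom R W B h"
  proof (rule surj_homI[OF h])
    fix y assume y: "y \<in> carrier B"
    obtain x where x: "x \<in> carrier P" "g (q x) = g y" by (rule surj_homE[OF q(2) cl(3)[OF y]])
    have "g (y \<oplus>\<^bsub>B\<^esub> \<ominus>\<^bsub>B\<^esub> q x) = \<zero>\<^bsub>C\<^esub>"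
      using x y cl by (simp add: hom_add[OF g] hom_neg[OF rm(1,2) g] C.M.r_neg)
    then obtain a where a: "a \<in> carrier A" "f a = y \<oplus>\<^bsub>B\<^esub> \<ominus>\<^bsub>B\<^esub> q x"
      using lift[of "y \<oplus>\<^bsub>B\<^esub> \<ominus>\<^bsub>B\<^esub> q x"] x y cl(2) by auto
    have "h (i1 a \<oplus>\<^bsub>W\<^esub> i2 x) = y" using a x y cl by (simp add: hi B.M.a_assoc B.M.l_neg)
    then show "\<exists>w\<in>carrier W. h w = y" using a(1) x(1) c by (intro bexI[of _ "i1 a \<oplus>\<^bsub>W\<^esub> i2 x"]) simp_all
  qed
  let ?K = "Ker W B h" and ?L = "Ker P C (\<lambda>x. g (q x))"
  have p2: "p2 \<in> rmod_hom R ?K ?L"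
  proof (intro hom_restrict[OF b(4)])
    show "a_kernel W B h \<subseteq> carrier W" by (auto simp: mem_kernel)
    show "p2 ` a_kernel W B h \<subseteq> a_kernel P C (\<lambda>x. g (q x))"
    proof
      fix y assume "y \<in> p2 ` a_kernel W B h"
      then obtain w where w: "w \<in> carrier W" "h w = \<zero>\<^bsub>B\<^esub>" "y = p2 w" by (auto simp: mem_kernel)
      have "g (h w) = g (q (p2 w))" using w(1) c cl by (simp add: h_def hom_add[OF g] gf)
      then show "y \<in> a_kernel P C (\<lambda>x. g (q x))" using w c z by (simp add: mem_kernel)
    qed
  qed
  show "surj_hom R ?K ?L p2"
  proof (rule surj_homI[OF p2])
    fix x assume "x \<in> carrier ?L"
    then have x: "x \<in> carrier P" "g (q x) = \<zero>\<^bsub>C\<^esub>" by (simp_all add: mem_kernel)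
    have "g (\<ominus>\<^bsub>B\<^esub> q x) = \<zero>\<^bsub>C\<^esub>" using x cl by (simp add: hom_neg[OF rm(1,2) g])
    then obtain a where a: "a \<in> carrier A" "f a = \<ominus>\<^bsub>B\<^esub> q x"
      using lift[of "\<ominus>\<^bsub>B\<^esub> q x"] x cl(2) by auto
    have "h (i1 a \<oplus>\<^bsub>W\<^esub> i2 x) = \<zero>\<^bsub>B\<^esub>" using a x cl by (simp add: hi B.M.l_neg)
    then show "\<exists>w\<in>carrier ?K. p2 w = x" using pa[OF a(1) x(1)] a(1) x(1) c
      by (intro bexI[of _ "i1 a \<oplus>\<^bsub>W\<^esub> i2 x"]) (simp_all add: mem_kernel)
  qed
  show "surj_hom R (Ker A (Ker B C g) f) (Ker ?K ?L p2) i1"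
  proof (rule surj_homI)
    show "i1 \<in> rmod_hom R (Ker A (Ker B C g) f) (Ker ?K ?L p2)"
    proof -
      have "i1 \<in> rmod_hom R (A\<lparr>carrier := a_kernel A (Ker B C g) f\<rparr>) (W\<lparr>carrier := a_kernel ?K ?L p2\<rparr>)"
        by (intro hom_restrict[OF b(1)]) (auto simp: mem_kernel h_def c e z)
      then show ?thesis by simp
    qed
    fix w assume "w \<in> carrier (Ker ?K ?L p2)"
    then have w: "w \<in> carrier W" "h w = \<zero>\<^bsub>B\<^esub>" "p2 w = \<zero>\<^bsub>P\<^esub>" by (simp_all add: mem_kernel)
    then have "f (p1 w) = \<zero>\<^bsub>B\<^esub>" "i1 (p1 w) = w" using c cl z e(5)[OF w(1)] by (simp_all add: h_def)
    then show "\<exists>x\<in>carrier (Ker A (Ker B C g) f). i1 x = w"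
      using c w(1) by (intro bexI[of _ "p1 w"]) (simp_all add: mem_kernel)
  qed
  show "\<forall>x\<in>carrier (Ker A (Ker B C g) f). i1 x = \<zero>\<^bsub>W\<^esub> \<longrightarrow> x = \<zero>\<^bsub>A\<^esub>"
  proof (intro ballI impI)
    fix x assume x: "x \<in> carrier (Ker A (Ker B C g) f)" "i1 x = \<zero>\<^bsub>W\<^esub>"
    then have "x \<in> carrier A" by (simp add: mem_kernel)
    from e(1)[OF this] show "x = \<zero>\<^bsub>A\<^esub>" using x(2) z(4) by simp
  qed
qed

lemma injective_of_kernel:
  assumes "A \<in> mod_cat R" "B \<in> mod_cat R" "f \<in> rmod_hom R A B" "\<forall>x\<in>carrier A. f x = \<zero>\<^bsub>B\<^esub> \<longrightarrow> x = \<zero>\<^bsub>A\<^esub>"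
  shows "inj_on f (carrier A)"
proof (rule inj_onI)
  note rm = assms(1,2)[THEN mod_catD(1)] and f = assms(3)
  interpret A: right_module R A by (rule rm)
  interpret B: right_module R B by (rule rm)
  fix x y assume xy: "x \<in> carrier A" "y \<in> carrier A" "f x = f y"
  have "f (x \<oplus>\<^bsub>A\<^esub> \<ominus>\<^bsub>A\<^esub> y) = \<zero>\<^bsub>B\<^esub>"
    using xy hom_closed[OF f] by (simp add: hom_add[OF f] hom_neg[OF rm f] B.M.r_neg)
  then have "x \<oplus>\<^bsub>A\<^esub> \<ominus>\<^bsub>A\<^esub> y = \<zero>\<^bsub>A\<^esub>" using assms(4) xy by simp
  then have "(x \<oplus>\<^bsub>A\<^esub> \<ominus>\<^bsub>A\<^esub> y) \<oplus>\<^bsub>A\<^esub> y = y" using xy by simp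
  then show "x = y" using xy by (simp add: A.M.a_assoc A.M.l_neg)
qed

lemma inverse_iso:
  assumes "A \<in> mod_cat R" "B \<in> mod_cat R" "surj_hom R A B f" "\<forall>x\<in>carrier A. f x = \<zero>\<^bsub>B\<^esub> \<longrightarrow> x = \<zero>\<^bsub>A\<^esub>"
  obtains g where "surj_hom R B A g" "\<forall>y\<in>carrier B. g y = \<zero>\<^bsub>A\<^esub> \<longrightarrow> y = \<zero>\<^bsub>B\<^esub>"
proof -
  note rm = assms(1,2)[THEN mod_catD(1)] and f = surj_homD[OF assms(3)]
  have "inj_on f (carrier A)" by (rule injective_of_kernel[OF assms(1,2) f(1) assms(4)])
  then have bij: "bij_betw f (carrier A) (carrier B)" using f(2) by (simp add: bij_betw_def)
  let ?g = "inv_into (carrier A) f"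
  have "surj_hom R B A ?g"
    using hom_inv[OF f(1) rm(1) bij] bij_betw_inv_into[OF bij] by (simp add: surj_hom_def bij_betw_def)
  moreover have "\<forall>y\<in>carrier B. ?g y = \<zero>\<^bsub>A\<^esub> \<longrightarrow> y = \<zero>\<^bsub>B\<^esub>"
    using f_inv_into_f[of _ f "carrier A"] f(2) hom_zero[OF rm f(1)] by force
  ultimately show ?thesis by (rule that)
qed

lemma resolved_iso_sym:
  assumes "resolved R t k N" "surj_hom R M N g" "\<forall>x\<in>carrier M. g x = \<zero>\<^bsub>N\<^esub> \<longrightarrow> x = \<zero>\<^bsub>M\<^esub>" "M \<in> mod_cat R"
  shows "resolved R t k M"
proof -
  obtain g' where "surj_hom R N M g'" "\<forall>y\<in>carrier N. g' y = \<zero>\<^bsub>M\<^esub> \<longrightarrow> y = \<zero>\<^bsub>N\<^esub>"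
    by (rule inverse_iso[OF assms(4) resolved_mod_cat[OF assms(1)] assms(2,3)])
  then show ?thesis by (rule resolved_iso[OF assms(1) _ _ assms(4)])
qed

text \<open>Let \<open>f\<close> map the deloopable module \<open>X\<close> onto \<open>C\<close> with kernel \<open>K\<close>, and cover \<open>X\<close> by \<open>P\<close>.  The
  kernel \<open>B\<close> of \<open>P \<rightarrow> C\<close> is an extension of \<open>K\<close> by the syzygy \<open>A\<close> of \<open>X\<close>.  Rotating it along a cover
  \<open>Q\<close> of \<open>K\<close> maps \<open>A \<oplus> Q\<close> onto \<open>B\<close> with kernel isomorphic to the syzygy of \<open>K\<close>, to which the
  induction hypothesis applies.\<close>

lemma resolved_cover:
  assumes "resolved R t k C"
  shows "\<exists>P p. cover R P C p \<and> resolved R t (Suc k) (Ker P C p)"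
  using assms
proof (induction t arbitrary: k C)
  case 0
  then have C: "C \<in> mod_cat R" "carrier C = {\<zero>\<^bsub>C\<^esub>}" by simp_all
  have "Ker C C (\<lambda>x. x) = C" using C(2) by (simp add: a_kernel_def kernel_def)
  moreover have "cover R C C (\<lambda>x. x)"
    by (intro coverI zero_projective C) (simp add: surj_hom_def hom_id)
  ultimately show ?case using C by (intro exI[of _ C] exI[of _ "\<lambda>x. x"]) simp
next
  case (Suc t)
  note C = resolved_mod_cat[OF Suc.prems]
  obtain X f where X: "X \<in> mod_cat R" "delooped R k t X" "surj_hom R X C f" "resolved R t (Suc k) (Ker X C f)"
    by (rule resolved_SucE[OF Suc.prems])
  obtain P p where P: "cover R P X p" "delooped R (Suc k) t (Ker P X p)" by (rule delooped_cover[OF X(1,2)])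
  note Pm = coverD[OF P(1)] and f = surj_homD[OF X(3)]
  note p = surj_homD[OF Pm(2)]
  let ?fp = "\<lambda>x. f (p x)"
  have fp: "surj_hom R P C ?fp"
    using hom_comp[OF p(1) f(1)] p(2) f(2) unfolding surj_hom_def by (metis image_image)
  define B where "B = Ker P C ?fp"
  define K where "K = Ker X C f"
  have Bm: "B \<in> mod_cat R" unfolding B_def by (rule ker_mod_cat[OF Pm(3) C surj_homD(1)[OF fp]])
  have Km: "K \<in> mod_cat R" using resolved_mod_cat[OF X(4)] by (simp add: K_def)
  have f0: "f \<zero>\<^bsub>X\<^esub> = \<zero>\<^bsub>C\<^esub>" by (rule hom_zero[OF mod_catD(1)[OF X(1)] mod_catD(1)[OF C] f(1)])
  have pB: "surj_hom R B K p"
  proof (rule surj_homI)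
    show "p \<in> rmod_hom R B K"
      unfolding B_def K_def using hom_closed[OF p(1)] by (intro hom_restrict[OF p(1)]) (auto simp: mem_kernel)
    fix y assume "y \<in> carrier K"
    then have y: "y \<in> carrier X" "f y = \<zero>\<^bsub>C\<^esub>" by (simp_all add: K_def mem_kernel)
    obtain x where "x \<in> carrier P" "p x = y" by (rule surj_homE[OF Pm(2) y(1)])
    then show "\<exists>x\<in>carrier B. p x = y" using y(2) by (intro bexI[of _ x]) (simp_all add: B_def mem_kernel)
  qed
  have "a_kernel B K p = a_kernel P X p" by (auto simp: B_def K_def mem_kernel f0)
  then have KerB: "Ker B K p = Ker P X p" by (simp add: B_def)
  define A where "A = Ker P X p"
  have Am: "A \<in> mod_cat R" unfolding A_def by (rule ker_mod_cat[OF Pm(3) X(1) p(1)])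
  obtain Q q where Q: "cover R Q K q" "resolved R t (Suc (Suc k)) (Ker Q K q)"
    using Suc.IH[OF X(4)] unfolding K_def[symmetric] by (elim exE conjE)
  note Qm = coverD[OF Q(1)]
  obtain q' where q': "q' \<in> rmod_hom R Q B" "\<forall>x\<in>carrier Q. p (q' x) = q x"
    by (rule projective_lift[OF Qm(1) Bm Km surj_homD[OF pB] surj_homD(1)[OF Qm(2)]])
  have pq': "surj_hom R Q K (\<lambda>x. p (q' x))"
    unfolding surj_hom_def using hom_comp[OF q'(1) surj_homD(1)[OF pB]] surj_homD(2)[OF Qm(2)] q'(2) by simp
  have KerQ: "Ker Q K (\<lambda>x. p (q' x)) = Ker Q K q"
    using q'(2) by (auto simp: mem_kernel set_eq_iff intro!: arg_cong[where f="\<lambda>H. Q\<lparr>carrier := H\<rparr>"])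
  obtain W i1 i2 p1 p2 where W: "W \<in> mod_cat R" "biprod R A Q W i1 i2 p1 p2"
    by (rule biprod_exists[OF Am Qm(3)])
  have idA: "surj_hom R A (Ker B K p) (\<lambda>x. x)" unfolding KerB A_def surj_hom_def by (simp add: hom_id)
  note rot = rotation[OF Bm Km Am Qm(3) W(1) surj_homD(1)[OF pB] idA q'(1) pq' W(2)]
  let ?h = "\<lambda>w. p1 w \<oplus>\<^bsub>B\<^esub> q' (p2 w)"
  have Wm: "Ker W B ?h \<in> mod_cat R" by (rule ker_mod_cat[OF W(1) Bm surj_homD(1)[OF rot(1)]])
  have inj: "\<forall>w\<in>carrier (Ker W B ?h). p2 w = \<zero>\<^bsub>Ker Q K q\<^esub> \<longrightarrow> w = \<zero>\<^bsub>Ker W B ?h\<^esub>"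
  proof (intro ballI impI)
    fix w assume w: "w \<in> carrier (Ker W B ?h)" "p2 w = \<zero>\<^bsub>Ker Q K q\<^esub>"
    then have "w \<in> carrier (Ker (Ker W B ?h) (Ker Q K (\<lambda>x. p (q' x))) p2)" by (simp add: mem_kernel)
    then obtain a where a: "a \<in> carrier (Ker A (Ker B K p) (\<lambda>x. x))" "i1 a = w" by (rule surj_homE[OF rot(3)])
    then have "a = \<zero>\<^bsub>A\<^esub>" by (simp add: mem_kernel A_def B_def)
    then show "w = \<zero>\<^bsub>Ker W B ?h\<^esub>"
      using a(2) hom_zero[OF mod_catD(1)[OF Am] mod_catD(1)[OF W(1)] biprod_hom(1)[OF W(2)]] by simp
  qed
  have "resolved R t (Suc (Suc k)) (Ker W B ?h)"
    by (rule resolved_iso_sym[OF Q(2) rot(2)[unfolded KerQ] inj Wm])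
  moreover have "delooped R (Suc k) t W"
    by (rule delooped_biprod[OF Am Qm(3) W P(2)[folded A_def] delooped_projective[OF Qm(1)]])
  ultimately have "resolved R (Suc t) (Suc k) B" by (intro resolved_SucI[OF Bm W(1) _ rot(1)])
  then show ?case
    unfolding B_def by (intro exI[of _ P] exI[of _ ?fp] conjI coverI Pm(1) fp)
qed

text \<open>Induction on the resolution of the submodule.  The module \<open>X\<close> that starts this resolution and a
  cover \<open>P\<close> of \<open>C\<close> are combined by rotation: \<open>X \<oplus> P\<close> maps onto \<open>B\<close>, and the kernel is again an
  extension, of the syzygy of \<open>C\<close> by the next kernel in the resolution.\<close>

theorem resolved_extension:
  assumes "resolved R s k (Ker B C g)" "resolved R t k C" "surj_hom R B C g" "B \<in> mod_cat R"
  shows "resolved R (s + t) k B"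
  using assms
proof (induction s arbitrary: k B C g)
  case 0
  have "carrier (Ker B C g) = {\<zero>\<^bsub>B\<^esub>}" using 0(1) by simp
  then have "\<forall>x\<in>carrier B. g x = \<zero>\<^bsub>C\<^esub> \<longrightarrow> x = \<zero>\<^bsub>B\<^esub>" by (auto simp: mem_kernel set_eq_iff)
  then show ?case using resolved_iso_sym[OF 0(2,3) _ 0(4)] by simp
next
  case (Suc s)
  note B = Suc.prems(4) and C = resolved_mod_cat[OF Suc.prems(2)] and g = surj_homD[OF Suc.prems(3)]
  obtain X f where X: "X \<in> mod_cat R" "delooped R k s X" "surj_hom R X (Ker B C g) f"
      "resolved R s (Suc k) (Ker X (Ker B C g) f)"
    by (rule resolved_SucE[OF Suc.prems(1)])
  obtain P p where P: "cover R P C p" "resolved R t (Suc k) (Ker P C p)"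
    using resolved_cover[OF Suc.prems(2)] by (elim exE conjE)
  note Pm = coverD[OF P(1)]
  obtain q where q: "q \<in> rmod_hom R P B" "\<forall>x\<in>carrier P. g (q x) = p x"
    by (rule projective_lift[OF Pm(1) B C g surj_homD(1)[OF Pm(2)]])
  have gq: "surj_hom R P C (\<lambda>x. g (q x))"
    unfolding surj_hom_def using hom_comp[OF q(1) g(1)] surj_homD(2)[OF Pm(2)] q(2) by simp
  have KerP: "Ker P C (\<lambda>x. g (q x)) = Ker P C p"
    using q(2) by (auto simp: mem_kernel set_eq_iff intro!: arg_cong[where f="\<lambda>H. P\<lparr>carrier := H\<rparr>"])
  obtain W i1 i2 p1 p2 where W: "W \<in> mod_cat R" "biprod R X P W i1 i2 p1 p2"
    by (rule biprod_exists[OF X(1) Pm(3)])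
  note rot = rotation[OF B C X(1) Pm(3) W(1) g(1) X(3) q(1) gq W(2)]
  let ?h = "\<lambda>w. f (p1 w) \<oplus>\<^bsub>B\<^esub> q (p2 w)"
  have Wm: "Ker W B ?h \<in> mod_cat R" by (rule ker_mod_cat[OF W(1) B surj_homD(1)[OF rot(1)]])
  have KPm: "Ker P C (\<lambda>x. g (q x)) \<in> mod_cat R" by (rule ker_mod_cat[OF Pm(3) C surj_homD(1)[OF gq]])
  have "resolved R s (Suc k) (Ker (Ker W B ?h) (Ker P C (\<lambda>x. g (q x))) p2)"
    using rot(4) by (intro resolved_iso[OF X(4) rot(3)] ker_mod_cat[OF Wm KPm surj_homD(1)[OF rot(2)]]) simp
  then have "resolved R (s + t) (Suc k) (Ker W B ?h)"
    by (rule Suc.IH[OF _ P(2)[folded KerP] rot(2) Wm])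
  moreover have "delooped R k (s + t) W"
    by (rule delooped_biprod[OF X(1) Pm(3) W delooped_mono[OF X(1,2)] delooped_projective[OF Pm(1)]]) simp
  ultimately show ?case unfolding add_Suc by (intro resolved_SucI[OF B W(1) _ rot(1)])
qed

end

section \<open>Derived delooping level as a resolution property\<close>

lemma Inf_enat_le_iff: "Inf {enat n | n. P n} \<le> enat m \<longleftrightarrow> (\<exists>n\<le>m. P n)"
proof
  assume le: "Inf {enat n | n. P n} \<le> enat m"
  show "\<exists>n\<le>m. P n"
  proof (rule ccontr)
    assume "\<not> (\<exists>n\<le>m. P n)"
    then have "Suc m \<le> n" if "P n" for n using that by (meson not_less_eq_eq)
    then have "enat (Suc m) \<le> Inf {enat n | n. P n}" by (intro Inf_greatest) auto
    then have "enat (Suc m) \<le> enat m" using le by (rule order_trans)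
    then show False by simp
  qed
next
  assume "\<exists>n\<le>m. P n"
  then obtain n where "n \<le> m" "P n" by blast
  then show "Inf {enat n | n. P n} \<le> enat m" by (intro Inf_lower2[of "enat n"]) auto
qed

lemma exact_seq_onto_0:
  "exact_seq_onto R 0 C M \<longleftrightarrow> C 0 \<in> mod_cat R \<and> (\<exists>f. surj_hom R (C 0) M f \<and> inj_on f (carrier (C 0)))"
proof
  assume "exact_seq_onto R 0 C M"
  then show "C 0 \<in> mod_cat R \<and> (\<exists>f. surj_hom R (C 0) M f \<and> inj_on f (carrier (C 0)))"
    unfolding exact_seq_onto_def Let_def surj_hom_def by auto
next
  assume "C 0 \<in> mod_cat R \<and> (\<exists>f. surj_hom R (C 0) M f \<and> inj_on f (carrier (C 0)))"
  then obtain f where "C 0 \<in> mod_cat R" "surj_hom R (C 0) M f" "inj_on f (carrier (C 0))"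
    by (elim exE conjE)
  then show "exact_seq_onto R 0 C M"
    unfolding exact_seq_onto_def Let_def surj_hom_def by (intro conjI exI[of _ "\<lambda>_. f"]) simp_all
qed

lemma kernel_restrict_cod: "a_kernel A (B\<lparr>carrier := K\<rparr>) f = a_kernel A B f"
  by (simp add: a_kernel_def kernel_def)

text \<open>The tail of an exact sequence ending in \<open>M\<close> ends in the kernel of the map onto \<open>M\<close>.\<close>

lemma exact_seq_onto_SucD:
  assumes "exact_seq_onto R (Suc n) C M"
  shows "\<exists>f. C 0 \<in> mod_cat R \<and> surj_hom R (C 0) M f \<and> exact_seq_onto R n (\<lambda>i. C (Suc i)) (Ker (C 0) M f)"
proof -
  let ?E = "case_nat M C"
  obtain d where C: "\<forall>i\<le>Suc n. C i \<in> mod_cat R" and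
    d: "\<forall>i\<le>Suc n. d i \<in> rmod_hom R (?E (Suc i)) (?E i)"
      "d 0 ` carrier (?E 1) = carrier (?E 0)"
      "\<forall>i<Suc n. d (Suc i) ` carrier (?E (Suc (Suc i))) = a_kernel (?E (Suc i)) (?E i) (d i)"
      "inj_on (d (Suc n)) (carrier (?E (Suc (Suc n))))"
    using assms unfolding exact_seq_onto_def Let_def by (elim exE conjE)
  let ?K = "Ker (C 0) M (d 0)"
  let ?E' = "case_nat ?K (\<lambda>i. C (Suc i))"
  let ?d = "\<lambda>i. d (Suc i)"
  have im0: "d (Suc 0) ` carrier (C (Suc 0)) = a_kernel (C 0) M (d 0)" using d(3)[rule_format, of 0] by simp
  have hom: "?d i \<in> rmod_hom R (?E' (Suc i)) (?E' i)" if "i \<le> n" for i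
  proof (cases i)
    case 0
    have "d (Suc 0) \<in> rmod_hom R (C (Suc 0)) (C 0)" using d(1)[rule_format, of "Suc 0"] by simp
    then show ?thesis using 0 im0 by (auto intro: hom_restrict_cod)
  next
    case (Suc j) then show ?thesis using d(1)[rule_format, of "Suc i"] that by simp
  qed
  have ex: "?d (Suc i) ` carrier (?E' (Suc (Suc i))) = a_kernel (?E' (Suc i)) (?E' i) (?d i)" if "i < n" for i
    using d(3)[rule_format, of "Suc i"] that by (cases i) (simp_all add: kernel_restrict_cod)
  have "exact_seq_onto R n (\<lambda>i. C (Suc i)) ?K"
    unfolding exact_seq_onto_def Let_def using C d(4) im0 hom ex
    by (intro conjI exI[of _ ?d]) simp_all
  moreover have "surj_hom R (C 0) M (d 0)" using d(1)[rule_format, of 0] d(2) by (simp add: surj_hom_def)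
  ultimately show ?thesis using C by (intro exI[of _ "d 0"]) simp
qed

lemma exact_seq_onto_SucI:
  assumes C0: "C 0 \<in> mod_cat R" and f: "surj_hom R (C 0) M f"
    and ex: "exact_seq_onto R n (\<lambda>i. C (Suc i)) (Ker (C 0) M f)"
  shows "exact_seq_onto R (Suc n) C M"
proof -
  let ?E' = "case_nat (Ker (C 0) M f) (\<lambda>i. C (Suc i))"
  obtain d where C: "\<forall>i\<le>n. C (Suc i) \<in> mod_cat R" and
    d: "\<forall>i\<le>n. d i \<in> rmod_hom R (?E' (Suc i)) (?E' i)"
      "d 0 ` carrier (?E' 1) = carrier (?E' 0)"
      "\<forall>i<n. d (Suc i) ` carrier (?E' (Suc (Suc i))) = a_kernel (?E' (Suc i)) (?E' i) (d i)"
      "inj_on (d n) (carrier (?E' (Suc n)))"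
    using ex unfolding exact_seq_onto_def Let_def by (elim exE conjE)
  let ?E = "case_nat M C"
  let ?d = "case_nat f d"
  have hom: "?d i \<in> rmod_hom R (?E (Suc i)) (?E i)" if "i \<le> Suc n" for i
  proof (cases i)
    case 0 then show ?thesis using f by (simp add: surj_hom_def)
  next
    case (Suc j)
    then have "d j \<in> rmod_hom R (?E' (Suc j)) (?E' j)" using d(1) that by simp
    moreover have "a_kernel (C 0) M f \<subseteq> carrier (C 0)" by (auto simp: mem_kernel)
    ultimately show ?thesis using Suc by (cases j) (auto intro: hom_widen_cod)
  qed
  have exact: "?d (Suc i) ` carrier (?E (Suc (Suc i))) = a_kernel (?E (Suc i)) (?E i) (?d i)" if "i < Suc n" for i
  proof (cases i)
    case 0 then show ?thesis using d(2) by simp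
  next
    case (Suc j)
    then show ?thesis using d(3)[rule_format, of j] that by (cases j) (simp_all add: kernel_restrict_cod)
  qed
  have C': "C i \<in> mod_cat R" if "i \<le> Suc n" for i using C0 C that by (cases i) simp_all
  show ?thesis
    unfolding exact_seq_onto_def Let_def using C' hom exact d(4) f
    by (intro conjI exI[of _ ?d]) (simp_all add: surj_hom_def)
qed

context noetherian_modules
begin

lemma dell_le_iff:
  assumes "M \<in> mod_cat R" shows "dell R k M \<le> enat n \<longleftrightarrow> delooped R k n M"
proof -
  have "dell R k M \<le> enat n \<longleftrightarrow> (\<exists>n'\<le>n. delooped R k n' M)"
    unfolding dell_def delooped_def by (rule Inf_enat_le_iff)
  then show ?thesis using delooped_mono[OF assms] by blast
qed

lemma resolved_of_exact_seq:
  assumes "exact_seq_onto R n C M" "\<forall>i\<le>n. delooped R (i + k) (m - i) (C i)" "n \<le> m" "M \<in> mod_cat R"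
  shows "resolved R (Suc m) k M"
  using assms
proof (induction n arbitrary: C M k m)
  case 0
  obtain f where f: "C 0 \<in> mod_cat R" "surj_hom R (C 0) M f" "inj_on f (carrier (C 0))"
    using 0(1) unfolding exact_seq_onto_0 by (elim exE conjE)
  note rm = f(1)[THEN mod_catD(1)] 0(4)[THEN mod_catD(1)]
  note K = ker_mod_cat[OF f(1) 0(4) surj_homD(1)[OF f(2)]]
  interpret C0: right_module R "C 0" by (rule rm)
  have z: "f \<zero>\<^bsub>C 0\<^esub> = \<zero>\<^bsub>M\<^esub>" by (rule hom_zero[OF rm surj_homD(1)[OF f(2)]])
  have "x = \<zero>\<^bsub>C 0\<^esub>" if "x \<in> carrier (C 0)" "f x = \<zero>\<^bsub>M\<^esub>" for x
    by (rule inj_onD[OF f(3)]) (simp_all add: that z)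
  then have "a_kernel (C 0) M f = {\<zero>\<^bsub>C 0\<^esub>}" 
  proof -
    assume k: "\<And>x. x \<in> carrier (C 0) \<Longrightarrow> f x = \<zero>\<^bsub>M\<^esub> \<Longrightarrow> x = \<zero>\<^bsub>C 0\<^esub>"
    show ?thesis
    proof (intro equalityI subsetI)
      fix x assume "x \<in> a_kernel (C 0) M f"
      then show "x \<in> {\<zero>\<^bsub>C 0\<^esub>}" using k by (simp add: mem_kernel)
    qed (simp add: mem_kernel z)
  qed
  then show ?case
    using 0(2) by (intro resolved_SucI[OF 0(4) f(1) _ f(2)] resolved_zero[OF K]) simp_all
next
  case (Suc n)
  obtain f where f: "C 0 \<in> mod_cat R" "surj_hom R (C 0) M f" "exact_seq_onto R n (\<lambda>i. C (Suc i)) (Ker (C 0) M f)"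
    using exact_seq_onto_SucD[OF Suc.prems(1)] by (elim exE conjE)
  obtain m' where m: "m = Suc m'" "n \<le> m'" using Suc.prems(3) by (cases m) simp_all
  note K = ker_mod_cat[OF f(1) Suc.prems(4) surj_homD(1)[OF f(2)]]
  have "\<forall>i\<le>n. delooped R (i + Suc k) (m' - i) (C (Suc i))"
  proof (intro allI impI)
    fix i assume "i \<le> n"
    then show "delooped R (i + Suc k) (m' - i) (C (Suc i))" using Suc.prems(2)[rule_format, of "Suc i"] m(1) by simp
  qed
  then have "resolved R m (Suc k) (Ker (C 0) M f)" unfolding m(1) by (rule Suc.IH[OF f(3) _ m(2) K])
  then show ?case using Suc.prems(2)[rule_format, of 0] by (intro resolved_SucI[OF Suc.prems(4) f(1) _ f(2)]) simp_all
qed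

lemma exact_seq_of_resolved:
  assumes "resolved R (Suc m) k M"
  shows "\<exists>n\<le>m. \<exists>C. exact_seq_onto R n C M \<and> (\<forall>i\<le>n. delooped R (i + k) (m - i) (C i))"
  using assms
proof (induction m arbitrary: k M)
  case 0
  obtain X f where X: "X \<in> mod_cat R" "delooped R k 0 X" "surj_hom R X M f" "resolved R 0 (Suc k) (Ker X M f)"
    by (rule resolved_SucE[OF 0])
  note M = resolved_mod_cat[OF 0]
  have ker: "\<forall>x\<in>carrier X. f x = \<zero>\<^bsub>M\<^esub> \<longrightarrow> x = \<zero>\<^bsub>X\<^esub>"
  proof (intro ballI impI)
    fix x assume "x \<in> carrier X" "f x = \<zero>\<^bsub>M\<^esub>"
    then have "x \<in> carrier (Ker X M f)" by (simp add: mem_kernel)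
    also have "carrier (Ker X M f) = {\<zero>\<^bsub>X\<^esub>}" using X(4) by simp
    finally show "x = \<zero>\<^bsub>X\<^esub>" by simp
  qed
  have "inj_on f (carrier X)"
    by (rule injective_of_kernel[OF X(1) M surj_homD(1)[OF X(3)] ker])
  then have "exact_seq_onto R 0 (\<lambda>_. X) M" using X(1,3) unfolding exact_seq_onto_0 by (intro conjI exI)
  then show ?case using X(2) by (intro exI[of _ 0] conjI exI[of _ "\<lambda>_. X"]) simp_all
next
  case (Suc m)
  obtain X f where X: "X \<in> mod_cat R" "delooped R k (Suc m) X" "surj_hom R X M f" "resolved R (Suc m) (Suc k) (Ker X M f)"
    by (rule resolved_SucE[OF Suc.prems])
  obtain n C where C: "n \<le> m" "exact_seq_onto R n C (Ker X M f)" "\<forall>i\<le>n. delooped R (i + Suc k) (m - i) (C i)"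
    using Suc.IH[OF X(4)] by (elim exE conjE)
  let ?C = "case_nat X C"
  have "exact_seq_onto R (Suc n) ?C M" using X(1,3) C(2) by (intro exact_seq_onto_SucI) simp_all
  moreover have "delooped R (i + k) (Suc m - i) (?C i)" if "i \<le> Suc n" for i
    using X(2) C(3) that by (cases i) simp_all
  ultimately show ?case using C(1) by (intro exI[of _ "Suc n"] conjI exI[of _ ?C]) simp_all
qed

theorem ddell_le_iff_resolved:
  assumes "M \<in> mod_cat R"
  shows "ddell R k M \<le> enat m \<longleftrightarrow> resolved R (Suc m) k M"
proof
  assume "ddell R k M \<le> enat m"
  then obtain m' n C where *: "m' \<le> m" "n \<le> m'" "exact_seq_onto R n C M" "\<forall>i\<le>n. dell R (i + k) (C i) \<le> enat (m' - i)"
    unfolding ddell_def Inf_enat_le_iff by (elim exE conjE)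
  have "delooped R (i + k) (m - i) (C i)" if "i \<le> n" for i
  proof -
    have C: "C i \<in> mod_cat R" using *(3) that unfolding exact_seq_onto_def by simp
    then have "delooped R (i + k) (m' - i) (C i)" using *(4) that unfolding dell_le_iff[OF C, symmetric] by simp
    then show ?thesis by (rule delooped_mono[OF C]) (simp add: *(1) diff_le_mono)
  qed
  then show "resolved R (Suc m) k M" using *(1,2) by (intro resolved_of_exact_seq[OF *(3) _ _ assms]) simp_all
next
  assume "resolved R (Suc m) k M"
  then obtain n C where *: "n \<le> m" "exact_seq_onto R n C M" "\<forall>i\<le>n. delooped R (i + k) (m - i) (C i)"
    using exact_seq_of_resolved[of m k M] by blast
  have "dell R (i + k) (C i) \<le> enat (m - i)" if "i \<le> n" for i
  proof -
    have C: "C i \<in> mod_cat R" using *(2) that unfolding exact_seq_onto_def by simp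
    then show ?thesis using *(3) that unfolding dell_le_iff[OF C] by simp
  qed
  then show "ddell R k M \<le> enat m" unfolding ddell_def Inf_enat_le_iff using *(1,2) by blast
qed

end

section \<open>The descending chain condition\<close>

definition dcc :: "('r, 'x) ring_scheme \<Rightarrow> ('r, 'm, 'y) module_scheme \<Rightarrow> bool" where
  "dcc R M \<longleftrightarrow> (\<forall>U :: nat \<Rightarrow> 'm set. (\<forall>n. submodule (U n) R M \<and> U (Suc n) \<subseteq> U n) \<longrightarrow>
     (\<exists>n. \<forall>m\<ge>n. U m = U n))"

lemma dccE:
  assumes "dcc R M" "\<And>n. submodule (U n) R M" "\<And>n. U (Suc n) \<subseteq> U n"
  obtains n where "\<forall>m\<ge>n. U m = U n"
proof -
  have "\<exists>n. \<forall>m\<ge>n. U m = U n" using assms(1)[unfolded dcc_def, rule_format, of U] assms(2,3) by simp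
  then show ?thesis using that by (elim exE)
qed

lemma dcc_minimal:
  assumes "dcc R M" "\<U> \<noteq> {}" "\<And>U. U \<in> \<U> \<Longrightarrow> submodule U R M"
  shows "\<exists>U\<in>\<U>. \<forall>V\<in>\<U>. V \<subseteq> U \<longrightarrow> V = U"
proof (rule ccontr)
  assume "\<not> ?thesis"
  then have "\<exists>V\<in>\<U>. V \<subset> U" if "U \<in> \<U>" for U using that by blast
  then have "\<exists>f. \<forall>n::nat. f n \<in> \<U> \<and> f (Suc n) \<subset> f n"
    using assms(2) by (intro dependent_nat_choice) auto
  then obtain f where f: "\<forall>n::nat. f n \<in> \<U> \<and> f (Suc n) \<subset> f n" by (elim exE)
  have sub: "submodule (f n) R M" "f (Suc n) \<subseteq> f n" for n using f assms(3) by auto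
  obtain n where n: "\<forall>m\<ge>n. f m = f n" by (rule dccE[OF assms(1), of f, OF sub])
  have "f (Suc n) = f n" by (rule n[rule_format]) simp
  moreover have "f (Suc n) \<subset> f n" using f by simp
  ultimately show False by simp
qed

lemma dcc_submodule:
  assumes "right_module R M" "dcc R M" "submodule H R M"
  shows "dcc R (M\<lparr>carrier := H\<rparr>)"
  unfolding dcc_def submodule_trans_iff[OF assms(1,3)]
proof (intro allI impI)
  fix U assume "\<forall>n. (submodule (U n) R M \<and> U n \<subseteq> H) \<and> U (Suc n) \<subseteq> U n"
  then have U: "submodule (U n) R M" "U (Suc n) \<subseteq> U n" for n by simp_all
  obtain n where "\<forall>m\<ge>n. U m = U n" by (rule dccE[OF assms(2), of U, OF U])
  then show "\<exists>n. \<forall>m\<ge>n. U m = U n" by (rule exI)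
qed

lemma dcc_image:
  assumes "right_module R M" "right_module R C" "f \<in> rmod_hom R M C" "f ` carrier M = carrier C" "dcc R M"
  shows "dcc R C"
  unfolding dcc_def
proof (intro allI impI)
  fix U assume U: "\<forall>n. submodule (U n) R C \<and> U (Suc n) \<subseteq> U n"
  let ?V = "\<lambda>n. {x \<in> carrier M. f x \<in> U n}"
  have U': "submodule (U n) R C" for n using U by blast
  obtain n where n: "\<forall>m\<ge>n. ?V m = ?V n"
    by (rule dccE[OF assms(5), of ?V]) (use U vimage_submodule[OF assms(1-3) U'] in auto)
  have im: "U m = f ` ?V m" for m using submodule_subset[OF U'[of m]] assms(4) by auto
  have "U m = U n" if "m \<ge> n" for m using n[rule_format, OF that] im[of m] im[of n] by metis
  then show "\<exists>n. \<forall>m\<ge>n. U m = U n" by blast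
qed

definition generated :: "('r, 'x) ring_scheme \<Rightarrow> ('r, 'm, 'y) module_scheme \<Rightarrow> 'm set \<Rightarrow> 'm set" where
  "generated R M A = \<Inter>{H. submodule H R M \<and> A \<subseteq> H}"

lemma
  assumes "right_module R M" "A \<subseteq> carrier M"
  shows generated_submodule: "submodule (generated R M A) R M" and generated_superset: "A \<subseteq> generated R M A"
proof -
  show "submodule (generated R M A) R M"
    unfolding generated_def using assms(2) submodule_carrier[OF assms(1)]
    by (intro submodule_Inter[OF assms(1)]) auto
  show "A \<subseteq> generated R M A" by (auto simp: generated_def)
qed

lemma generated_least: "submodule H R M \<Longrightarrow> A \<subseteq> H \<Longrightarrow> generated R M A \<subseteq> H"
  by (auto simp: generated_def)

lemma generated_mono: "A \<subseteq> B \<Longrightarrow> generated R M A \<subseteq> generated R M B"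
  by (auto simp: generated_def)

lemma generated_empty: "right_module R M \<Longrightarrow> generated R M {} = {\<zero>\<^bsub>M\<^esub>}"
proof (rule equalityI)
  assume M: "right_module R M"
  show "generated R M {} \<subseteq> {\<zero>\<^bsub>M\<^esub>}" by (rule generated_least[OF submodule_singleton_zero[OF M]]) simp
  show "{\<zero>\<^bsub>M\<^esub>} \<subseteq> generated R M {}" using submodule_zero[OF generated_submodule[OF M, of "{}"]] by simp
qed

lemma generates_iff:
  assumes M: "right_module R M" and A: "A \<subseteq> carrier M"
  shows "(\<forall>H. submodule H R M \<and> A \<subseteq> H \<longrightarrow> H = carrier M) \<longleftrightarrow> generated R M A = carrier M"
proof
  assume "\<forall>H. submodule H R M \<and> A \<subseteq> H \<longrightarrow> H = carrier M"
  then show "generated R M A = carrier M" using generated_submodule[OF M A] generated_superset[OF M A] by simp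
next
  assume eq: "generated R M A = carrier M"
  show "\<forall>H. submodule H R M \<and> A \<subseteq> H \<longrightarrow> H = carrier M"
  proof (intro allI impI equalityI)
    fix H assume H: "submodule H R M \<and> A \<subseteq> H"
    then show "H \<subseteq> carrier M" using submodule_subset by (elim conjE)
    show "carrier M \<subseteq> H" unfolding eq[symmetric] using H by (elim conjE) (rule generated_least)
  qed
qed

lemma fin_gen_generated:
  "right_module R M \<Longrightarrow> fin_gen R M \<longleftrightarrow> (\<exists>A\<subseteq>carrier M. finite A \<and> generated R M A = carrier M)"
  unfolding fin_gen_def using generates_iff by (metis (no_types, lifting))

text \<open>The submodule \<open>x R + H\<close>.\<close>

definition cyclic_sum :: "('r, 'x) ring_scheme \<Rightarrow> ('r, 'm, 'y) module_scheme \<Rightarrow> 'm \<Rightarrow> 'm set \<Rightarrow> 'm set" where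
  "cyclic_sum R M x H = {a \<odot>\<^bsub>M\<^esub> x \<oplus>\<^bsub>M\<^esub> h | a h. a \<in> carrier R \<and> h \<in> H}"

lemma
  assumes "right_module R M" "submodule H R M" "x \<in> carrier M"
  shows cyclic_sum_submodule: "submodule (cyclic_sum R M x H) R M"
    and cyclic_sum_mem: "x \<in> cyclic_sum R M x H"
    and cyclic_sum_superset: "H \<subseteq> cyclic_sum R M x H"
proof -
  interpret M: right_module R M by fact
  note H = submodule_zero[OF assms(2)] submodule_add[OF assms(2)] submodule_smult[OF assms(2)]
  have c: "h \<in> H \<Longrightarrow> h \<in> carrier M" for h using submodule_subset[OF assms(2)] by blast
  have I: "a \<in> carrier R \<Longrightarrow> h \<in> H \<Longrightarrow> a \<odot>\<^bsub>M\<^esub> x \<oplus>\<^bsub>M\<^esub> h \<in> cyclic_sum R M x H" for a h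
    by (auto simp: cyclic_sum_def)
  show mem: "x \<in> cyclic_sum R M x H" using I[OF M.R.one_closed H(1)] assms(3) by simp
  show sup: "H \<subseteq> cyclic_sum R M x H"
  proof
    fix h assume "h \<in> H"
    then show "h \<in> cyclic_sum R M x H" using I[OF M.R.zero_closed, of h] assms(3) c by simp
  qed
  show "submodule (cyclic_sum R M x H) R M"
  proof (rule M.submoduleI)
    show "cyclic_sum R M x H \<subseteq> carrier M" using c assms(3) by (auto simp: cyclic_sum_def)
    show "\<zero>\<^bsub>M\<^esub> \<in> cyclic_sum R M x H" using sup H(1) by blast
  next
    fix y z assume "y \<in> cyclic_sum R M x H" "z \<in> cyclic_sum R M x H"
    then obtain a h b k where *: "a \<in> carrier R" "h \<in> H" "y = a \<odot>\<^bsub>M\<^esub> x \<oplus>\<^bsub>M\<^esub> h"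
      "b \<in> carrier R" "k \<in> H" "z = b \<odot>\<^bsub>M\<^esub> x \<oplus>\<^bsub>M\<^esub> k"
      unfolding cyclic_sum_def by blast
    then have "y \<oplus>\<^bsub>M\<^esub> z = (a \<oplus>\<^bsub>R\<^esub> b) \<odot>\<^bsub>M\<^esub> x \<oplus>\<^bsub>M\<^esub> (h \<oplus>\<^bsub>M\<^esub> k)"
      using c assms(3) by (simp add: M.smult_ring_distr M.M.a_ac)
    then show "y \<oplus>\<^bsub>M\<^esub> z \<in> cyclic_sum R M x H" using I * H by simp
  next
    fix b y assume b: "b \<in> carrier R" and "y \<in> cyclic_sum R M x H"
    then obtain a h where *: "a \<in> carrier R" "h \<in> H" "y = a \<odot>\<^bsub>M\<^esub> x \<oplus>\<^bsub>M\<^esub> h"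
      unfolding cyclic_sum_def by blast
    then have "b \<odot>\<^bsub>M\<^esub> y = (a \<otimes>\<^bsub>R\<^esub> b) \<odot>\<^bsub>M\<^esub> x \<oplus>\<^bsub>M\<^esub> b \<odot>\<^bsub>M\<^esub> h"
      using c assms(3) b by (simp add: M.smult_module_distr M.smult_assoc)
    then show "b \<odot>\<^bsub>M\<^esub> y \<in> cyclic_sum R M x H" using I * H b by simp
  qed
qed

lemma generated_insert:
  assumes "right_module R M" "insert x A \<subseteq> carrier M"
  shows "generated R M (insert x A) = cyclic_sum R M x (generated R M A)"
proof
  have A: "A \<subseteq> carrier M" and x: "x \<in> carrier M" using assms(2) by auto
  note S = generated_submodule[OF assms(1) A] and I = generated_submodule[OF assms(1,2)]
  show "generated R M (insert x A) \<subseteq> cyclic_sum R M x (generated R M A)"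
    using cyclic_sum_mem[OF assms(1) S x] cyclic_sum_superset[OF assms(1) S x] generated_superset[OF assms(1) A]
    by (intro generated_least cyclic_sum_submodule[OF assms(1) S x]) blast
  have "x \<in> generated R M (insert x A)" using generated_superset[OF assms(1,2)] by blast
  moreover have "generated R M A \<subseteq> generated R M (insert x A)" by (rule generated_mono) blast
  ultimately show "cyclic_sum R M x (generated R M A) \<subseteq> generated R M (insert x A)"
    using submodule_add[OF I] submodule_smult[OF I] by (auto simp: cyclic_sum_def)
qed

text \<open>Induction on the generators.  A descending chain of submodules is tested on \<open>x R + S\<close>, where \<open>S\<close>
  is generated by the other generators, by two chains: the right ideals \<open>I n\<close> of all \<open>a\<close> for which
  \<open>x a\<close> lies in \<open>U n + S\<close>, and the intersections \<open>U n \<inter> S\<close>.  Both become stationary, and together they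
  determine \<open>U n\<close> inside \<open>x R + S\<close>.\<close>

lemma dcc_fin_gen:
  assumes M: "right_module R M" and "dcc R (regular_module R)" "fin_gen R M"
  shows "dcc R M"
proof -
  interpret M: right_module R M by fact
  let ?F = "regular_module R"
  note F = regular_right_module[OF M.R.ring_axioms]
  have Fs [simp]: "carrier ?F = carrier R" "a \<odot>\<^bsub>?F\<^esub> x = x \<otimes>\<^bsub>R\<^esub> a" "x \<oplus>\<^bsub>?F\<^esub> y = x \<oplus>\<^bsub>R\<^esub> y" "\<zero>\<^bsub>?F\<^esub> = \<zero>\<^bsub>R\<^esub>" for a x y
    by (simp_all add: regular_module_def)
  have stab: "\<exists>n. \<forall>m\<ge>n. U m \<inter> generated R M A = U n \<inter> generated R M A"
    if U: "\<And>n. submodule (U n) R M" "\<And>n. U (Suc n) \<subseteq> U n" and A: "finite A" "A \<subseteq> carrier M" for A U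
    using A
  proof (induction A rule: finite_induct)
    case empty
    show ?case using submodule_zero[OF U(1)] by (simp add: generated_empty[OF M])
  next
    case (insert x A)
    then have A: "A \<subseteq> carrier M" and x: "x \<in> carrier M" by auto
    let ?S = "generated R M A"
    note S = generated_submodule[OF M A]
    have Sc: "h \<in> ?S \<Longrightarrow> h \<in> carrier M" and Uc: "u \<in> U n \<Longrightarrow> u \<in> carrier M" for h u n
      using submodule_subset[OF S] submodule_subset[OF U(1)[of n]] by auto
    have mono: "U m \<subseteq> U n" if "n \<le> m" for n m using U(2) that by (rule lift_Suc_antimono_le)
    define I where "I n = {a \<in> carrier R. \<exists>u\<in>U n. \<exists>h\<in>?S. a \<odot>\<^bsub>M\<^esub> x = u \<oplus>\<^bsub>M\<^esub> h}" for n
    have "submodule (I n) R ?F" for n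
    proof (rule right_module.submoduleI[OF F])
      show "\<zero>\<^bsub>?F\<^esub> \<in> I n"
        using submodule_zero[OF U(1)[of n]] submodule_zero[OF S] x
        by (auto simp: I_def intro!: bexI[of _ "\<zero>\<^bsub>M\<^esub>"])
    next
      fix a b assume "a \<in> I n" "b \<in> I n"
      then obtain u h v k where *: "a \<in> carrier R" "u \<in> U n" "h \<in> ?S" "a \<odot>\<^bsub>M\<^esub> x = u \<oplus>\<^bsub>M\<^esub> h"
        "b \<in> carrier R" "v \<in> U n" "k \<in> ?S" "b \<odot>\<^bsub>M\<^esub> x = v \<oplus>\<^bsub>M\<^esub> k" unfolding I_def by blast
      have "(a \<oplus>\<^bsub>R\<^esub> b) \<odot>\<^bsub>M\<^esub> x = (u \<oplus>\<^bsub>M\<^esub> v) \<oplus>\<^bsub>M\<^esub> (h \<oplus>\<^bsub>M\<^esub> k)"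
        using * x Sc Uc by (simp add: M.smult_ring_distr M.M.a_ac)
      then show "a \<oplus>\<^bsub>?F\<^esub> b \<in> I n"
        using * submodule_add[OF U(1)[of n]] submodule_add[OF S] unfolding I_def
        by (intro CollectI conjI bexI[of _ "u \<oplus>\<^bsub>M\<^esub> v"] bexI[of _ "h \<oplus>\<^bsub>M\<^esub> k"]) simp_all
    next
      fix b a assume b: "b \<in> carrier R" and "a \<in> I n"
      then obtain u h where *: "a \<in> carrier R" "u \<in> U n" "h \<in> ?S" "a \<odot>\<^bsub>M\<^esub> x = u \<oplus>\<^bsub>M\<^esub> h"
        unfolding I_def by blast
      have "(a \<otimes>\<^bsub>R\<^esub> b) \<odot>\<^bsub>M\<^esub> x = b \<odot>\<^bsub>M\<^esub> u \<oplus>\<^bsub>M\<^esub> b \<odot>\<^bsub>M\<^esub> h"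
        using * x b Sc Uc by (simp add: M.smult_assoc M.smult_module_distr)
      then show "b \<odot>\<^bsub>?F\<^esub> a \<in> I n"
        using * b submodule_smult[OF U(1)[of n]] submodule_smult[OF S] unfolding I_def
        by (intro CollectI conjI bexI[of _ "b \<odot>\<^bsub>M\<^esub> u"] bexI[of _ "b \<odot>\<^bsub>M\<^esub> h"]) simp_all
    qed (auto simp: I_def)
    moreover have "I (Suc n) \<subseteq> I n" for n using U(2)[of n] unfolding I_def by blast
    ultimately obtain n1 where n1: "\<forall>m\<ge>n1. I m = I n1" by (rule dccE[OF assms(2), of I])
    obtain n2 where n2: "\<forall>m\<ge>n2. U m \<inter> ?S = U n2 \<inter> ?S" using insert.IH[OF A] by (elim exE)
    define n where "n = max n1 n2"
    have "y \<in> U m" if m: "m \<ge> n" and y: "y \<in> U n" "y \<in> generated R M (insert x A)" for m y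
    proof -
      obtain a h where ah: "a \<in> carrier R" "h \<in> ?S" "y = a \<odot>\<^bsub>M\<^esub> x \<oplus>\<^bsub>M\<^esub> h"
        using y(2) generated_insert[OF M insert.prems] by (auto simp: cyclic_sum_def)
      have "a \<odot>\<^bsub>M\<^esub> x = y \<oplus>\<^bsub>M\<^esub> \<ominus>\<^bsub>M\<^esub> h" using ah x Sc by (simp add: M.M.a_assoc M.M.r_neg)
      then have "a \<in> I n" using ah(1) y(1) submodule_neg[OF S ah(2)] unfolding I_def
        by (intro CollectI conjI bexI[of _ y] bexI[of _ "\<ominus>\<^bsub>M\<^esub> h"])
      moreover have "I n = I m"
        using n1[rule_format, of n] n1[rule_format, of m] m by (simp add: n_def)
      ultimately have "a \<in> I m" by simp
      then obtain u k where uk: "u \<in> U m" "k \<in> ?S" "a \<odot>\<^bsub>M\<^esub> x = u \<oplus>\<^bsub>M\<^esub> k"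
        unfolding I_def mem_Collect_eq by (elim conjE bexE)
      have kh: "k \<oplus>\<^bsub>M\<^esub> h \<in> ?S" by (rule submodule_add[OF S uk(2) ah(2)])
      have y': "y = u \<oplus>\<^bsub>M\<^esub> (k \<oplus>\<^bsub>M\<^esub> h)" using ah uk x Sc Uc by (simp add: M.M.a_assoc)
      have uc: "u \<in> carrier M" "k \<oplus>\<^bsub>M\<^esub> h \<in> carrier M" using uk(1) Uc kh Sc by auto
      have "\<ominus>\<^bsub>M\<^esub> u \<oplus>\<^bsub>M\<^esub> y \<in> U n"
        using mono[OF m] uk(1) by (intro submodule_add[OF U(1)] submodule_neg[OF U(1)] y(1)) (rule subsetD)
      moreover have "\<ominus>\<^bsub>M\<^esub> u \<oplus>\<^bsub>M\<^esub> y = k \<oplus>\<^bsub>M\<^esub> h" unfolding y' using uc by (rule M.M.r_neg1)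
      ultimately have "k \<oplus>\<^bsub>M\<^esub> h \<in> U n \<inter> ?S" using kh by simp
      also have "U n \<inter> ?S = U m \<inter> ?S" 
        using n2[rule_format, of n] n2[rule_format, of m] m by (simp add: n_def)
      finally show "y \<in> U m" unfolding y' by (intro submodule_add[OF U(1) uk(1)]) (rule IntD1)
    qed
    then show ?case using mono by (intro exI[of _ n]) blast
  qed
  obtain A where A: "A \<subseteq> carrier M" "finite A" "generated R M A = carrier M"
    using assms(3) unfolding fin_gen_generated[OF M] by blast
  show ?thesis
    unfolding dcc_def
  proof (intro allI impI)
    fix U assume U: "\<forall>n. submodule (U n) R M \<and> U (Suc n) \<subseteq> U n"
    then have "U m \<inter> carrier M = U m" for m using submodule_subset by blast
    then show "\<exists>n. \<forall>m\<ge>n. U m = U n" using stab[of U A] U A(1,2) unfolding A(3) by presburger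
  qed
qed

text \<open>Zorn's lemma, applied in two ways: with the element one of the ring it yields maximal right
  ideals, and with an element of a semisimple module it yields maximal submodules.\<close>

lemma submodule_avoiding:
  assumes M: "right_module R M" and W: "submodule W R M" and u: "u \<notin> W"
  obtains U where "submodule U R M" "W \<subseteq> U" "u \<notin> U"
    "\<forall>V. submodule V R M \<longrightarrow> U \<subset> V \<longrightarrow> u \<in> V"
proof -
  let ?\<A> = "{U. submodule U R M \<and> W \<subseteq> U \<and> u \<notin> U}"
  have "\<Union>\<C> \<in> ?\<A>" if C: "\<C> \<noteq> {}" "subset.chain ?\<A> \<C>" for \<C>
  proof -
    have C': "\<C> \<subseteq> ?\<A>" "\<forall>X\<in>\<C>. \<forall>Y\<in>\<C>. X \<subseteq> Y \<or> Y \<subseteq> X"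
      using C(2)[unfolded subset_chain_def, THEN conjunct1] C(2)[unfolded subset_chain_def, THEN conjunct2] .
    have CA: "submodule X R M \<and> W \<subseteq> X \<and> u \<notin> X" if "X \<in> \<C>" for X
      using subsetD[OF C'(1) that] by simp
    have "submodule (\<Union>\<C>) R M"
    proof (rule right_module.submoduleI[OF M])
      note sub = CA[THEN conjunct1]
      show "\<Union>\<C> \<subseteq> carrier M" using submodule_subset[OF sub] by (rule Union_least)
      show "\<zero>\<^bsub>M\<^esub> \<in> \<Union>\<C>" using submodule_zero[OF sub] C(1) by auto
      show "a \<odot>\<^bsub>M\<^esub> x \<in> \<Union>\<C>" if "a \<in> carrier R" "x \<in> \<Union>\<C>" for a x
        using submodule_smult[OF sub that(1)] that(2) by auto
      show "x \<oplus>\<^bsub>M\<^esub> y \<in> \<Union>\<C>" if xy: "x \<in> \<Union>\<C>" "y \<in> \<Union>\<C>" for x y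
      proof -
        obtain X Y where XY: "X \<in> \<C>" "Y \<in> \<C>" "x \<in> X" "y \<in> Y" using xy by blast
        then have "X \<subseteq> Y \<or> Y \<subseteq> X" using C'(2) by simp
        then obtain Z where "Z \<in> \<C>" "x \<in> Z" "y \<in> Z" using XY by blast
        then show ?thesis using submodule_add[OF sub] by auto
      qed
    qed
    moreover have "W \<subseteq> \<Union>\<C>" "u \<notin> \<Union>\<C>" using CA C(1) by auto
    ultimately show ?thesis by simp
  qed
  then have "\<exists>U\<in>?\<A>. \<forall>X\<in>?\<A>. U \<subseteq> X \<longrightarrow> X = U"
    using W u by (intro subset_Zorn_nonempty) auto
  then obtain U where U: "U \<in> ?\<A>" "\<forall>X\<in>?\<A>. U \<subseteq> X \<longrightarrow> X = U" by (elim bexE)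
  have "\<forall>V. submodule V R M \<longrightarrow> U \<subset> V \<longrightarrow> u \<in> V"
  proof (intro allI impI)
    fix V assume V: "submodule V R M" "U \<subset> V"
    show "u \<in> V"
    proof (rule ccontr)
      assume "u \<notin> V"
      then have "V \<in> ?\<A>" using U(1) V by auto
      then have "V = U" using U(2) V(2) by simp
      then show False using V(2) by simp
    qed
  qed
  then show ?thesis using U(1) by (intro that[of U]) simp_all
qed

lemma (in cring) ideal_of_submodule:
  assumes "submodule I R (regular_module R)"
  shows "ideal I R"
proof (rule idealI[OF ring_axioms])
  have sc: "I \<subseteq> carrier R" using submodule_subset[OF assms] by (simp add: regular_module_def)
  show "subgroup I (add_monoid R)"
    using assms unfolding submodule_def by (simp add: subgroup_def regular_module_def m_inv_def)
  fix a x assume ax: "a \<in> I" "x \<in> carrier R"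
  show "a \<otimes> x \<in> I" using submodule_smult[OF assms ax(2,1)] by (simp add: regular_module_def)
  then show "x \<otimes> a \<in> I" using ax sc by (simp add: m_comm subset_iff)
qed

lemma (in module) is_right_module: "right_module R M"
  unfolding right_module_def right_module_axioms_def
proof (intro conjI allI impI)
  show "(a \<otimes> b) \<odot>\<^bsub>M\<^esub> x = b \<odot>\<^bsub>M\<^esub> (a \<odot>\<^bsub>M\<^esub> x)"
    if "a \<in> carrier R" "b \<in> carrier R" "x \<in> carrier M" for a b x
    using smult_assoc1[OF that(2,1,3)] that by (simp add: R.m_comm)
qed (simp_all add: R.ring_axioms M.abelian_group_axioms smult_l_distr smult_r_distr)

text \<open>\<open>R\<close> is finitely generated over the artinian ring \<open>S\<close>, and every right ideal of \<open>R\<close> is an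
  \<open>S\<close>-submodule.\<close>

lemma artin_algebra_dcc:
  assumes "artin_algebra S R"
  shows "dcc R (regular_module R)"
proof -
  interpret artin_algebra S R by fact
  have S: "cring S" using base_artinian by (simp add: artinian_cring_def)
  have SR: "right_module S R" by (rule module.is_right_module) (rule artin_algebra.axioms(2)[OF assms])
  have "dcc S (regular_module S)"
    unfolding dcc_def
  proof (intro allI impI)
    fix U assume U: "\<forall>n. submodule (U n) S (regular_module S) \<and> U (Suc n) \<subseteq> U n"
    have "ideal (U n) S" for n using U by (intro cring.ideal_of_submodule[OF S]) blast
    then show "\<exists>n. \<forall>m\<ge>n. U m = U n" using base_artinian U unfolding artinian_cring_def by blast
  qed
  then have dS: "dcc S R" by (rule dcc_fin_gen[OF SR _ fin_gen_over_base])
  show ?thesis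
    unfolding dcc_def
  proof (intro allI impI)
    fix U assume U: "\<forall>n. submodule (U n) R (regular_module R) \<and> U (Suc n) \<subseteq> U n"
    have "submodule (U n) S R" for n
    proof (rule right_module.submoduleI[OF SR])
      have Un: "submodule (U n) R (regular_module R)" using U by blast
      show sc: "U n \<subseteq> carrier R" using submodule_subset[OF Un] by (simp add: regular_module_def)
      show "\<zero>\<^bsub>R\<^esub> \<in> U n" using submodule_zero[OF Un] by (simp add: regular_module_def)
      show "x \<oplus>\<^bsub>R\<^esub> y \<in> U n" if "x \<in> U n" "y \<in> U n" for x y
        using submodule_add[OF Un that] by (simp add: regular_module_def)
      show "a \<odot>\<^bsub>R\<^esub> x \<in> U n" if a: "a \<in> carrier S" "x \<in> U n" for a x
      proof -
        have x: "x \<in> carrier R" using a sc by blast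
        have "(a \<odot>\<^bsub>R\<^esub> \<one>\<^bsub>R\<^esub>) \<odot>\<^bsub>regular_module R\<^esub> x \<in> U n"
          using a by (intro submodule_smult[OF Un]) simp_all
        moreover have "(a \<odot>\<^bsub>R\<^esub> \<one>\<^bsub>R\<^esub>) \<odot>\<^bsub>regular_module R\<^esub> x = a \<odot>\<^bsub>R\<^esub> x"
          using a x by (simp add: regular_module_def smult_mult_right)
        ultimately show ?thesis by simp
      qed
    qed
    then show "\<exists>n. \<forall>m\<ge>n. U m = U n" using dS U unfolding dcc_def by blast
  qed
qed

section \<open>The radical of a right artinian ring\<close>

lemma regular_simps [simp]:
  "carrier (regular_module R) = carrier R" "x \<oplus>\<^bsub>regular_module R\<^esub> y = x \<oplus>\<^bsub>R\<^esub> y"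
  "a \<odot>\<^bsub>regular_module R\<^esub> x = x \<otimes>\<^bsub>R\<^esub> a" "\<zero>\<^bsub>regular_module R\<^esub> = \<zero>\<^bsub>R\<^esub>"
  by (simp_all add: regular_module_def)

abbreviation right_ideal :: "'r set \<Rightarrow> ('r, 'x) ring_scheme \<Rightarrow> bool" where
  "right_ideal I R \<equiv> submodule I R (regular_module R)"

text \<open>Elements that are zero or generate a simple submodule, expressed without submodules.\<close>

definition simple_elt :: "('r, 'x) ring_scheme \<Rightarrow> ('r, 'm, 'y) module_scheme \<Rightarrow> 'm \<Rightarrow> bool" where
  "simple_elt R M u \<longleftrightarrow> u \<in> carrier M \<and>
     (\<forall>a\<in>carrier R. a \<odot>\<^bsub>M\<^esub> u \<noteq> \<zero>\<^bsub>M\<^esub> \<longrightarrow> (\<exists>b\<in>carrier R. b \<odot>\<^bsub>M\<^esub> (a \<odot>\<^bsub>M\<^esub> u) = u))"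

context ring
begin

lemma right_idealI:
  assumes "I \<subseteq> carrier R" "\<zero> \<in> I" "\<And>x y. x \<in> I \<Longrightarrow> y \<in> I \<Longrightarrow> x \<oplus> y \<in> I"
    "\<And>x a. x \<in> I \<Longrightarrow> a \<in> carrier R \<Longrightarrow> x \<otimes> a \<in> I"
  shows "right_ideal I R"
  using assms by (intro right_module.submoduleI[OF regular_right_module[OF ring_axioms]]) simp_all

lemma
  assumes "right_ideal I R"
  shows right_ideal_carrier: "x \<in> I \<Longrightarrow> x \<in> carrier R"
    and right_ideal_zero: "\<zero> \<in> I"
    and right_ideal_add: "x \<in> I \<Longrightarrow> y \<in> I \<Longrightarrow> x \<oplus> y \<in> I"
    and right_ideal_mult: "x \<in> I \<Longrightarrow> a \<in> carrier R \<Longrightarrow> x \<otimes> a \<in> I"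
    and right_ideal_neg: "x \<in> I \<Longrightarrow> \<ominus> x \<in> I"
proof -
  show c: "x \<in> I \<Longrightarrow> x \<in> carrier R" for x using submodule_subset[OF assms] by auto
  show "\<zero> \<in> I" using submodule_zero[OF assms] by simp
  show "x \<in> I \<Longrightarrow> y \<in> I \<Longrightarrow> x \<oplus> y \<in> I" using submodule_add[OF assms] by simp
  show m: "x \<in> I \<Longrightarrow> a \<in> carrier R \<Longrightarrow> x \<otimes> a \<in> I" for x a using submodule_smult[OF assms] by simp
  show "x \<in> I \<Longrightarrow> \<ominus> x \<in> I" using m[of x "\<ominus> \<one>"] c[of x] by (simp add: r_minus)
qed

lemma right_ideal_diff: "right_ideal I R \<Longrightarrow> x \<in> I \<Longrightarrow> y \<in> I \<Longrightarrow> x \<ominus> y \<in> I"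
  unfolding a_minus_def by (intro right_ideal_add right_ideal_neg)

lemma right_ideal_one: "right_ideal I R \<Longrightarrow> \<one> \<in> I \<Longrightarrow> I = carrier R"
  using right_ideal_mult[of I \<one>] right_ideal_carrier[of I] by (intro equalityI subsetI) force+

lemma right_ideal_principal:
  assumes "a \<in> carrier R" shows "right_ideal ((\<lambda>c. a \<otimes> c) ` carrier R) R"
proof (rule right_idealI)
  let ?H = "(\<lambda>c. a \<otimes> c) ` carrier R"
  show "?H \<subseteq> carrier R" using assms by auto
  show "\<zero> \<in> ?H" using assms by (intro image_eqI[of _ _ \<zero>]) simp_all
  show "x \<oplus> y \<in> ?H" if xy: "x \<in> ?H" "y \<in> ?H" for x y
  proof -
    obtain c d where "c \<in> carrier R" "d \<in> carrier R" "x = a \<otimes> c" "y = a \<otimes> d" using xy by blast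
    then show ?thesis using assms by (intro image_eqI[of _ _ "c \<oplus> d"]) (simp_all add: r_distr)
  qed
  show "x \<otimes> b \<in> ?H" if xb: "x \<in> ?H" "b \<in> carrier R" for x b
  proof -
    obtain c where "c \<in> carrier R" "x = a \<otimes> c" using xb by blast
    then show ?thesis using assms xb by (intro image_eqI[of _ _ "c \<otimes> b"]) (simp_all add: m_assoc)
  qed
qed

lemma maximal_right_idealD: "right_ideal I R" "\<one> \<notin> I" if "maximal_right_ideal I R"
  using that right_ideal_one[of I] unfolding maximal_right_ideal_def by blast+

lemma right_ideal_Inter_maximal:
  assumes "\<forall>I\<in>F. maximal_right_ideal I R" shows "right_ideal (carrier R \<inter> \<Inter>F) R"
proof -
  have rI: "right_ideal I R" if "I \<in> F" for I using assms that maximal_right_idealD(1) by blast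
  show ?thesis
    using right_ideal_zero[OF rI] right_ideal_add[OF rI] right_ideal_mult[OF rI] by (intro right_idealI) auto
qed

lemma maximal_right_ideal_split:
  assumes I: "maximal_right_ideal I R" and b: "b \<in> carrier R" "b \<notin> I"
  obtains i s where "i \<in> I" "s \<in> carrier R" "\<one> = i \<oplus> b \<otimes> s"
proof -
  note rI = maximal_right_idealD(1)[OF I] and F = regular_right_module[OF ring_axioms]
  let ?K = "cyclic_sum R (regular_module R) b I"
  have b': "b \<in> carrier (regular_module R)" using b(1) by simp
  have "right_ideal ?K R" by (rule cyclic_sum_submodule[OF F rI b'])
  moreover have "I \<subseteq> ?K" by (rule cyclic_sum_superset[OF F rI b'])
  moreover have "?K \<noteq> I" using cyclic_sum_mem[OF F rI b'] b(2) by metis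
  ultimately have "?K = carrier R" using I unfolding maximal_right_ideal_def by blast
  then have "\<one> \<in> ?K" by simp
  then obtain s i where si: "s \<in> carrier R" "i \<in> I" "\<one> = b \<otimes> s \<oplus> i" unfolding cyclic_sum_def by auto
  then show ?thesis using that[of i s] b(1) right_ideal_carrier[OF rI] by (simp add: a_comm)
qed

lemma maximal_right_ideal_exists:
  assumes "right_ideal H R" "\<one> \<notin> H"
  obtains I where "maximal_right_ideal I R" "H \<subseteq> I"
proof -
  obtain U where U: "right_ideal U R" "H \<subseteq> U" "\<one> \<notin> U" "\<forall>V. right_ideal V R \<longrightarrow> U \<subset> V \<longrightarrow> \<one> \<in> V"
    by (rule submodule_avoiding[OF regular_right_module[OF ring_axioms] assms])
  have "J = U \<or> J = carrier R" if "right_ideal J R" "U \<subseteq> J" for J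
    using U(4) that right_ideal_one[OF that(1)] by blast
  moreover have "U \<noteq> carrier R" using U(3) by auto
  ultimately have "maximal_right_ideal U R" unfolding maximal_right_ideal_def using U(1) by blast
  then show ?thesis using U(2) by (rule that)
qed

lemma jacobson_radE: "x \<in> jacobson_rad R \<Longrightarrow> x \<in> carrier R"
  by (simp add: jacobson_rad_def)

lemma jacobson_right_ideal: "right_ideal (jacobson_rad R) R"
  using maximal_right_idealD(1)[THEN right_ideal_zero] maximal_right_idealD(1)[THEN right_ideal_add]
    maximal_right_idealD(1)[THEN right_ideal_mult]
  by (intro right_idealI) (auto simp: jacobson_rad_def)

text \<open>Left multiplication by \<open>r\<close> embeds the quotient of \<open>R\<close> by this right ideal into the simple
  module \<open>R / I\<close>.\<close>

lemma maximal_right_ideal_conductor: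
  assumes I: "maximal_right_ideal I R" and r: "r \<in> carrier R" "r \<notin> I"
  shows "maximal_right_ideal {y \<in> carrier R. r \<otimes> y \<in> I} R"
  unfolding maximal_right_ideal_def
proof (intro conjI allI impI)
  let ?I' = "{y \<in> carrier R. r \<otimes> y \<in> I}"
  note rI = maximal_right_idealD(1)[OF I]
  show I': "right_ideal ?I' R"
    using r right_ideal_zero[OF rI] right_ideal_add[OF rI] right_ideal_mult[OF rI]
    by (intro right_idealI) (auto simp: r_distr simp flip: m_assoc)
  have "\<one> \<notin> ?I'" using r by simp
  then show "?I' \<noteq> carrier R" using one_closed by metis
  fix K assume K: "right_ideal K R \<and> ?I' \<subseteq> K"
  show "K = ?I' \<or> K = carrier R"
  proof (cases "K \<subseteq> ?I'")
    case True then show ?thesis using K by blast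
  next
    case False
    then obtain y where y: "y \<in> K" "y \<notin> ?I'" by blast
    have yc: "y \<in> carrier R" using right_ideal_carrier K y by blast
    have ry: "r \<otimes> y \<in> carrier R" "r \<otimes> y \<notin> I" using y yc r by auto
    obtain i s where isplit: "i \<in> I" "s \<in> carrier R" "\<one> = i \<oplus> (r \<otimes> y) \<otimes> s"
      by (rule maximal_right_ideal_split[OF I ry])
    have ic: "i \<in> carrier R" using isplit right_ideal_carrier[OF rI] by blast
    have "r = (i \<oplus> (r \<otimes> y) \<otimes> s) \<otimes> r" using r by (simp flip: isplit(3))
    also have "\<dots> = i \<otimes> r \<oplus> r \<otimes> (y \<otimes> (s \<otimes> r))" using ic r yc isplit by (simp add: l_distr m_assoc)
    finally have rr: "r = i \<otimes> r \<oplus> r \<otimes> (y \<otimes> (s \<otimes> r))" .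
    have "r \<otimes> (\<one> \<ominus> y \<otimes> (s \<otimes> r)) = r \<ominus> r \<otimes> (y \<otimes> (s \<otimes> r))"
      using r yc isplit(2) by (simp add: a_minus_def r_distr r_minus)
    also have "\<dots> = i \<otimes> r"
      by (subst (1) rr) (use ic r yc isplit(2) in \<open>simp add: a_minus_def a_assoc r_neg\<close>)
    finally have "r \<otimes> (\<one> \<ominus> y \<otimes> (s \<otimes> r)) \<in> I" using right_ideal_mult[OF rI isplit(1) r(1)] by simp
    then have "\<one> \<ominus> y \<otimes> (s \<otimes> r) \<in> K" using K r yc isplit(2) by auto
    moreover have "y \<otimes> (s \<otimes> r) \<in> K" using right_ideal_mult[of K y] K y isplit(2) r by simp
    ultimately have "(\<one> \<ominus> y \<otimes> (s \<otimes> r)) \<oplus> y \<otimes> (s \<otimes> r) \<in> K" using right_ideal_add K by blast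
    then have "\<one> \<in> K" using yc isplit(2) r by (simp add: a_minus_def a_assoc l_neg)
    then show ?thesis using right_ideal_one K by blast
  qed
qed

lemma jacobson_left_mult:
  assumes "x \<in> jacobson_rad R" "r \<in> carrier R" shows "r \<otimes> x \<in> jacobson_rad R"
proof -
  have x: "x \<in> carrier R" using assms(1) by (rule jacobson_radE)
  have "r \<otimes> x \<in> I" if I: "maximal_right_ideal I R" for I
  proof (cases "r \<in> I")
    case True then show ?thesis using right_ideal_mult[OF maximal_right_idealD(1)[OF I]] x by blast
  next
    case False
    from maximal_right_ideal_conductor[OF I assms(2) this] show ?thesis
      using assms(1) unfolding jacobson_rad_def by blast
  qed
  then show ?thesis using x assms(2) by (simp add: jacobson_rad_def)
qed

lemma jacobson_ideal: "ideal (jacobson_rad R) R"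
proof (rule idealI[OF ring_axioms])
  show "subgroup (jacobson_rad R) (add_monoid R)"
    using jacobson_right_ideal unfolding submodule_def by (simp add: subgroup_def regular_module_def m_inv_def)
qed (simp_all add: jacobson_left_mult right_ideal_mult[OF jacobson_right_ideal])

text \<open>A proper right ideal containing \<open>1 - b\<close> would lie in a maximal one, which contains \<open>b\<close> too.\<close>

lemma jacobson_right_invertible:
  assumes "b \<in> jacobson_rad R"
  obtains c where "c \<in> carrier R" "(\<one> \<ominus> b) \<otimes> c = \<one>"
proof -
  have b: "b \<in> carrier R" using assms by (rule jacobson_radE)
  let ?H = "(\<lambda>c. (\<one> \<ominus> b) \<otimes> c) ` carrier R"
  have H: "right_ideal ?H R" by (rule right_ideal_principal) (use b in simp)
  have "\<one> \<in> ?H"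
  proof (rule ccontr)
    assume "\<one> \<notin> ?H"
    then obtain I where I: "maximal_right_ideal I R" "?H \<subseteq> I" by (rule maximal_right_ideal_exists[OF H])
    have "(\<one> \<ominus> b) \<otimes> \<one> \<in> I" using I(2) by auto
    then have "\<one> \<ominus> b \<in> I" using b by simp
    moreover have "b \<in> I" using assms I(1) by (simp add: jacobson_rad_def)
    ultimately have "(\<one> \<ominus> b) \<oplus> b \<in> I" using right_ideal_add[OF maximal_right_idealD(1)[OF I(1)]] by blast
    then have "\<one> \<in> I" using b by (simp add: a_minus_def a_assoc l_neg)
    then show False using maximal_right_idealD(2)[OF I(1)] by blast
  qed
  then show ?thesis using that by (metis imageE)
qed

lemma rad_power_ideal: "ideal (rad_power R n) R"
  by (induction n) (simp_all add: oneideal ideal_prod_is_ideal jacobson_ideal)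

lemma rad_power_add: "rad_power R (m + n) = ideal_prod R (rad_power R m) (rad_power R n)"
proof (induction n)
  case 0 show ?case using ideal_prod_one[OF rad_power_ideal] by simp
next
  case (Suc n)
  then show ?case using ideal_prod_assoc[OF rad_power_ideal rad_power_ideal jacobson_ideal] by simp
qed

lemma ideal_right_ideal: "ideal I R \<Longrightarrow> right_ideal I R"
  by (intro right_idealI) (auto simp: ideal.Icarr additive_subgroup.zero_closed[OF ideal.axioms(1)]
      additive_subgroup.a_closed[OF ideal.axioms(1)] ideal.I_r_closed)

end

locale right_artinian = ring R for R :: "('r, 'x) ring_scheme" (structure) +
  assumes right_dcc: "dcc R (regular_module R)"
begin

text \<open>Let \<open>B\<close> be the stable value of the powers of the radical, so that \<open>B B = B\<close>.  If \<open>B\<close> is not zero,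
  take a minimal right ideal \<open>I\<close> with \<open>I B \<noteq> 0\<close> and \<open>x \<in> I\<close> with \<open>x B \<noteq> 0\<close>.  Then \<open>x B = I\<close> by
  minimality, so \<open>x = x c\<close> for some \<open>c\<close> in the radical; but \<open>1 - c\<close> is right invertible, so \<open>x = 0\<close>.\<close>

lemma jacobson_nilpotent: "\<exists>n. rad_power R n = {\<zero>}"
proof -
  let ?P = "rad_power R"
  have dec: "?P (Suc n) \<subseteq> ?P n" for n
    using ideal_prod_inter[OF rad_power_ideal jacobson_ideal] by auto
  obtain n where n: "\<forall>m\<ge>n. ?P m = ?P n"
    by (rule dccE[OF right_dcc, of ?P, OF ideal_right_ideal[OF rad_power_ideal] dec])
  define B where "B = ?P n"
  have Bc: "b \<in> B \<Longrightarrow> b \<in> carrier R" for b using ideal.Icarr[OF rad_power_ideal] by (simp add: B_def)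
  have rB: "right_ideal B R" unfolding B_def by (rule ideal_right_ideal[OF rad_power_ideal])
  have BB: "ideal_prod R B B = B"
    using n[rule_format, of "n + n"] by (simp add: B_def rad_power_add)
  have "?P (Suc n) \<subseteq> jacobson_rad R" using ideal_prod_inter[OF rad_power_ideal jacobson_ideal] by auto
  then have BJ: "B \<subseteq> jacobson_rad R" using n[rule_format, of "Suc n"] by (simp add: B_def del: rad_power.simps)
  have "B = {\<zero>}"
  proof (rule ccontr)
    assume "B \<noteq> {\<zero>}"
    then obtain b0 where b0: "b0 \<in> B" "b0 \<noteq> \<zero>" using right_ideal_zero[OF rB] by blast
    let ?\<U> = "{I. right_ideal I R \<and> (\<exists>x\<in>I. \<exists>b\<in>B. x \<otimes> b \<noteq> \<zero>)}"
    have "\<one> \<otimes> b0 \<noteq> \<zero>" using b0 Bc by simp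
    then have "carrier R \<in> ?\<U>" using b0(1) ideal_right_ideal[OF oneideal] one_closed by blast
    then have "\<exists>I\<in>?\<U>. \<forall>V\<in>?\<U>. V \<subseteq> I \<longrightarrow> V = I" by (intro dcc_minimal[OF right_dcc]) auto
    then obtain I where I: "I \<in> ?\<U>" "\<forall>V\<in>?\<U>. V \<subseteq> I \<longrightarrow> V = I" by (elim bexE)
    then have rI: "right_ideal I R" by blast
    obtain x b where x: "x \<in> I" "b \<in> B" "x \<otimes> b \<noteq> \<zero>" using I(1) by blast
    have xc: "x \<in> carrier R" using right_ideal_carrier[OF rI x(1)] .
    let ?K = "(\<lambda>b. x \<otimes> b) ` B"
    have K: "right_ideal ?K R"
    proof (rule right_idealI)
      show "?K \<subseteq> carrier R" using xc Bc by auto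
      show "\<zero> \<in> ?K" using xc right_ideal_zero[OF rB] by (intro image_eqI[of _ _ \<zero>]) simp_all
      show "y \<oplus> z \<in> ?K" if yz: "y \<in> ?K" "z \<in> ?K" for y z
      proof -
        obtain c d where "c \<in> B" "d \<in> B" "y = x \<otimes> c" "z = x \<otimes> d" using yz by blast
        then show ?thesis using xc Bc right_ideal_add[OF rB]
          by (intro image_eqI[of _ _ "c \<oplus> d"]) (simp_all add: r_distr)
      qed
      show "y \<otimes> a \<in> ?K" if ya: "y \<in> ?K" "a \<in> carrier R" for y a
      proof -
        obtain c where "c \<in> B" "y = x \<otimes> c" using ya by blast
        then show ?thesis using xc Bc ya right_ideal_mult[OF rB]
          by (intro image_eqI[of _ _ "c \<otimes> a"]) (simp_all add: m_assoc)
      qed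
    qed
    have "\<exists>y\<in>?K. \<exists>b\<in>B. y \<otimes> b \<noteq> \<zero>"
    proof (rule ccontr)
      assume no: "\<not> (\<exists>y\<in>?K. \<exists>b\<in>B. y \<otimes> b \<noteq> \<zero>)"
      have "c \<in> carrier R \<and> x \<otimes> c = \<zero>" if "c \<in> ideal_prod R B B" for c
        using that
      proof induction
        case (prod i j)
        have "(x \<otimes> i) \<otimes> j = \<zero>" using no prod by blast
        then show ?case using prod xc Bc by (simp add: m_assoc)
      next
        case (sum s1 s2) then show ?case using xc by (simp add: r_distr)
      qed
      then show False using x BB by blast
    qed
    then have "?K \<in> ?\<U>" using K by blast
    moreover have "?K \<subseteq> I" using right_ideal_mult[OF rI x(1)] Bc by blast
    ultimately have "?K = I" using I(2) by blast
    then obtain c where c: "c \<in> B" "x = x \<otimes> c" using x(1) by blast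
    obtain d where d: "d \<in> carrier R" "(\<one> \<ominus> c) \<otimes> d = \<one>"
      by (rule jacobson_right_invertible[OF subsetD[OF BJ c(1)]])
    have "x \<otimes> (\<one> \<ominus> c) = \<zero>"
      using xc Bc[OF c(1)] c(2) by (simp add: a_minus_def r_distr r_minus r_neg)
    then have "x \<otimes> ((\<one> \<ominus> c) \<otimes> d) = \<zero>"
      using xc Bc[OF c(1)] d(1) by (simp flip: m_assoc)
    then have "x = \<zero>" using d(2) xc by simp
    then show False using x Bc by simp
  qed
  then show ?thesis by (intro exI[of _ n]) (simp add: B_def)
qed

lemma rad_power_loewy_length: "rad_power R (loewy_length R) = {\<zero>}"
  unfolding loewy_length_def using jacobson_nilpotent by (rule LeastI_ex)

text \<open>A minimal finite intersection of maximal right ideals is contained in all of them.\<close>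

lemma jacobson_finite_Inter:
  obtains F where "finite F" "\<forall>I\<in>F. maximal_right_ideal I R" "carrier R \<inter> \<Inter>F = jacobson_rad R"
proof -
  let ?\<U> = "{carrier R \<inter> \<Inter>F | F. finite F \<and> (\<forall>I\<in>F. maximal_right_ideal I R)}"
  have "carrier R \<inter> \<Inter>{} \<in> ?\<U>" by blast
  then have "\<exists>U\<in>?\<U>. \<forall>V\<in>?\<U>. V \<subseteq> U \<longrightarrow> V = U"
    using right_ideal_Inter_maximal by (intro dcc_minimal[OF right_dcc]) auto
  then obtain U where U: "U \<in> ?\<U>" "\<forall>V\<in>?\<U>. V \<subseteq> U \<longrightarrow> V = U" by (elim bexE)
  obtain F where F: "U = carrier R \<inter> \<Inter>F" "finite F" "\<forall>I\<in>F. maximal_right_ideal I R" using U(1) by blast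
  have "U \<subseteq> I" if I: "maximal_right_ideal I R" for I
  proof -
    have "carrier R \<inter> \<Inter>(insert I F) \<in> ?\<U>" using F I by blast
    moreover have "carrier R \<inter> \<Inter>(insert I F) \<subseteq> U" using F(1) by blast
    ultimately have "carrier R \<inter> \<Inter>(insert I F) = U" using U(2) by blast
    then show ?thesis by blast
  qed
  then have "U = jacobson_rad R" using F(1,3) unfolding jacobson_rad_def by blast
  then show ?thesis using F by (intro that[of F]) simp_all
qed

end

section \<open>Semisimple modules and finite generation\<close>

context ring
begin

text \<open>An element killed by a finite intersection of maximal right ideals is a sum of elements that
  generate simple submodules.  Let \<open>B\<close> be the intersection of the members of \<open>F\<close>.  If \<open>B\<close> is not
  contained in the additional ideal \<open>I\<close>, then \<open>1 = i + f\<close> with \<open>i \<in> I\<close> and \<open>f \<in> B\<close>.  In the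
  decomposition \<open>x = x i + x f\<close> the first summand is killed by \<open>B\<close>, and the second one generates a
  quotient of \<open>R / I\<close>, because \<open>x f a = 0\<close> whenever \<open>f a \<in> I\<close>.\<close>

lemma mem_of_simple_elts:
  assumes M: "right_module R M" and H: "submodule H R M" "\<forall>u. simple_elt R M u \<longrightarrow> u \<in> H"
    and F: "finite F" "\<forall>I\<in>F. maximal_right_ideal I R"
    and x: "x \<in> carrier M" "\<forall>b\<in>carrier R \<inter> \<Inter>F. b \<odot>\<^bsub>M\<^esub> x = \<zero>\<^bsub>M\<^esub>"
  shows "x \<in> H"
  using F x
proof (induction F arbitrary: x rule: finite_induct)
  case empty
  interpret M: right_module R M by (rule M)
  have "\<one> \<odot>\<^bsub>M\<^esub> x = \<zero>\<^bsub>M\<^esub>" using empty.prems(3) by auto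
  then have "x = \<zero>\<^bsub>M\<^esub>" using empty.prems(2) by simp
  then show ?case using submodule_zero[OF H(1)] by simp
next
  case (insert I F)
  interpret M: right_module R M by (rule M)
  have I: "maximal_right_ideal I R" and F: "\<forall>I\<in>F. maximal_right_ideal I R" using insert.prems(1) by auto
  note rI = maximal_right_idealD(1)[OF I] and xc = insert.prems(2)
  define B where "B = carrier R \<inter> \<Inter>F"
  have rB: "right_ideal B R" unfolding B_def by (rule right_ideal_Inter_maximal[OF F])
  have kill: "c \<odot>\<^bsub>M\<^esub> x = \<zero>\<^bsub>M\<^esub>" if "c \<in> B" "c \<in> I" for c
    using insert.prems(3) that unfolding B_def by auto
  show ?case
  proof (cases "B \<subseteq> I")
    case True
    then show ?thesis using kill by (intro insert.IH[OF F xc]) (auto simp: B_def)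
  next
    case False
    then obtain b where b: "b \<in> B" "b \<notin> I" by blast
    have bc: "b \<in> carrier R" using b(1) by (simp add: B_def)
    obtain i s where isplit: "i \<in> I" "s \<in> carrier R" "\<one> = i \<oplus> b \<otimes> s"
      by (rule maximal_right_ideal_split[OF I bc b(2)])
    define f where "f = b \<otimes> s"
    have f: "f \<in> B" "f \<in> carrier R" using right_ideal_mult[OF rB b(1) isplit(2)] by (simp_all add: f_def B_def)
    have ic: "i \<in> carrier R" using right_ideal_carrier[OF rI isplit(1)] .
    have one: "i \<oplus> f = \<one>" unfolding f_def by (rule isplit(3)[symmetric])
    have "x = (i \<oplus> f) \<odot>\<^bsub>M\<^esub> x" using xc by (simp add: one)
    then have split: "x = i \<odot>\<^bsub>M\<^esub> x \<oplus>\<^bsub>M\<^esub> f \<odot>\<^bsub>M\<^esub> x" using ic f xc by (simp add: M.smult_ring_distr)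
    have "i \<odot>\<^bsub>M\<^esub> x \<in> H"
    proof (rule insert.IH[OF F])
      show "i \<odot>\<^bsub>M\<^esub> x \<in> carrier M" using ic xc by simp
      show "\<forall>c\<in>carrier R \<inter> \<Inter>F. c \<odot>\<^bsub>M\<^esub> (i \<odot>\<^bsub>M\<^esub> x) = \<zero>\<^bsub>M\<^esub>"
      proof
        fix c assume "c \<in> carrier R \<inter> \<Inter>F"
        then have c: "c \<in> B" "c \<in> carrier R" by (simp_all add: B_def)
        have "c = (i \<oplus> f) \<otimes> c" using c by (simp add: one)
        then have cc: "c = i \<otimes> c \<oplus> f \<otimes> c" using ic f c by (simp add: l_distr)
        have "i \<otimes> c = c \<ominus> f \<otimes> c"
          by (subst (2) cc) (use ic f c in \<open>simp add: a_minus_def a_assoc r_neg\<close>)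
        then have "i \<otimes> c \<in> B" using right_ideal_diff[OF rB c(1) right_ideal_mult[OF rB f(1) c(2)]] by simp
        then have "(i \<otimes> c) \<odot>\<^bsub>M\<^esub> x = \<zero>\<^bsub>M\<^esub>" using right_ideal_mult[OF rI isplit(1) c(2)] by (rule kill)
        then show "c \<odot>\<^bsub>M\<^esub> (i \<odot>\<^bsub>M\<^esub> x) = \<zero>\<^bsub>M\<^esub>" using ic c xc by (simp add: M.smult_assoc)
      qed
    qed
    moreover have "simple_elt R M (f \<odot>\<^bsub>M\<^esub> x)"
      unfolding simple_elt_def
    proof (intro conjI ballI impI)
      show "f \<odot>\<^bsub>M\<^esub> x \<in> carrier M" using f xc by simp
      fix a assume a: "a \<in> carrier R" "a \<odot>\<^bsub>M\<^esub> (f \<odot>\<^bsub>M\<^esub> x) \<noteq> \<zero>\<^bsub>M\<^esub>"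
      have fa: "f \<otimes> a \<in> B" "f \<otimes> a \<in> carrier R" using right_ideal_mult[OF rB f(1) a(1)] f a by simp_all
      have "f \<otimes> a \<notin> I" using kill[OF fa(1)] a f xc by (auto simp: M.smult_assoc)
      then obtain j t where jt: "j \<in> I" "t \<in> carrier R" "\<one> = j \<oplus> (f \<otimes> a) \<otimes> t"
        by (rule maximal_right_ideal_split[OF I fa(2)])
      have jc: "j \<in> carrier R" using right_ideal_carrier[OF rI jt(1)] .
      have "f = (j \<oplus> (f \<otimes> a) \<otimes> t) \<otimes> f" using f by (simp flip: jt(3))
      then have ff: "f = j \<otimes> f \<oplus> (f \<otimes> a) \<otimes> (t \<otimes> f)" using jc f a jt by (simp add: l_distr m_assoc)
      have g: "(f \<otimes> a) \<otimes> (t \<otimes> f) \<in> B" using right_ideal_mult[OF rB fa(1)] jt f by simp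
      have "j \<otimes> f = f \<ominus> (f \<otimes> a) \<otimes> (t \<otimes> f)"
        by (subst (2) ff) (use jc f a jt in \<open>simp add: a_minus_def a_assoc r_neg\<close>)
      then have "j \<otimes> f \<in> B" using right_ideal_diff[OF rB f(1) g] by simp
      then have "(j \<otimes> f) \<odot>\<^bsub>M\<^esub> x = \<zero>\<^bsub>M\<^esub>" using right_ideal_mult[OF rI jt(1) f(2)] by (rule kill)
      then have "f \<odot>\<^bsub>M\<^esub> x = ((f \<otimes> a) \<otimes> (t \<otimes> f)) \<odot>\<^bsub>M\<^esub> x"
        using M.smult_ring_distr[of "j \<otimes> f" "(f \<otimes> a) \<otimes> (t \<otimes> f)" x] jc f a jt xc ff by simp
      also have "\<dots> = (t \<otimes> f) \<odot>\<^bsub>M\<^esub> (a \<odot>\<^bsub>M\<^esub> (f \<odot>\<^bsub>M\<^esub> x))" using f a jt xc by (simp add: M.smult_assoc)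
      finally show "\<exists>b\<in>carrier R. b \<odot>\<^bsub>M\<^esub> (a \<odot>\<^bsub>M\<^esub> (f \<odot>\<^bsub>M\<^esub> x)) = f \<odot>\<^bsub>M\<^esub> x"
        using jt f by (intro bexI[of _ "t \<otimes> f"]) simp_all
    qed
    ultimately show ?thesis using H submodule_add[OF H(1)] split by metis
  qed
qed

end

lemma simple_elt_dichotomy:
  assumes "right_module R M" "submodule H R M" "simple_elt R M u" "u \<notin> H" "a \<in> carrier R" "a \<odot>\<^bsub>M\<^esub> u \<in> H"
  shows "a \<odot>\<^bsub>M\<^esub> u = \<zero>\<^bsub>M\<^esub>"
  using assms submodule_smult[OF assms(2)] unfolding simple_elt_def by metis

context right_artinian
begin

lemma semisimple_generated:
  assumes "right_module R M" "submodule H R M" "\<forall>u. simple_elt R M u \<longrightarrow> u \<in> H"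
    "\<forall>j\<in>jacobson_rad R. \<forall>x\<in>carrier M. j \<odot>\<^bsub>M\<^esub> x = \<zero>\<^bsub>M\<^esub>"
  shows "H = carrier M"
proof -
  obtain F where F: "finite F" "\<forall>I\<in>F. maximal_right_ideal I R" "carrier R \<inter> \<Inter>F = jacobson_rad R"
    by (rule jacobson_finite_Inter)
  have "x \<in> H" if "x \<in> carrier M" for x
    using assms(4) that by (intro mem_of_simple_elts[OF assms(1-3) F(1,2) that]) (simp add: F(3))
  then show ?thesis using submodule_subset[OF assms(2)] by blast
qed

text \<open>Choose \<open>U\<close> minimal such that \<open>U\<close> and finitely many elements generate \<open>M\<close>.  If \<open>U\<close> contained some
  \<open>u \<noteq> 0\<close>, let \<open>V\<close> be maximal among the submodules of \<open>U\<close> that avoid \<open>u\<close>.  For \<open>x\<close> generating a simple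
  module and not in \<open>V\<close>, maximality puts \<open>u\<close> into \<open>x R + V\<close>, and simplicity puts \<open>x\<close> into \<open>u R + V\<close>.
  As \<open>U\<close> is generated by simple submodules, \<open>U = u R + V\<close>, so \<open>V\<close> contradicts the minimality of \<open>U\<close>.\<close>

lemma semisimple_fin_gen:
  assumes M: "right_module R M" and d: "dcc R M"
    and J: "\<forall>j\<in>jacobson_rad R. \<forall>x\<in>carrier M. j \<odot>\<^bsub>M\<^esub> x = \<zero>\<^bsub>M\<^esub>"
  shows "fin_gen R M"
proof -
  interpret M: right_module R M by (rule M)
  let ?\<U> = "{U. submodule U R M \<and> (\<exists>A\<subseteq>carrier M. finite A \<and> generated R M (U \<union> A) = carrier M)}"
  have "generated R M (carrier M \<union> {}) = carrier M"
    using generated_superset[OF M, of "carrier M"] submodule_subset[OF generated_submodule[OF M, of "carrier M"]] by auto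
  then have "carrier M \<in> ?\<U>" using submodule_carrier[OF M] by blast
  then have "\<exists>U\<in>?\<U>. \<forall>V\<in>?\<U>. V \<subseteq> U \<longrightarrow> V = U" by (intro dcc_minimal[OF d]) auto
  then obtain U where U: "U \<in> ?\<U>" "\<forall>V\<in>?\<U>. V \<subseteq> U \<longrightarrow> V = U" by (elim bexE)
  obtain A where A: "submodule U R M" "A \<subseteq> carrier M" "finite A" "generated R M (U \<union> A) = carrier M"
    using U(1) by blast
  note Uc = submodule_subset[OF A(1)]
  have "U \<subseteq> {\<zero>\<^bsub>M\<^esub>}"
  proof (rule ccontr)
    assume "\<not> U \<subseteq> {\<zero>\<^bsub>M\<^esub>}"
    then obtain u where u: "u \<in> U" "u \<noteq> \<zero>\<^bsub>M\<^esub>" by blast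
    let ?N = "M\<lparr>carrier := U\<rparr>"
    note N = submodule_module[OF M A(1)]
    have u0: "u \<notin> {\<zero>\<^bsub>?N\<^esub>}" using u(2) by simp
    obtain V where V: "submodule V R ?N" "u \<notin> V" "\<forall>W. submodule W R ?N \<longrightarrow> V \<subset> W \<longrightarrow> u \<in> W"
      by (rule submodule_avoiding[OF N submodule_singleton_zero[OF N] u0])
    have uN: "u \<in> carrier ?N" using u(1) by simp
    let ?W = "cyclic_sum R ?N u V"
    note W = cyclic_sum_submodule[OF N V(1) uN] cyclic_sum_mem[OF N V(1) uN] cyclic_sum_superset[OF N V(1) uN]
    have "?W = carrier ?N"
    proof (rule semisimple_generated[OF N W(1)])
      show "\<forall>j\<in>jacobson_rad R. \<forall>x\<in>carrier ?N. j \<odot>\<^bsub>?N\<^esub> x = \<zero>\<^bsub>?N\<^esub>" using J Uc by auto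
      show "\<forall>x. simple_elt R ?N x \<longrightarrow> x \<in> ?W"
      proof (intro allI impI)
        fix x assume x: "simple_elt R ?N x"
        then have xN: "x \<in> carrier ?N" by (simp add: simple_elt_def)
        show "x \<in> ?W"
        proof (cases "x \<in> V")
          case True then show ?thesis using W(3) by blast
        next
          case False
          let ?X = "cyclic_sum R ?N x V"
          note X = cyclic_sum_submodule[OF N V(1) xN] cyclic_sum_mem[OF N V(1) xN] cyclic_sum_superset[OF N V(1) xN]
          have "u \<in> ?X" using V(3) X False by blast
          then obtain a v where av: "a \<in> carrier R" "v \<in> V" "u = a \<odot>\<^bsub>M\<^esub> x \<oplus>\<^bsub>M\<^esub> v"
            unfolding cyclic_sum_def by auto
          have cl: "x \<in> carrier M" "v \<in> carrier M" "u \<in> carrier M"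
            using xN av(2) submodule_subset[OF V(1)] Uc u(1) by auto
          have "a \<odot>\<^bsub>M\<^esub> x \<noteq> \<zero>\<^bsub>M\<^esub>" using av V(2) cl by auto
          then obtain b where b: "b \<in> carrier R" "b \<odot>\<^bsub>M\<^esub> (a \<odot>\<^bsub>M\<^esub> x) = x"
            using x av(1) unfolding simple_elt_def by auto
          have "a \<odot>\<^bsub>M\<^esub> x = u \<oplus>\<^bsub>M\<^esub> \<ominus>\<^bsub>M\<^esub> v" using av cl by (simp add: M.M.a_assoc M.M.r_neg)
          also have "\<ominus>\<^bsub>M\<^esub> v = (\<ominus> \<one>) \<odot>\<^bsub>M\<^esub> v" using cl by (simp add: M.smult_minus_one)
          also have "u \<oplus>\<^bsub>M\<^esub> (\<ominus> \<one>) \<odot>\<^bsub>M\<^esub> v \<in> ?W"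
            using submodule_add[OF W(1) W(2), of "(\<ominus> \<one>) \<odot>\<^bsub>M\<^esub> v"] submodule_smult[OF W(1), of "\<ominus> \<one>" v] W(3) av(2)
            by auto
          finally have "b \<odot>\<^bsub>M\<^esub> (a \<odot>\<^bsub>M\<^esub> x) \<in> ?W" using submodule_smult[OF W(1) b(1)] by simp
          then show ?thesis using b(2) by simp
        qed
      qed
    qed
    then have WU: "cyclic_sum R M u V = U" by (simp add: cyclic_sum_def)
    have VM: "submodule V R M" "V \<subseteq> U" using V(1) submodule_trans_iff[OF M A(1)] by blast+
    have sub: "V \<union> insert u A \<subseteq> carrier M" using VM(2) Uc u(1) A(2) by blast
    note G = generated_submodule[OF M sub] and Gs = generated_superset[OF M sub]
    have "U \<subseteq> generated R M (V \<union> insert u A)"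
    proof
      fix y assume "y \<in> U"
      then obtain a v where "a \<in> carrier R" "v \<in> V" "y = a \<odot>\<^bsub>M\<^esub> u \<oplus>\<^bsub>M\<^esub> v"
        unfolding WU[symmetric] cyclic_sum_def by blast
      then show "y \<in> generated R M (V \<union> insert u A)" using submodule_add[OF G] submodule_smult[OF G] Gs by auto
    qed
    then have "generated R M (U \<union> A) \<subseteq> generated R M (V \<union> insert u A)" using Gs by (intro generated_least[OF G]) auto
    then have "generated R M (V \<union> insert u A) = carrier M" using A(4) submodule_subset[OF G] by auto
    then have "V \<in> ?\<U>" using VM(1) A(2,3) u(1) Uc by (intro CollectI conjI exI[of _ "insert u A"]) auto
    then have "V = U" using U(2) VM(2) by simp
    then show False using u(1) V(2) by simp
  qed
  then have "U \<union> A \<subseteq> generated R M A"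
    using generated_superset[OF M A(2)] submodule_zero[OF generated_submodule[OF M A(2)]] by blast
  then have "generated R M (U \<union> A) \<subseteq> generated R M A" by (rule generated_least[OF generated_submodule[OF M A(2)]])
  then have "generated R M A = carrier M"
    using A(4) submodule_subset[OF generated_submodule[OF M A(2)]] by simp
  then show ?thesis unfolding fin_gen_generated[OF M] using A(2,3) by blast
qed

text \<open>\<open>H\<close> is the socle.  If \<open>M\<close> is killed by the power \<open>n + 1\<close> of the radical, then \<open>M / H\<close> is killed by
  the power \<open>n\<close>; this splits off the semisimple layers from the bottom.\<close>

lemma socle_layer:
  assumes M: "right_module R M"
    and kill: "\<forall>a\<in>rad_power R (Suc n). \<forall>x\<in>carrier M. a \<odot>\<^bsub>M\<^esub> x = \<zero>\<^bsub>M\<^esub>"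
  defines "H \<equiv> {x \<in> carrier M. \<forall>j\<in>jacobson_rad R. j \<odot>\<^bsub>M\<^esub> x = \<zero>\<^bsub>M\<^esub>}"
  shows "submodule H R M"
    and "a \<in> rad_power R n \<Longrightarrow> x \<in> carrier M \<Longrightarrow> a \<odot>\<^bsub>M\<^esub> x \<in> H"
proof -
  interpret M: right_module R M by (rule M)
  note Jc = jacobson_radE
  show "submodule H R M"
  proof (rule M.submoduleI)
    show "H \<subseteq> carrier M" "\<zero>\<^bsub>M\<^esub> \<in> H" using Jc by (auto simp: H_def)
    show "x \<oplus>\<^bsub>M\<^esub> y \<in> H" if "x \<in> H" "y \<in> H" for x y
      using that Jc by (simp add: H_def M.smult_module_distr)
    show "a \<odot>\<^bsub>M\<^esub> x \<in> H" if a: "a \<in> carrier R" "x \<in> H" for a x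
      using a(2) jacobson_left_mult[OF _ a(1)] a(1) Jc by (simp add: H_def flip: M.smult_assoc)
  qed
  assume a: "a \<in> rad_power R n" and x: "x \<in> carrier M"
  have ac: "a \<in> carrier R" by (rule ideal.Icarr[OF rad_power_ideal a])
  have "j \<odot>\<^bsub>M\<^esub> (a \<odot>\<^bsub>M\<^esub> x) = \<zero>\<^bsub>M\<^esub>" if j: "j \<in> jacobson_rad R" for j
  proof -
    have "a \<otimes> j \<in> rad_power R (Suc n)" using a j by (simp add: ideal_prod.prod)
    then have "(a \<otimes> j) \<odot>\<^bsub>M\<^esub> x = \<zero>\<^bsub>M\<^esub>" using kill x by blast
    then show ?thesis using ac Jc[OF j] x by (simp add: M.smult_assoc)
  qed
  then show "a \<odot>\<^bsub>M\<^esub> x \<in> H" using ac x by (simp add: H_def)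
qed

lemma quotient_killed:
  assumes "right_module R M" "right_module R C" "g \<in> rmod_hom R M C" "g ` carrier M = carrier C"
    "\<forall>a\<in>I. \<forall>x\<in>carrier M. a \<odot>\<^bsub>M\<^esub> x \<in> a_kernel M C g" "I \<subseteq> carrier R"
  shows "\<forall>a\<in>I. \<forall>y\<in>carrier C. a \<odot>\<^bsub>C\<^esub> y = \<zero>\<^bsub>C\<^esub>"
proof (intro ballI)
  fix a y assume a: "a \<in> I" and "y \<in> carrier C"
  then obtain x where x: "x \<in> carrier M" "y = g x" using assms(4) by blast
  have "g (a \<odot>\<^bsub>M\<^esub> x) = \<zero>\<^bsub>C\<^esub>" using assms(5) a x(1) by (simp add: mem_kernel)
  moreover have "a \<in> carrier R" using a assms(6) by blast
  ultimately show "a \<odot>\<^bsub>C\<^esub> y = \<zero>\<^bsub>C\<^esub>" using hom_smult[OF assms(3)] x by metis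
qed

lemma zero_of_killed:
  assumes "right_module R M" "\<forall>a\<in>rad_power R 0. \<forall>x\<in>carrier M. a \<odot>\<^bsub>M\<^esub> x = \<zero>\<^bsub>M\<^esub>"
  shows "carrier M = {\<zero>\<^bsub>M\<^esub>}"
proof -
  interpret M: right_module R M by fact
  have "x = \<zero>\<^bsub>M\<^esub>" if "x \<in> carrier M" for x
  proof -
    have "\<one> \<odot>\<^bsub>M\<^esub> x = \<zero>\<^bsub>M\<^esub>" using assms(2) that one_closed by (simp only: rad_power.simps)
    then show ?thesis using that by simp
  qed
  then show ?thesis by auto
qed

text \<open>The socle is finitely generated by semisimplicity, the quotient by induction.\<close>

lemma dcc_imp_fin_gen:
  fixes M :: "('r, 'm) module"
  assumes "right_module R M" "dcc R M" "\<forall>a\<in>rad_power R n. \<forall>x\<in>carrier M. a \<odot>\<^bsub>M\<^esub> x = \<zero>\<^bsub>M\<^esub>"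
  shows "fin_gen R M"
  using assms
proof (induction n arbitrary: M)
  case 0
  have "generated R M {} = carrier M" using generated_empty[OF 0(1)] zero_of_killed[OF 0(1,3)] by simp
  then show ?case unfolding fin_gen_generated[OF 0(1)] by (intro exI[of _ "{}"]) simp
next
  case (Suc n)
  note M = Suc.prems(1) and kill = Suc.prems(3)
  let ?H = "{x \<in> carrier M. \<forall>j\<in>jacobson_rad R. j \<odot>\<^bsub>M\<^esub> x = \<zero>\<^bsub>M\<^esub>}"
  note H = socle_layer[OF M kill]
  obtain C :: "('r, 'm) module" and g where C: "right_module R C" "g \<in> rmod_hom R M C" "g ` carrier M = carrier C" "a_kernel M C g = ?H"
    by (rule quotient_exists[OF M H(1)])
  have "\<forall>a\<in>rad_power R n. \<forall>y\<in>carrier C. a \<odot>\<^bsub>C\<^esub> y = \<zero>\<^bsub>C\<^esub>"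
    using H(2) ideal.Icarr[OF rad_power_ideal] by (intro quotient_killed[OF M C(1-3)]) (auto simp: C(4))
  then have "fin_gen R C" by (intro Suc.IH[OF C(1) dcc_image[OF M C(1-3) Suc.prems(2)]])
  moreover have "fin_gen R (M\<lparr>carrier := a_kernel M C g\<rparr>)"
    unfolding C(4) by (intro semisimple_fin_gen submodule_module[OF M H(1)] dcc_submodule[OF M Suc.prems(2) H(1)]) simp
  ultimately show ?case by (intro fin_gen_extension[OF M C(1-3)])
qed

lemma noetherian: "noetherian_modules R"
proof (intro noetherian_modules.intro noetherian_modules_axioms.intro ring_axioms)
  fix M :: "'r fgmod" and H assume M: "M \<in> mod_cat R" and H: "submodule H R M"
  note rm = mod_catD[OF M]
  interpret M: right_module R M by (rule rm)
  show "fin_gen R (M\<lparr>carrier := H\<rparr>)"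
  proof (rule dcc_imp_fin_gen[OF submodule_module[OF rm(1) H]])
    show "dcc R (M\<lparr>carrier := H\<rparr>)"
      by (rule dcc_submodule[OF rm(1) dcc_fin_gen[OF rm(1) right_dcc rm(2)] H])
    show "\<forall>a\<in>rad_power R (loewy_length R). \<forall>x\<in>carrier (M\<lparr>carrier := H\<rparr>).
        a \<odot>\<^bsub>M\<lparr>carrier := H\<rparr>\<^esub> x = \<zero>\<^bsub>M\<lparr>carrier := H\<rparr>\<^esub>"
      using subsetD[OF submodule_subset[OF H]] by (simp add: rad_power_loewy_length)
  qed
qed

sublocale noetherian_modules R by (rule noetherian)

section \<open>Loewy filtrations\<close>

lemma simple_elt_module:
  assumes M: "right_module R M" and u: "simple_elt R M u" "u \<noteq> \<zero>\<^bsub>M\<^esub>"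
  shows "simple_rmodule R (M\<lparr>carrier := (\<lambda>a. a \<odot>\<^bsub>M\<^esub> u) ` carrier R\<rparr>)" (is "simple_rmodule R ?L")
    and "submodule ((\<lambda>a. a \<odot>\<^bsub>M\<^esub> u) ` carrier R) R M" (is "submodule ?U R M")
proof -
  interpret M: right_module R M by (rule M)
  have uc: "u \<in> carrier M" using u(1) by (simp add: simple_elt_def)
  have "a \<odot>\<^bsub>M\<^esub> u \<oplus>\<^bsub>M\<^esub> \<zero>\<^bsub>M\<^esub> = a \<odot>\<^bsub>M\<^esub> u" if "a \<in> carrier R" for a using uc that by simp
  then have "cyclic_sum R M u {\<zero>\<^bsub>M\<^esub>} = ?U" unfolding cyclic_sum_def by force
  then show U: "submodule ?U R M"
    using cyclic_sum_submodule[OF M submodule_singleton_zero[OF M] uc] by simp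
  have uU: "u \<in> ?U" using uc by (intro image_eqI[of _ _ \<one>]) simp_all
  have "H = {\<zero>\<^bsub>M\<^esub>} \<or> H = ?U" if "submodule H R ?L" for H
  proof -
    have H: "submodule H R M" "H \<subseteq> ?U" using that submodule_trans_iff[OF M U] by blast+
    show ?thesis
    proof (cases "u \<in> H")
      case True
      then show ?thesis using H submodule_smult[OF H(1)] by blast
    next
      case False
      then show ?thesis using H simple_elt_dichotomy[OF M H(1) u(1)] submodule_zero[OF H(1)] by blast
    qed
  qed
  then show "simple_rmodule R ?L"
    unfolding simple_rmodule_def using submodule_module[OF M U] uU u(2) by auto
qed

text \<open>Adjoining the generators of simple submodules one at a time, each either lies in the submodule
  generated so far or adds a simple direct summand.\<close>

lemma resolved_semisimple:
  assumes simp: "\<forall>L\<in>mod_cat R. simple_rmodule R L \<longrightarrow> resolved R t k L"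
    and M: "M \<in> mod_cat R" and J: "\<forall>j\<in>jacobson_rad R. \<forall>x\<in>carrier M. j \<odot>\<^bsub>M\<^esub> x = \<zero>\<^bsub>M\<^esub>"
  shows "resolved R t k M"
proof -
  note rm = mod_catD(1)[OF M]
  interpret M: right_module R M by (rule rm)
  let ?S = "{u. simple_elt R M u}"
  have Sc: "?S \<subseteq> carrier M" by (auto simp: simple_elt_def)
  have res: "resolved R t k (M\<lparr>carrier := generated R M A\<rparr>)" if "finite A" "A \<subseteq> ?S" for A
    using that
  proof (induction A rule: finite_induct)
    case empty
    show ?case
      unfolding generated_empty[OF rm] by (rule resolved_zero[OF zero_submodule_mod_cat[OF M]]) simp
  next
    case (insert u A)
    then have u: "simple_elt R M u" and A: "A \<subseteq> ?S" by auto
    have uc: "u \<in> carrier M" and Ac: "A \<subseteq> carrier M" using u A Sc by auto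
    let ?H = "generated R M A" and ?U = "(\<lambda>a. a \<odot>\<^bsub>M\<^esub> u) ` carrier R"
    note H = generated_submodule[OF rm Ac]
    have G: "generated R M (insert u A) = cyclic_sum R M u ?H" using uc Ac by (intro generated_insert[OF rm]) simp
    note GS = cyclic_sum_submodule[OF rm H uc]
    show ?case
    proof (cases "u \<in> ?H")
      case True
      then have "cyclic_sum R M u ?H = ?H"
        using cyclic_sum_superset[OF rm H uc] submodule_add[OF H] submodule_smult[OF H] by (auto simp: cyclic_sum_def)
      then show ?thesis using insert.IH[OF A] G by simp
    next
      case False
      then have u0: "u \<noteq> \<zero>\<^bsub>M\<^esub>" using submodule_zero[OF H] by auto
      note L = simple_elt_module[OF rm u u0]
      let ?Z = "M\<lparr>carrier := cyclic_sum R M u ?H\<rparr>"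
      have UZ: "?U \<subseteq> cyclic_sum R M u ?H"
        using submodule_smult[OF GS] cyclic_sum_mem[OF rm H uc] by auto
      have sub: "submodule ?U R ?Z" "submodule ?H R ?Z"
        using L(2) H UZ cyclic_sum_superset[OF rm H uc] submodule_trans_iff[OF rm GS] by simp_all
      have sum: "?U <+>\<^bsub>?Z\<^esub> ?H = carrier ?Z" unfolding set_add_def' by (auto simp: cyclic_sum_def)
      have int: "?U \<inter> ?H = {\<zero>\<^bsub>?Z\<^esub>}"
        using simple_elt_dichotomy[OF rm H u False] submodule_zero[OF L(2)] submodule_zero[OF H] by auto
      obtain p1 p2 where bp: "biprod R (?Z\<lparr>carrier := ?U\<rparr>) (?Z\<lparr>carrier := ?H\<rparr>) ?Z (\<lambda>x. x) (\<lambda>x. x) p1 p2"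
        by (rule biprod_internal[OF submodule_module[OF rm GS] sub sum int])
      have "resolved R t k (M\<lparr>carrier := ?U\<rparr>)" using simp sub_mod_cat[OF M L(2)] L(1) by blast
      then have "resolved R t k ?Z"
        using resolved_biprod[OF _ _ sub_mod_cat[OF M GS] bp] insert.IH[OF A] by simp
      then show ?thesis unfolding G .
    qed
  qed
  let ?T = "\<Union>{generated R M A | A. finite A \<and> A \<subseteq> ?S}"
  have gs: "submodule (generated R M A) R M" if "A \<subseteq> ?S" for A
    using that Sc by (intro generated_submodule[OF rm]) blast
  have T: "submodule ?T R M"
  proof (rule M.submoduleI)
    show "?T \<subseteq> carrier M" using submodule_subset[OF gs] by blast
    show "\<zero>\<^bsub>M\<^esub> \<in> ?T" using submodule_zero[OF gs, of "{}"] by blast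
    show "a \<odot>\<^bsub>M\<^esub> x \<in> ?T" if "a \<in> carrier R" "x \<in> ?T" for a x
      using submodule_smult[OF gs that(1)] that(2) by blast
    show "x \<oplus>\<^bsub>M\<^esub> y \<in> ?T" if xy: "x \<in> ?T" "y \<in> ?T" for x y
    proof -
      obtain A B where AB: "finite A" "A \<subseteq> ?S" "x \<in> generated R M A" "finite B" "B \<subseteq> ?S" "y \<in> generated R M B"
        using xy by blast
      then have "x \<in> generated R M (A \<union> B)" "y \<in> generated R M (A \<union> B)"
        using generated_mono[of A "A \<union> B" R M] generated_mono[of B "A \<union> B" R M] by auto
      then have "x \<oplus>\<^bsub>M\<^esub> y \<in> generated R M (A \<union> B)" using AB(2,5) by (intro submodule_add[OF gs]) auto
      moreover have "finite (A \<union> B)" "A \<union> B \<subseteq> ?S" using AB by auto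
      ultimately show ?thesis by blast
    qed
  qed
  have "\<forall>u. simple_elt R M u \<longrightarrow> u \<in> ?T"
  proof (intro allI impI)
    fix u assume u: "simple_elt R M u"
    then have "u \<in> generated R M {u}" using generated_superset[OF rm, of "{u}"] Sc by auto
    then show "u \<in> ?T" using u by blast
  qed
  then have TM: "?T = carrier M" by (rule semisimple_generated[OF rm T _ J])
  obtain X where X: "X \<subseteq> carrier M" "finite X" "generated R M X = carrier M"
    using mod_catD(2)[OF M] unfolding fin_gen_generated[OF rm] by blast
  have ex: "\<exists>A. finite A \<and> A \<subseteq> ?S \<and> Y \<subseteq> generated R M A" if "finite Y" "Y \<subseteq> carrier M" for Y
    using that
  proof (induction Y rule: finite_induct)
    case empty show ?case by (intro exI[of _ "{}"]) simp
  next
    case (insert y Y)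
    obtain A where A: "finite A" "A \<subseteq> ?S" "Y \<subseteq> generated R M A" using insert by auto
    have "y \<in> ?T" using insert.prems TM by simp
    then obtain B where B: "finite B" "B \<subseteq> ?S" "y \<in> generated R M B" by blast
    have "insert y Y \<subseteq> generated R M (A \<union> B)"
      using A(3) B(3) generated_mono[of A "A \<union> B" R M] generated_mono[of B "A \<union> B" R M] by auto
    then show ?case using A B by (intro exI[of _ "A \<union> B"]) auto
  qed
  obtain A where A: "finite A" "A \<subseteq> ?S" "X \<subseteq> generated R M A" using ex[OF X(2,1)] by (elim exE conjE)
  have "carrier M \<subseteq> generated R M A" unfolding X(3)[symmetric] by (rule generated_least[OF gs[OF A(2)] A(3)])
  then have "generated R M A = carrier M" using submodule_subset[OF gs[OF A(2)]] by blast
  then show ?thesis using res[OF A(1,2)] by simp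
qed

theorem resolved_loewy:
  assumes simp: "\<forall>L\<in>mod_cat R. simple_rmodule R L \<longrightarrow> resolved R t k L"
    and "M \<in> mod_cat R" "\<forall>a\<in>rad_power R n. \<forall>x\<in>carrier M. a \<odot>\<^bsub>M\<^esub> x = \<zero>\<^bsub>M\<^esub>"
  shows "resolved R (n * t) k M"
  using assms(2,3)
proof (induction n arbitrary: M)
  case 0
  then show ?case using zero_of_killed[OF mod_catD(1)[OF 0(1)] 0(2)] by simp
next
  case (Suc n)
  note M = Suc.prems(1) and rm = mod_catD[OF Suc.prems(1)] and kill = Suc.prems(2)
  let ?H = "{x \<in> carrier M. \<forall>j\<in>jacobson_rad R. j \<odot>\<^bsub>M\<^esub> x = \<zero>\<^bsub>M\<^esub>}"
  note H = socle_layer[OF rm(1) kill]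
  obtain C :: "'r fgmod" and g where C: "right_module R C" "g \<in> rmod_hom R M C" "g ` carrier M = carrier C" "a_kernel M C g = ?H"
    by (rule quotient_exists[OF rm(1) H(1)])
  have Cm: "C \<in> mod_cat R" using C(1) fin_gen_image[OF rm(1) C(1-3) rm(2)] by (simp add: mod_cat_def)
  have "\<forall>a\<in>rad_power R n. \<forall>y\<in>carrier C. a \<odot>\<^bsub>C\<^esub> y = \<zero>\<^bsub>C\<^esub>"
    using H(2) ideal.Icarr[OF rad_power_ideal] by (intro quotient_killed[OF rm(1) C(1-3)]) (auto simp: C(4))
  then have "resolved R (n * t) k C" by (rule Suc.IH[OF Cm])
  moreover have "resolved R t k (Ker M C g)"
    unfolding C(4) by (intro resolved_semisimple[OF simp] sub_mod_cat[OF M H(1)]) simp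
  ultimately have "resolved R (t + n * t) k M"
    using C(2,3) by (intro resolved_extension[of t k M C g "n * t"] M) (simp_all add: surj_hom_def)
  then show ?case by simp
qed

end

theorem lemma4p14:
  fixes S :: "('s, 'x) ring_scheme" and R :: "('s, 'r, 'y) module_scheme" and k :: nat
  assumes "artin_algebra S R" and "k \<ge> 1"
  shows "(\<forall>m::nat. ddell_ring R k = enat m \<longrightarrow>
            gddell R k \<le> enat (loewy_length R * (m + 1) - 1)) \<and>
         (ddell_ring R k < \<infinity> \<longleftrightarrow> gddell R k < \<infinity>)"
proof -
  interpret right_artinian R
    by (intro right_artinian.intro right_artinian_axioms.intro artin_algebra.axioms(1)[OF assms(1)]
        artin_algebra_dcc[OF assms(1)])
  have bound: "gddell R k \<le> enat (loewy_length R * (m + 1) - 1)" if m: "ddell_ring R k = enat m" for m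
    unfolding gddell_def
  proof (rule Sup_least)
    fix e assume "e \<in> {ddell R k M | M. M \<in> mod_cat R}"
    then obtain M where M: "M \<in> mod_cat R" "e = ddell R k M" by blast
    interpret M: right_module R M using M(1) by (rule mod_catD)
    have "\<forall>L\<in>mod_cat R. simple_rmodule R L \<longrightarrow> resolved R (Suc m) k L"
    proof (intro ballI impI)
      fix L assume L: "L \<in> mod_cat R" "simple_rmodule R L"
      then have "ddell R k L \<le> ddell_ring R k" unfolding ddell_ring_def by (intro Sup_upper) blast
      then show "resolved R (Suc m) k L" using ddell_le_iff_resolved[OF L(1)] m by simp
    qed
    then have res: "resolved R (loewy_length R * Suc m) k M"
      by (rule resolved_loewy[OF _ M(1)]) (simp add: rad_power_loewy_length)
    show "e \<le> enat (loewy_length R * (m + 1) - 1)"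
    proof (cases "loewy_length R")
      \<comment> \<open>Here the ring is zero, so all modules vanish, and truncated subtraction makes the bound \<open>0\<close>.\<close>
      case 0
      then have "carrier M = {\<zero>\<^bsub>M\<^esub>}" using res by simp
      then have "resolved R (Suc (loewy_length R * (m + 1) - 1)) k M" by (rule resolved_zero[OF M(1)])
      then show ?thesis unfolding M(2) ddell_le_iff_resolved[OF M(1)] .
    next
      case (Suc l)
      then have "loewy_length R * Suc m = Suc (loewy_length R * (m + 1) - 1)" by simp
      then show ?thesis using res ddell_le_iff_resolved[OF M(1)] M(2) by metis
    qed
  qed
  have "ddell_ring R k \<le> gddell R k" unfolding ddell_ring_def gddell_def by (rule Sup_subset_mono) blast
  moreover have "gddell R k < \<infinity>" if fin: "ddell_ring R k < \<infinity>"
  proof -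
    obtain m where "ddell_ring R k = enat m" using fin by (cases "ddell_ring R k") simp_all
    from bound[OF this] show ?thesis by (rule le_less_trans) simp
  qed
  ultimately show ?thesis using bound by (blast intro: le_less_trans)
qed

end
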